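(* Let $\mu\subset\lambda$ be partitions, let $L_1,\dots,L_k$ be the Kreiman outer decomposition of $\lambda/\mu$, and let $P$ be the poset on $\{L_1,\dots,L_k\}$ with the relation $<$ ("strictly below"). Suppose that: (i) $P$ is a ranked poset; (ii) if $L_i<L_j$, then in $L_j$ the first step is an up step, the last step is a down step and every peak is a $\lambda$-high peak. Let $s_i$ (resp. $t_i$) be the first (resp. last) cell in $L_i$ and let $r_i$ be the rank of $L_i$ in $P$. Then \[ \sum_{\pi\in\mathrm{RPP}(\lambda/\mu)} q^{|\pi|} = q^{-\sum_{i=1}^k r_i|L_i|} \det \left( E_\lambda(s_i,t_j;q)\right)_{i,j=1}^k, \] where \[ E_\lambda(s_i,t_j;q) = \sum_{\pi\in \mathrm{RPP}(L_\lambda(s_i,t_j))} q^{|\pi|} = \sum_{D\in\mathrm{Dyck}_\lambda(s_i,t_j)} \ \prod_{u\in D} \frac1{1-q^{h(u)}} \prod_{u\in\mathcal V(D)} q^{h(u)}, \] which is understood to be $0$ when $\mathrm{Dyck}_\lambda(s_i,t_j)=\emptyset$.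
   Context: Partitions are identified with Young diagrams; $(i,j)\in\lambda$ is the cell in row $i$ (from the top), column $j$ (from the left). $\lambda/\mu$ is the set difference of diagrams. $h(u)$ is the hook length in $\lambda$: $h(i,j)=\lambda_i+\lambda'_j-i-j+1$, with $\lambda'$ the transpose. $\mathrm{RPP}$ of a skew shape: set of fillings by nonnegative integers weakly increasing along rows and down columns; $|\pi|$ is the sum of entries. A $\lambda$-Dyck path is a sequence $(u_0,\dots,u_m)$ of cells of $\lambda$ such that each step $(u_{i-1},u_i)$ is an up step ($u_i-u_{i-1}=(-1,0)$) or a down step ($u_i-u_{i-1}=(0,1)$). $\mathrm{Dyck}_\lambda(s,t)$ is the set of $\lambda$-Dyck paths starting at cell $s$ and ending at cell $t$. If $s$ is the southmost cell of a column of $\lambda$ and $t$ the eastmost cell of a row of $\lambda$, $L_\lambda(s,t)$ is the lowest path in $\mathrm{Dyck}_\lambda(s,t)$ (on every diagonal it is as far southeast as possible); its set of cells is a skew shape (border strip). Paths are also regarded as sets of cells; $|L|$ is the number of cells of $L$. For a $\lambda$-Dyck path $D=(u_0,\dots,u_m)$ and $1\le i\le m-1$: $u_i$ is a peak if $(u_{i-1},u_i)$ is an up step and $(u_i,u_{i+1})$ is a down step; a valley if $(u_{i-1},u_i)$ is a down step and $(u_i,u_{i+1})$ is an up step. A peak $u_i$ is a $\lambda$-high peak if $u_i+(1,1)\in\lambda$. $\mathcal V(D)$ is the set of valleys. For $\lambda$-Dyck paths, $D_1\le D_2$ ("weakly below") means: for every cell $u\in D_1$ there is an integer $k\ge0$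 with $u-(k,k)\in D_2$; and every $u\in D_1\cap D_2$ is a peak of $D_1$ and a valley of $D_2$. $D_1<D_2$ ("strictly below") means $D_1\le D_2$ and $D_1\cap D_2=\emptyset$. The Kreiman outer decomposition of $\lambda/\mu$ is the (unique up to permutation) sequence $L_1,\dots,L_k$ of mutually disjoint nonempty $\lambda$-Dyck paths such that each $L_i$ starts at the southmost cell of a column of $\lambda$ and ends at the eastmost cell of a row of $\lambda$, and $L_1\cup\dots\cup L_k=\lambda/\mu$. A poset $P$ is ranked if there is a (necessarily unique) function $r:P\to\{0,1,2,\dots\}$ with $r(x)=0$ for every minimal $x$ and $r(y)=r(x)+1$ whenever $y$ covers $x$; $r(x)$ is the rank of $x$. *)

theory Defs
  imports
    "Jordan_Normal_Form.Determinant"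
    "HOL-Computational_Algebra.Formal_Laurent_Series"
begin

type_synonym cell = "nat \<times> nat"


section \<open>Partitions and Young diagrams\<close>

definition int_partition :: "nat list \<Rightarrow> bool" where
  "int_partition lam \<longleftrightarrow> sorted_wrt (\<ge>) lam \<and> (\<forall>p\<in>set lam. 0 < p)"

text \<open>Parts, rows and columns are numbered from 1; lists are indexed from 0.\<close>

definition part :: "nat list \<Rightarrow> nat \<Rightarrow> nat" where
  "part lam i = (if 1 \<le> i \<and> i \<le> length lam then lam ! (i - 1) else 0)"

definition diagram :: "nat list \<Rightarrow> cell set" where
  "diagram lam = {(i, j). 1 \<le> i \<and> i \<le> length lam \<and> 1 \<le> j \<and> j \<le> part lam i}"

definition conj_part :: "nat list \<Rightarrow> nat \<Rightarrow> nat" where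
  "conj_part lam j = card {i. (i, j) \<in> diagram lam}"

text \<open>The subtraction of natural numbers is exact for the cells of the diagram.\<close>

definition hook_length :: "nat list \<Rightarrow> cell \<Rightarrow> nat" where
  "hook_length lam = (\<lambda>(i, j). part lam i + conj_part lam j + 1 - i - j)"

definition southmost_of_column :: "nat list \<Rightarrow> cell \<Rightarrow> bool" where
  "southmost_of_column lam u \<longleftrightarrow>
     u \<in> diagram lam \<and> (\<forall>v\<in>diagram lam. snd v = snd u \<longrightarrow> fst v \<le> fst u)"

definition eastmost_of_row :: "nat list \<Rightarrow> cell \<Rightarrow> bool" where
  "eastmost_of_row lam u \<longleftrightarrow>
     u \<in> diagram lam \<and> (\<forall>v\<in>diagram lam. fst v = fst u \<longrightarrow> snd v \<le> snd u)"


section \<open>Reverse plane partitions\<close>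

text \<open>A filling of a shape is a function on all cells that vanishes outside the shape, so that
  distinct functions are distinct fillings.\<close>

definition RPP :: "cell set \<Rightarrow> (cell \<Rightarrow> nat) set" where
  "RPP S = {\<pi>. (\<forall>u. u \<notin> S \<longrightarrow> \<pi> u = 0) \<and>
     (\<forall>u\<in>S. \<forall>v\<in>S. fst u = fst v \<and> snd u \<le> snd v \<longrightarrow> \<pi> u \<le> \<pi> v) \<and>
     (\<forall>u\<in>S. \<forall>v\<in>S. snd u = snd v \<and> fst u \<le> fst v \<longrightarrow> \<pi> u \<le> \<pi> v)}"

text \<open>The formal power series $\sum_{\pi \in \mathrm{RPP}(S)} q^{|\pi|}$ of a finite shape $S$,
  with $q$ the indeterminate.\<close>

definition RPP_gf :: "cell set \<Rightarrow> rat fps" where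
  "RPP_gf S = Abs_fps (\<lambda>n. of_nat (card {\<pi> \<in> RPP S. (\<Sum>u\<in>S. \<pi> u) = n}))"


section \<open>Dyck paths in a diagram\<close>

definition up_step :: "cell \<Rightarrow> cell \<Rightarrow> bool" where
  "up_step u v \<longleftrightarrow> fst v + 1 = fst u \<and> snd v = snd u"

definition down_step :: "cell \<Rightarrow> cell \<Rightarrow> bool" where
  "down_step u v \<longleftrightarrow> fst v = fst u \<and> snd v = snd u + 1"

definition dyck_path :: "nat list \<Rightarrow> cell list \<Rightarrow> bool" where
  "dyck_path lam D \<longleftrightarrow> D \<noteq> [] \<and> set D \<subseteq> diagram lam \<and>
     (\<forall>i. i + 1 < length D \<longrightarrow> up_step (D ! i) (D ! (i + 1)) \<or> down_step (D ! i) (D ! (i + 1)))"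

definition Dyck :: "nat list \<Rightarrow> cell \<Rightarrow> cell \<Rightarrow> cell list set" where
  "Dyck lam s t = {D. dyck_path lam D \<and> hd D = s \<and> last D = t}"

definition peaks :: "cell list \<Rightarrow> cell set" where
  "peaks D = {D ! i | i. 0 < i \<and> i + 1 < length D \<and>
     up_step (D ! (i - 1)) (D ! i) \<and> down_step (D ! i) (D ! (i + 1))}"

definition valleys :: "cell list \<Rightarrow> cell set" where
  "valleys D = {D ! i | i. 0 < i \<and> i + 1 < length D \<and>
     down_step (D ! (i - 1)) (D ! i) \<and> up_step (D ! i) (D ! (i + 1))}"

definition high_peaks :: "nat list \<Rightarrow> cell list \<Rightarrow> cell set" where
  "high_peaks lam D = {u \<in> peaks D. (fst u + 1, snd u + 1) \<in> diagram lam}"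

definition first_step_up :: "cell list \<Rightarrow> bool" where
  "first_step_up D \<longleftrightarrow> 2 \<le> length D \<and> up_step (D ! 0) (D ! 1)"

definition last_step_down :: "cell list \<Rightarrow> bool" where
  "last_step_down D \<longleftrightarrow> 2 \<le> length D \<and> down_step (D ! (length D - 2)) (D ! (length D - 1))"

text \<open>The equation between sums says that the two cells lie on the same diagonal.\<close>

definition lowest_path :: "nat list \<Rightarrow> cell \<Rightarrow> cell \<Rightarrow> cell list" where
  "lowest_path lam s t = (THE L. L \<in> Dyck lam s t \<and>
     (\<forall>D\<in>Dyck lam s t. \<forall>u\<in>set L. \<forall>v\<in>set D. fst u + snd v = fst v + snd u \<longrightarrow> fst v \<le> fst u))"

text \<open>The condition $u - (k,k) \in D_2$ is written $u = v + (k,k)$ with $v \in D_2$.\<close>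

definition weakly_below :: "cell list \<Rightarrow> cell list \<Rightarrow> bool" where
  "weakly_below D1 D2 \<longleftrightarrow>
     (\<forall>u\<in>set D1. \<exists>k. \<exists>v\<in>set D2. u = (fst v + k, snd v + k)) \<and>
     (\<forall>u\<in>set D1 \<inter> set D2. u \<in> peaks D1 \<and> u \<in> valleys D2)"

definition strictly_below :: "cell list \<Rightarrow> cell list \<Rightarrow> bool" where
  "strictly_below D1 D2 \<longleftrightarrow> weakly_below D1 D2 \<and> set D1 \<inter> set D2 = {}"


section \<open>The Kreiman outer decomposition\<close>

definition kreiman_outer_decomposition :: "nat list \<Rightarrow> nat list \<Rightarrow> cell list list \<Rightarrow> bool" where
  "kreiman_outer_decomposition lam mu Ls \<longleftrightarrow>
     (\<forall>L\<in>set Ls. dyck_path lam L \<and> southmost_of_column lam (hd L) \<and> eastmost_of_row lam (last L)) \<and>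
     (\<forall>i<length Ls. \<forall>j<length Ls. i \<noteq> j \<longrightarrow> set (Ls ! i) \<inter> set (Ls ! j) = {}) \<and>
     (\<Union>L\<in>set Ls. set L) = diagram lam - diagram mu"


section \<open>Ranked posets\<close>

text \<open>A poset is given by its carrier and its strict order.\<close>

definition minimal_in :: "'a set \<Rightarrow> ('a \<Rightarrow> 'a \<Rightarrow> bool) \<Rightarrow> 'a \<Rightarrow> bool" where
  "minimal_in A lt x \<longleftrightarrow> x \<in> A \<and> (\<forall>y\<in>A. \<not> lt y x)"

definition covers_in :: "'a set \<Rightarrow> ('a \<Rightarrow> 'a \<Rightarrow> bool) \<Rightarrow> 'a \<Rightarrow> 'a \<Rightarrow> bool" where
  "covers_in A lt y x \<longleftrightarrow> x \<in> A \<and> y \<in> A \<and> lt x y \<and> (\<forall>z\<in>A. \<not> (lt x z \<and> lt z y))"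

definition is_rank_function :: "'a set \<Rightarrow> ('a \<Rightarrow> 'a \<Rightarrow> bool) \<Rightarrow> ('a \<Rightarrow> nat) \<Rightarrow> bool" where
  "is_rank_function A lt r \<longleftrightarrow>
     (\<forall>x. minimal_in A lt x \<longrightarrow> r x = 0) \<and> (\<forall>x y. covers_in A lt y x \<longrightarrow> r y = r x + 1)"

definition ranked :: "'a set \<Rightarrow> ('a \<Rightarrow> 'a \<Rightarrow> bool) \<Rightarrow> bool" where
  "ranked A lt \<longleftrightarrow> (\<exists>r. is_rank_function A lt r)"

text \<open>On the carrier of a finite poset, all rank functions agree.\<close>

definition poset_rank :: "'a set \<Rightarrow> ('a \<Rightarrow> 'a \<Rightarrow> bool) \<Rightarrow> 'a \<Rightarrow> nat" where
  "poset_rank A lt = (SOME r. is_rank_function A lt r)"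

text \<open>The paths of a Kreiman outer decomposition always form a poset under
  \<^const>\<open>strictly_below\<close>, so \<^const>\<open>ranked\<close> need not demand the order axioms.\<close>

lemma dyck_path_diagonal:
  assumes "dyck_path lam D" "i < length D"
  shows "fst (D ! i) + snd (D ! 0) + i = fst (D ! 0) + snd (D ! i)"
  using assms(2)
proof (induction i)
  case (Suc i)
  then have "up_step (D ! i) (D ! (i + 1)) \<or> down_step (D ! i) (D ! (i + 1))"
    using assms(1) by (simp add: dyck_path_def)
  then show ?case
    using Suc by (auto simp: up_step_def down_step_def)
qed simp

lemma dyck_path_diagonal_unique:
  assumes "dyck_path lam D" "u \<in> set D" "v \<in> set D" "fst u + snd v = fst v + snd u"
  shows "u = v"
proof -
  obtain i j where ij: "i < length D" "u = D ! i" "j < length D" "v = D ! j"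
    using assms(2,3) by (metis in_set_conv_nth)
  have "i = j"
    using dyck_path_diagonal[OF assms(1) ij(1)] dyck_path_diagonal[OF assms(1) ij(3)]
      assms(4)[unfolded ij(2,4)]
    by linarith
  then show ?thesis using ij by simp
qed

lemma kreiman_irreflp_strictly_below:
  assumes "kreiman_outer_decomposition lam mu Ls"
  shows "irreflp_on (set Ls) strictly_below"
proof (rule irreflp_onI)
  fix L
  assume "L \<in> set Ls"
  then have "L \<noteq> []"
    using assms by (simp add: kreiman_outer_decomposition_def dyck_path_def)
  then show "\<not> strictly_below L L"
    by (simp add: strictly_below_def)
qed

lemma strictly_belowE:
  assumes "strictly_below A B" "u \<in> set A"
  obtains k v where "v \<in> set B" "u = (fst v + k, snd v + k)"
proof -
  have "\<exists>k. \<exists>v\<in>set B. u = (fst v + k, snd v + k)"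
    using assms by (simp only: strictly_below_def weakly_below_def)
  then show ?thesis using that by (elim exE bexE)
qed

lemma kreiman_transp_strictly_below:
  assumes K: "kreiman_outer_decomposition lam mu Ls"
  shows "transp_on (set Ls) strictly_below"
proof (rule transp_onI)
  fix A B C
  assume mem: "A \<in> set Ls" "B \<in> set Ls" "C \<in> set Ls"
    and AB: "strictly_below A B" and BC: "strictly_below B C"
  have dA: "dyck_path lam A" using K mem by (simp add: kreiman_outer_decomposition_def)
  have step: "\<exists>k l. \<exists>w\<in>set C. u = (fst w + k + l, snd w + k + l) \<and> (fst w + k, snd w + k) \<in> set B"
    if uA: "u \<in> set A" for u
  proof -
    obtain l v where v: "v \<in> set B" "u = (fst v + l, snd v + l)"
      by (rule strictly_belowE[OF AB uA])
    obtain k w where w: "w \<in> set C" "v = (fst w + k, snd w + k)"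
      by (rule strictly_belowE[OF BC v(1)])
    have "u = (fst w + k + l, snd w + k + l)" "(fst w + k, snd w + k) \<in> set B"
      using v w by simp_all
    then show ?thesis using w(1) by (intro exI bexI conjI)
  qed
  have "A \<noteq> C"
  proof
    assume "A = C"
    have "hd A \<in> set A" using dA by (simp add: dyck_path_def)
    then obtain u where u: "u \<in> set A" ..
    obtain k l w where w: "w \<in> set C" "u = (fst w + k + l, snd w + k + l)" "(fst w + k, snd w + k) \<in> set B"
      using step[OF u] by (elim exE bexE conjE)
    have "u = w"
      using dyck_path_diagonal_unique[OF dA u, of w] w(1,2) \<open>A = C\<close> by simp
    then have "k = 0" "l = 0" using w(2) by (simp_all add: prod_eq_iff)
    then have "u \<in> set B" using w(2,3) by simp
    then show False using AB u unfolding strictly_below_def by blast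
  qed
  then have "set A \<inter> set C = {}"
  proof -
    obtain i j where ij: "i < length Ls" "A = Ls ! i" "j < length Ls" "C = Ls ! j"
      using mem by (auto simp: in_set_conv_nth)
    then have "i \<noteq> j" using \<open>A \<noteq> C\<close> by blast
    then show ?thesis
      using K ij unfolding kreiman_outer_decomposition_def by blast
  qed
  moreover have "\<exists>k. \<exists>w\<in>set C. u = (fst w + k, snd w + k)" if uA: "u \<in> set A" for u
  proof -
    obtain k l w where w: "w \<in> set C" "u = (fst w + k + l, snd w + k + l)"
      using step[OF uA] by (elim exE bexE conjE)
    then have "u = (fst w + (k + l), snd w + (k + l))" by simp
    then show ?thesis using w(1) by (intro exI bexI)
  qed
  ultimately show "strictly_below A C"
    by (simp add: strictly_below_def weakly_below_def)
qed


section \<open>The entries of the determinant\<close>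

definition E_gf :: "nat list \<Rightarrow> cell \<Rightarrow> cell \<Rightarrow> rat fps" where
  "E_gf lam s t = (if Dyck lam s t = {} then 0 else RPP_gf (set (lowest_path lam s t)))"

end

theory Submission
  imports Defs
begin

text \<open>The proof has three parts: a signless evaluation of the determinant, a comparison of that evaluation
with the reverse plane partitions of \<open>lam / mu\<close> by means of the ranks, and a recursion for the entries.

Number the diagonals by their \<open>content\<close>. The \<open>rim\<close> consists of the lowest cell of each diagonal. A path
\<open>L_i\<close> has one cell for each content in an interval \<open>[a_i, b_i]\<close> and starts and ends on the rim. Disjoint
paths keep their vertical order on common diagonals, so the intervals are nested or disjoint, and \<open>L_j\<close> is
strictly below \<open>L_i\<close> iff the interval of \<open>L_j\<close> lies strictly inside that of \<open>L_i\<close>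
(\<open>paths_nested\<close>, \<open>nested_iff_strictly_below\<close>).

\<^emph>\<open>The determinant.\<close> The entry \<open>E(s_i, t_j)\<close> is the generating function of the reverse plane partitions of
the piece of the rim with contents \<open>[a_i, b_j]\<close>. These are walks with one entry per content that weakly
decrease over the up steps of the rim and weakly increase over its right steps. The determinant of such walk sums
is evaluated one content at a time, starting at the largest: the rows of the active strips are sums over nested
ranges of entries, subtracting neighbouring rows makes the ranges disjoint, and multilinearity yields a sum over
interlacing entries (\<open>stage_step_up\<close>, \<open>stage_step_right\<close>). Since the intervals are nested, each
start is joined with its own end and no sign remains. If strip \<open>i\<close> is placed \<open>depth i\<close> diagonal steps
above the rim, where \<open>depth i\<close> counts the intervals around \<open>[a_i, b_i]\<close>, then the interlacing families are
the fillings \<open>\<eta>\<close> of \<open>lam / mu\<close> for which \<open>\<eta> + level\<close> is a reverse plane partition; the level of a cell is its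
diagonal distance from the rim (\<open>det_strip_gf_fillings\<close>). So the determinant enumerates the reverse plane
partitions \<open>\<pi>' \<ge> level\<close> by \<open>|\<pi>'| - \<Sum> level\<close>. All entries are bounded by some \<open>H\<close>, to keep the sums finite;
the coefficient of \<open>q^n\<close> is not affected if \<open>n \<le> H\<close>.

\<^emph>\<open>The ranks.\<close> Going one step deeper among the strips that are active at a content is a cover relation, so
\<open>r_i + depth i\<close> is the same for all of them, and it is constant on the components of \<open>lam / mu\<close>
(\<open>rank_depth_act\<close>, \<open>offset_order\<close>). Adding this offset maps the reverse plane partitions of
\<open>lam / mu\<close> bijectively onto those \<open>\<pi>'\<close> that are at least the offset. It remains to see that \<open>\<pi>' \<ge> level\<close>
already implies this bound. By monotonicity only the minimal cells of \<open>lam / mu\<close> matter, and there the offset equals the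
level: if the innermost strip active at such a cell had positive rank, the hypothesis on first steps, last
steps and peaks would make its path have a high peak on the rim, where no peak is high (\<open>rank_minimal_cell\<close>). Since offset minus level
is the rank of the strip, the bijection changes the weight by \<open>\<Sum> r_i |L_i|\<close> in total.

\<^emph>\<open>The entries.\<close> Let \<open>f(u)\<close> be the weighted sum over the Dyck paths from \<open>u\<close> to \<open>t\<close>. Splitting off the first
cell gives \<open>(1 - q^h(i,j)) f(i,j) = f(i-1,j) + f(i,j+1) - f(i-1,j+1)\<close> (\<open>Dyck_gf_recursion\<close>). For the other side,
consider the fillings of the rim from the bottom of column \<open>j\<close> on that are constant along the up steps from rows
below row \<open>i\<close>. On the \<open>h(i,j)\<close> contents from the bottom of column \<open>j\<close> to the end of row \<open>i\<close>, one can
subtract 1 unless the first entry is zero or the inequality at the end of row \<open>i\<close> is an equality;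
inclusion-exclusion over these two obstructions gives the same recursion (\<open>wgf_ribbon_fillings\<close>).\<close>

section \<open>Determinants as functions of their rows\<close>

text \<open>Matrices are functions of two indices, so that rows can be updated and compared as functions.\<close>

definition rdet :: "nat \<Rightarrow> (nat \<Rightarrow> nat \<Rightarrow> 'a::comm_ring_1) \<Rightarrow> 'a" where
  "rdet n A = det (mat n n (\<lambda>(i, j). A i j))"

lemma rdet_Leibniz:
  "rdet n A = (\<Sum>p | p permutes {..<n}. signof p * (\<Prod>i<n. A i (p i)))"
proof -
  have "(\<Prod>i<n. mat n n (\<lambda>(i, j). A i j) $$ (i, p i)) = (\<Prod>i<n. A i (p i))"
    if "p permutes {..<n}" for p
    using permutes_in_image[OF that] by (intro prod.cong) auto
  then show ?thesis
    unfolding rdet_def by (subst det_def'[of _ n], simp, unfold atLeast0LessThan, intro sum.cong refl) simp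
qed

lemma rdet_cong:
  assumes "\<And>i j. i < n \<Longrightarrow> j < n \<Longrightarrow> A i j = B i j"
  shows "rdet n A = rdet n B"
  unfolding rdet_def using assms by (intro arg_cong[where f = det]) auto

lemma rdet_transpose: "rdet n (\<lambda>i j. A j i) = rdet n A"
proof -
  have "mat n n (\<lambda>(i, j). A j i) = (mat n n (\<lambda>(i, j). A i j))\<^sup>T" by auto
  then show ?thesis unfolding rdet_def using det_transpose[of "mat n n (\<lambda>(i, j). A i j)" n] by simp
qed

lemma rdet_identity: "rdet n (\<lambda>i j. if j = i then 1 else 0) = 1"
proof -
  have "mat n n (\<lambda>(i, j). if j = i then 1 else 0) = (1\<^sub>m n :: 'a mat)" by auto
  then show ?thesis unfolding rdet_def by simp
qed

lemma rdet_row_diff: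
  assumes "r < n"
  shows "rdet n (A(r := \<lambda>j. u j - v j)) = rdet n (A(r := u)) - rdet n (A(r := v))"
proof -
  have "(\<Prod>i<n. (A(r := w)) i (p i)) = w (p r) * (\<Prod>i\<in>{..<n} - {r}. A i (p i))" for p w
    using assms by (subst prod.remove[of _ r]) (auto intro!: prod.cong)
  then show ?thesis
    unfolding rdet_Leibniz by (simp only: left_diff_distrib right_diff_distrib sum_subtractf)
qed

lemma rdet_equal_rows:
  assumes "r < n" "s < n" "r \<noteq> s" "A r = A s"
  shows "rdet n A = 0"
  unfolding rdet_def by (rule det_identical_rows[of _ n r s]) (use assms in auto)

lemma rdet_subtract_row:
  assumes "r < n" "s < n" "r \<noteq> s"
  shows "rdet n (A(r := \<lambda>j. A r j - A s j)) = rdet n A"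
proof -
  have "rdet n (A(r := A s)) = 0"
    by (rule rdet_equal_rows[OF assms]) (use assms in auto)
  then show ?thesis
    using rdet_row_diff[OF assms(1), of A "A r" "A s"] by simp
qed

text \<open>The row of least measure is treated last. The row to be subtracted from it lies outside \<open>J\<close> and is unchanged,
and up to that moment it was itself available unchanged to the other rows.\<close>

lemma rdet_subtract_rows:
  fixes m :: "nat \<Rightarrow> nat"
  assumes "finite J" "J \<subseteq> {..<n}" "\<And>j. j \<in> J \<Longrightarrow> f j < n \<and> m (f j) < m j"
  shows "rdet n (\<lambda>j. if j \<in> J then (\<lambda>i. A j i - A (f j) i) else A j) = rdet n A"
  using assms
proof (induction "card J" arbitrary: J)
  case 0
  then show ?case by simp
next
  case (Suc c)
  then have "J \<noteq> {}" by auto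
  then obtain j0 where j0: "j0 \<in> J" "\<And>j. j \<in> J \<Longrightarrow> m j0 \<le> m j"
    using ex_is_arg_min_if_finite[OF Suc.prems(1), where f = m] by (auto simp: is_arg_min_linorder)
  define B where "B = (\<lambda>j. if j \<in> J - {j0} then (\<lambda>i. A j i - A (f j) i) else A j)"
  have f0: "f j0 \<notin> J" "f j0 < n" "f j0 \<noteq> j0" "j0 < n"
    using j0 Suc.prems(3)[of j0] j0(2)[of "f j0"] Suc.prems(2) by force+
  have "rdet n A = rdet n B"
    unfolding B_def using Suc.hyps(2) j0(1) Suc.prems
    by (intro Suc.hyps(1)[symmetric]) auto
  also have "\<dots> = rdet n (B(j0 := \<lambda>i. B j0 i - B (f j0) i))"
    using rdet_subtract_row[OF f0(4,2), of B] f0(3) by auto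
  also have "B(j0 := \<lambda>i. B j0 i - B (f j0) i) = (\<lambda>j. if j \<in> J then (\<lambda>i. A j i - A (f j) i) else A j)"
    using f0 j0(1) by (auto simp: B_def fun_eq_iff)
  finally show ?case by simp
qed

text \<open>A Leibniz term that does not use the diagonal entry \<open>1\<close> of column \<open>r\<close> contains a zero of this column, so the
remaining entries of row \<open>r\<close> have no influence.\<close>

lemma rdet_unit_column:
  assumes "r < n" "\<And>j. j < n \<Longrightarrow> A j r = (if j = r then 1 else 0)"
  shows "rdet n (A(r := \<lambda>i. if i = r then 1 else 0)) = rdet n A"
  unfolding rdet_Leibniz
proof (intro sum.cong refl arg_cong2[where f = "(*)"])
  fix p assume "p \<in> {p. p permutes {..<n}}"
  then have p: "p permutes {..<n}" by simp
  show "(\<Prod>i<n. (A(r := \<lambda>i. if i = r then 1 else 0)) i (p i)) = (\<Prod>i<n. A i (p i))"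
  proof (cases "p r = r")
    case True
    then show ?thesis using assms by (intro prod.cong) auto
  next
    case False
    obtain j where j: "j < n" "p j = r"
      using permutes_image[OF p] assms(1) by (metis imageE lessThan_iff)
    with False have "j \<noteq> r" by auto
    then have "(A(r := \<lambda>i. if i = r then 1 else 0)) j (p j) = 0" "A j (p j) = 0"
      using assms j by auto
    then have "(\<Prod>i<n. (A(r := \<lambda>i. if i = r then 1 else 0)) i (p i)) = 0" "(\<Prod>i<n. A i (p i)) = 0"
      using j by (intro prod_zero bexI[of _ j]; simp)+
    then show ?thesis by simp
  qed
qed

lemma rdet_scale_rows:
  assumes "C \<subseteq> {..<n}"
  shows "rdet n (\<lambda>j. if j \<in> C then (\<lambda>i. w j * A j i) else A j) = (\<Prod>j\<in>C. w j) * rdet n A"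
proof -
  have "(\<Prod>j<n. (if j \<in> C then (\<lambda>i. w j * A j i) else A j) (p j)) =
      (\<Prod>j<n. (if j \<in> C then w j else 1)) * (\<Prod>j<n. A j (p j))" for p
    unfolding prod.distrib[symmetric] by (intro prod.cong) auto
  moreover have "(\<Prod>j<n. (if j \<in> C then w j else 1)) = (\<Prod>j\<in>C. w j)"
    using assms by (simp add: prod.If_cases Int_absorb1)
  ultimately show ?thesis
    unfolding rdet_Leibniz by (simp only: sum_distrib_left mult.left_commute)
qed

text \<open>Multilinearity in several rows at once; a choice function picks a summand in each of them.\<close>

lemma rdet_sum_rows:
  fixes A :: "nat \<Rightarrow> nat \<Rightarrow> 'a::comm_ring_1"
  assumes "C \<subseteq> {..<n}" "\<And>j. j \<in> C \<Longrightarrow> finite (I j)"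
  shows "rdet n (\<lambda>j. if j \<in> C then (\<lambda>i. \<Sum>x\<in>I j. g j x i) else A j) =
     (\<Sum>x\<in>PiE C I. rdet n (\<lambda>j. if j \<in> C then g j (x j) else A j))"
proof -
  have C: "finite C" using assms(1) finite_subset by blast
  have split: "(\<Prod>j<n. F j) = (\<Prod>j\<in>C. F j) * (\<Prod>j\<in>{..<n} - C. F j)" for F :: "nat \<Rightarrow> 'a"
    using prod.subset_diff[OF assms(1) finite_lessThan, of F] by (simp add: mult.commute)
  have *: "(\<Prod>j<n. (if j \<in> C then (\<lambda>i. \<Sum>x\<in>I j. g j x i) else A j) (p j)) =
      (\<Sum>x\<in>PiE C I. \<Prod>j<n. (if j \<in> C then g j (x j) else A j) (p j))" for p
  proof -
    have "(\<Prod>j<n. (if j \<in> C then (\<lambda>i. \<Sum>x\<in>I j. g j x i) else A j) (p j)) =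
      (\<Prod>j\<in>C. \<Sum>x\<in>I j. g j x (p j)) * (\<Prod>j\<in>{..<n} - C. A j (p j))"
      by (subst split) (auto intro!: arg_cong2[where f = "(*)"] prod.cong)
    also have "\<dots> = (\<Sum>x\<in>PiE C I. (\<Prod>j\<in>C. g j (x j) (p j)) * (\<Prod>j\<in>{..<n} - C. A j (p j)))"
      by (subst prod_sum_PiE[OF C assms(2)]) (auto simp: sum_distrib_right)
    also have "\<dots> = (\<Sum>x\<in>PiE C I. \<Prod>j<n. (if j \<in> C then g j (x j) else A j) (p j))"
      by (intro sum.cong refl, subst split) (auto intro!: arg_cong2[where f = "(*)"] prod.cong)
    finally show ?thesis .
  qed
  show ?thesis
    unfolding rdet_Leibniz * sum_distrib_left by (rule sum.swap)
qed

section \<open>Determinants of walk sums\<close>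

text \<open>A walk has its first entry at content \<open>s\<close> and one entry for each further content; from one content to the next
the entry weakly decreases where \<open>up\<close> holds and weakly increases elsewhere. For \<open>y \<le> H\<close>, this is the sum of
\<open>q\<close> to the power of the sum of the entries over all walks with entries at most \<open>H\<close> that reach the entry \<open>y\<close>
at content \<open>c\<close>.\<close>

primrec strip_gf :: "'r::comm_ring_1 \<Rightarrow> nat \<Rightarrow> (nat \<Rightarrow> bool) \<Rightarrow> nat \<Rightarrow> nat \<Rightarrow> nat \<Rightarrow> 'r" where
  "strip_gf q H up s 0 y = 0"
| "strip_gf q H up s (Suc c) y =
     q ^ y * (if s = Suc c then 1 else \<Sum>x\<in>(if up c then {y..H} else {..y}). strip_gf q H up s c x)"

lemma strip_gf_before_start: "c < s \<Longrightarrow> strip_gf q H up s c y = 0"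
  by (induction c arbitrary: y) auto

text \<open>The intervals \<open>[a i, b i]\<close> have distinct starts and are nested or disjoint. A start is never reached by an up step, and
an end is always left by one. This is what makes the walk of the innermost interval enter and leave
below all the other walks, so that nesting of intervals and order of entries agree.\<close>

locale strip_family =
  fixes k :: nat and a b :: "nat \<Rightarrow> nat" and up :: "nat \<Rightarrow> bool"
  assumes start_pos: "i < k \<Longrightarrow> 1 \<le> a i"
    and start_le_end: "i < k \<Longrightarrow> a i \<le> b i"
    and start_inj: "i < k \<Longrightarrow> j < k \<Longrightarrow> a i = a j \<Longrightarrow> i = j"
    and nested: "i < k \<Longrightarrow> j < k \<Longrightarrow> a i < a j \<Longrightarrow> a j \<le> b i \<Longrightarrow> b j < b i"
    and start_not_up: "i < k \<Longrightarrow> a i = Suc c \<Longrightarrow> \<not> up c"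
    and end_up: "i < k \<Longrightarrow> up (b i)"
begin

definition act :: "nat \<Rightarrow> nat set" where
  "act c = {i. i < k \<and> a i \<le> c \<and> c \<le> b i}"

lemma finite_act [simp]: "finite (act c)"
  unfolding act_def by simp

lemma act_up: "up c \<Longrightarrow> act (Suc c) \<subseteq> act c"
  using start_not_up by (auto simp: act_def le_Suc_eq)

lemma act_right: "\<not> up c \<Longrightarrow> act c \<subseteq> act (Suc c)"
  using end_up by (force simp: act_def intro: Suc_leI le_neq_implies_less)

lemma act_nested: "i \<in> act c \<Longrightarrow> j \<in> act c \<Longrightarrow> a i < a j \<Longrightarrow> b j < b i"
  using nested by (auto simp: act_def)

text \<open>The entries that strip \<open>j\<close> may have at content \<open>c\<close> when the entries at the next content are given by \<open>y\<close>.
Besides the condition on a walk, they have to interlace with \<open>y\<close>: over an up step with the entries of the strips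
around \<open>j\<close>, over a right step with those of the strips inside \<open>j\<close>.\<close>

definition admissible :: "nat \<Rightarrow> nat \<Rightarrow> (nat \<Rightarrow> nat) \<Rightarrow> nat \<Rightarrow> nat set" where
  "admissible H c y j = {x. x \<le> H \<and> (if up c
     then (j \<in> act (Suc c) \<longrightarrow> y j \<le> x) \<and> (\<forall>j'\<in>act (Suc c). a j' < a j \<longrightarrow> x < y j')
     else x \<le> y j \<and> (\<forall>j'\<in>act (Suc c). a j < a j' \<longrightarrow> y j' < x))}"

definition decreasing_on :: "nat \<Rightarrow> nat \<Rightarrow> (nat \<Rightarrow> nat) \<Rightarrow> bool" where
  "decreasing_on H c y \<longleftrightarrow> (\<forall>j\<in>act c. y j \<le> H) \<and>
     (\<forall>j\<in>act c. \<forall>j'\<in>act c. a j < a j' \<longrightarrow> y j' < y j)"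

lemma finite_admissible [simp]: "finite (admissible H c y j)"
  unfolding admissible_def by (rule finite_subset[of _ "{..H}"]) auto

lemma admissible_decreasing:
  assumes x: "x \<in> PiE (act c) (admissible H c y)"
  shows "decreasing_on H c x"
  unfolding decreasing_on_def
proof (intro conjI ballI impI)
  fix j assume "j \<in> act c"
  then show "x j \<le> H" using x by (auto simp: admissible_def PiE_iff)
next
  fix j j' assume jj: "j \<in> act c" "j' \<in> act c" "a j < a j'"
  have adm: "x j \<in> admissible H c y j" "x j' \<in> admissible H c y j'"
    using x jj by (auto simp: PiE_iff)
  show "x j' < x j"
  proof (cases "up c")
    case True
    have "j \<in> act (Suc c)"
      using act_nested[OF jj] jj by (auto simp: act_def)
    then show ?thesis using adm jj True by (fastforce simp: admissible_def)
  next
    case False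
    have "j' \<in> act (Suc c)" using act_right[OF False] jj by auto
    then show ?thesis using adm jj False by (fastforce simp: admissible_def)
  qed
qed

text \<open>Row \<open>j\<close> is a unit row before the start of strip \<open>j\<close>, the vector of walk sums up to the entry \<open>y j\<close> while
the strip is active, and the vector of sums of complete walks after its end. To the left of all strips this is
the identity matrix, and to the right of them the transpose of the matrix to be evaluated.\<close>

definition stage :: "'r::comm_ring_1 \<Rightarrow> nat \<Rightarrow> nat \<Rightarrow> (nat \<Rightarrow> nat) \<Rightarrow> nat \<Rightarrow> nat \<Rightarrow> 'r" where
  "stage q H c y j = (\<lambda>i. if c < a j then (if i = j then 1 else 0)
     else if c \<le> b j then strip_gf q H up (a i) c (y j)
     else \<Sum>x\<le>H. strip_gf q H up (a i) (b j) x)"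

text \<open>Apart from the weights of the entries at \<open>Suc c\<close>, the row of a strip active at \<open>c\<close> is a sum over the range of all
entries from \<open>y j\<close> to \<open>H\<close>, and these ranges are nested. Subtracting from each row the row of the next strip
around it leaves the part of the range below the entry of that strip, which is the admissible set.\<close>

lemma stage_step_up:
  fixes q :: "'r::comm_ring_1"
  assumes up: "up c" and dec: "decreasing_on H (Suc c) y"
  shows "rdet k (stage q H (Suc c) y) =
    (\<Prod>j\<in>act (Suc c). q ^ y j) * (\<Sum>x\<in>PiE (act c) (admissible H c y). rdet k (stage q H c x))"
proof -
  have no_start: "a i \<noteq> Suc c" if "i < k" for i
    using start_not_up[OF that] up by blast
  \<comment> \<open>a strip that ends at content c has no further entry; its complete walks are the sum from 0 on\<close>
  define y' where "y' = (\<lambda>j. if j \<in> act (Suc c) then y j else 0)"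
  define N where "N = (\<lambda>j i. if j \<in> act c then \<Sum>x\<in>{y' j..H}. strip_gf q H up (a i) c x
     else stage q H (Suc c) y j i)"
  have "rdet k (stage q H (Suc c) y) =
      rdet k (\<lambda>j. if j \<in> act (Suc c) then (\<lambda>i. q ^ y j * N j i) else N j)"
  proof (rule rdet_cong)
    fix j i assume ij: "j < k" "i < k"
    consider "j \<in> act (Suc c)" | "j \<notin> act (Suc c)" "j \<in> act c" | "j \<notin> act c" by blast
    then show "stage q H (Suc c) y j i =
        (if j \<in> act (Suc c) then (\<lambda>i. q ^ y j * N j i) else N j) i"
    proof cases
      case 1
      then have "j \<in> act c" using act_up[OF up] by auto
      then show ?thesis using 1 up no_start[OF ij(2)] no_start[OF ij(1)]
        by (auto simp: N_def stage_def y'_def act_def)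
    next
      case 2
      then have "b j = c" by (auto simp: act_def)
      with 2 show ?thesis by (auto simp: N_def stage_def y'_def act_def atMost_atLeast0)
    next
      case 3
      then have "j \<notin> act (Suc c)" using act_up[OF up] by auto
      with 3 show ?thesis by (simp add: N_def)
    qed
  qed
  also have "\<dots> = (\<Prod>j\<in>act (Suc c). q ^ y j) * rdet k N"
    by (rule rdet_scale_rows) (auto simp: act_def)
  also have "rdet k N = (\<Sum>x\<in>PiE (act c) (admissible H c y). rdet k (stage q H c x))"
  proof -
    define J where "J = {j \<in> act c. \<exists>j'\<in>act (Suc c). a j' < a j}"
    have "\<exists>j'\<in>act (Suc c). a j' < a j \<and> (\<forall>j''\<in>act (Suc c). a j'' < a j \<longrightarrow> a j'' \<le> a j')"
      if "j \<in> J" for j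
    proof -
      let ?S = "{j'\<in>act (Suc c). a j' < a j}"
      have "finite ?S" "?S \<noteq> {}" using that by (auto simp: J_def)
      then obtain m where "m \<in> ?S" "\<forall>x\<in>?S. a x \<le> a m"
        using Max_in[of "a ` ?S"] Max_ge[of "a ` ?S"] by (smt (verit) finite_imageI image_iff image_is_empty)
      then show ?thesis by auto
    qed
    then obtain f where f: "\<And>j. j \<in> J \<Longrightarrow> f j \<in> act (Suc c) \<and> a (f j) < a j \<and>
        (\<forall>j''\<in>act (Suc c). a j'' < a j \<longrightarrow> a j'' \<le> a (f j))" by metis
    have adm: "N j i - N (f j) i = (\<Sum>x\<in>admissible H c y j. strip_gf q H up (a i) c x)"
      if "j \<in> J" for j i
    proof -
      have fj: "f j \<in> act (Suc c)" "a (f j) < a j" "f j \<in> act c" "j \<in> act c"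
        using f[OF that] act_up[OF up] that by (auto simp: J_def)
      have le: "y' j \<le> y (f j)" "y (f j) \<le> H"
        using fj dec by (auto simp: y'_def decreasing_on_def le_less)
      have "y (f j) \<le> y j'" if j': "j' \<in> act (Suc c)" "a j' < a j" for j'
      proof (cases "j' = f j")
        case False
        then have "a j' < a (f j)"
          using f[OF \<open>j \<in> J\<close>] j' start_inj[of j' "f j"] fj by (force simp: act_def)
        then show ?thesis using dec j' fj by (auto simp: decreasing_on_def le_less)
      qed simp
      then have eq: "admissible H c y j = {y' j..<y (f j)}"
        using fj le up by (force simp: admissible_def y'_def)
      have "{y' j..H} = {y' j..<y (f j)} \<union> {y (f j)..H}" "{y' j..<y (f j)} \<inter> {y (f j)..H} = {}"
        using le by auto
      then have "(\<Sum>x\<in>{y' j..H}. strip_gf q H up (a i) c x) =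
         (\<Sum>x\<in>{y' j..<y (f j)}. strip_gf q H up (a i) c x) + (\<Sum>x\<in>{y (f j)..H}. strip_gf q H up (a i) c x)"
        by (simp add: sum.union_disjoint)
      then show ?thesis using fj by (simp add: N_def eq y'_def)
    qed
    have adm': "N j i = (\<Sum>x\<in>admissible H c y j. strip_gf q H up (a i) c x)"
      if "j \<in> act c" "j \<notin> J" for j i
    proof -
      have "admissible H c y j = {y' j..H}"
        using that up by (auto simp: admissible_def J_def y'_def)
      then show ?thesis using that by (simp add: N_def)
    qed
    have "rdet k N = rdet k (\<lambda>j. if j \<in> J then (\<lambda>i. N j i - N (f j) i) else N j)"
      by (rule rdet_subtract_rows[symmetric, where m = a]) (use f in \<open>auto simp: J_def act_def\<close>)
    also have "\<dots> = rdet k (\<lambda>j. if j \<in> act c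
        then (\<lambda>i. \<Sum>x\<in>admissible H c y j. strip_gf q H up (a i) c x) else stage q H (Suc c) y j)"
    proof (rule rdet_cong)
      fix j i
      show "(if j \<in> J then (\<lambda>i. N j i - N (f j) i) else N j) i = (if j \<in> act c
        then (\<lambda>i. \<Sum>x\<in>admissible H c y j. strip_gf q H up (a i) c x) else stage q H (Suc c) y j) i"
        using adm[of j i] adm'[of j i] by (auto simp: J_def N_def)
    qed
    also have "\<dots> = (\<Sum>x\<in>PiE (act c) (admissible H c y). rdet k (\<lambda>j. if j \<in> act c
        then (\<lambda>i. strip_gf q H up (a i) c (x j)) else stage q H (Suc c) y j))"
      by (rule rdet_sum_rows) (auto simp: act_def)
    also have "\<dots> = (\<Sum>x\<in>PiE (act c) (admissible H c y). rdet k (stage q H c x))"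
    proof (intro sum.cong refl rdet_cong)
      fix x j i assume "j < k"
      then show "(if j \<in> act c then (\<lambda>i. strip_gf q H up (a i) c (x j))
          else stage q H (Suc c) y j) i = stage q H c x j i"
        using no_start[of j] by (auto simp: stage_def act_def)
    qed
    finally show ?thesis .
  qed
  finally show ?thesis .
qed

text \<open>Here the ranges reach from \<open>0\<close> to \<open>y j\<close>, and the row of the next strip inside is subtracted. A strip that
starts at \<open>Suc c\<close> contributes the constant \<open>1\<close> to its column in every active row; the subtraction clears this column
outside the row of the new strip, whose row can then be replaced by a unit row.\<close>

lemma stage_step_right:
  fixes q :: "'r::comm_ring_1"
  assumes right: "\<not> up c" and dec: "decreasing_on H (Suc c) y"
  shows "rdet k (stage q H (Suc c) y) =
    (\<Prod>j\<in>act (Suc c). q ^ y j) * (\<Sum>x\<in>PiE (act c) (admissible H c y). rdet k (stage q H c x))"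
proof -
  have no_end: "b i \<noteq> c" if "i < k" for i
    using end_up[OF that] right by blast
  define N where "N = (\<lambda>j i. if j \<in> act (Suc c)
     then (if a i = Suc c then 1 else \<Sum>x\<in>{..y j}. strip_gf q H up (a i) c x)
     else stage q H (Suc c) y j i)"
  have "rdet k (stage q H (Suc c) y) =
      rdet k (\<lambda>j. if j \<in> act (Suc c) then (\<lambda>i. q ^ y j * N j i) else N j)"
    by (rule rdet_cong) (use right in \<open>auto simp: N_def stage_def act_def\<close>)
  also have "\<dots> = (\<Prod>j\<in>act (Suc c). q ^ y j) * rdet k N"
    by (rule rdet_scale_rows) (auto simp: act_def)
  also have "rdet k N = (\<Sum>x\<in>PiE (act c) (admissible H c y). rdet k (stage q H c x))"
  proof -
    define J where "J = {j \<in> act c. \<exists>j'\<in>act (Suc c). a j < a j'}"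
    have "\<exists>j'\<in>act (Suc c). a j < a j' \<and> (\<forall>j''\<in>act (Suc c). a j < a j'' \<longrightarrow> a j' \<le> a j'')"
      if "j \<in> J" for j
    proof -
      let ?S = "{j'\<in>act (Suc c). a j < a j'}"
      have "finite ?S" "?S \<noteq> {}" using that by (auto simp: J_def)
      then obtain m where "m \<in> ?S" "\<forall>x\<in>?S. a m \<le> a x"
        using Min_in[of "a ` ?S"] Min_le[of "a ` ?S"] by (smt (verit) finite_imageI image_iff image_is_empty)
      then show ?thesis by auto
    qed
    then obtain f where f: "\<And>j. j \<in> J \<Longrightarrow> f j \<in> act (Suc c) \<and> a j < a (f j) \<and>
        (\<forall>j''\<in>act (Suc c). a j < a j'' \<longrightarrow> a (f j) \<le> a j'')" by metis
    have act: "j \<in> act c \<Longrightarrow> j \<in> act (Suc c)" for j using act_right[OF right] by auto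
    have adm: "N j i - N (f j) i = (\<Sum>x\<in>admissible H c y j. strip_gf q H up (a i) c x)"
      if "j \<in> J" for j i
    proof -
      have fj: "f j \<in> act (Suc c)" "a j < a (f j)" "j \<in> act (Suc c)"
        using f[OF that] act[of j] that by (auto simp: J_def)
      have le: "y (f j) < y j" "y j \<le> H"
        using fj dec by (auto simp: decreasing_on_def)
      have "y j' \<le> y (f j)" if j': "j' \<in> act (Suc c)" "a j < a j'" for j'
      proof (cases "j' = f j")
        case False
        then have "a (f j) < a j'"
          using f[OF \<open>j \<in> J\<close>] j' start_inj[of j' "f j"] fj by (force simp: act_def)
        then show ?thesis using dec j' fj by (auto simp: decreasing_on_def le_less)
      qed simp
      then have eq: "admissible H c y j = {y (f j)<..y j}"
        using fj le right by (force simp: admissible_def)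
      have "{..y j} = {..y (f j)} \<union> {y (f j)<..y j}" "{..y (f j)} \<inter> {y (f j)<..y j} = {}"
        using le by auto
      then have "(\<Sum>x\<in>{..y j}. strip_gf q H up (a i) c x) =
         (\<Sum>x\<in>{..y (f j)}. strip_gf q H up (a i) c x) + (\<Sum>x\<in>{y (f j)<..y j}. strip_gf q H up (a i) c x)"
        by (simp add: sum.union_disjoint)
      then show ?thesis using fj by (simp add: N_def eq strip_gf_before_start)
    qed
    have adm': "N j i = (\<Sum>x\<in>admissible H c y j. strip_gf q H up (a i) c x)"
      if "j \<in> act c" "j \<notin> J" "i < k" for j i
    proof -
      have "a i \<noteq> Suc c"
      proof
        assume "a i = Suc c"
        then have "i \<in> act (Suc c)" "a j < a i"
          using that start_le_end[of i] by (auto simp: act_def)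
        with that show False by (auto simp: J_def)
      qed
      moreover have "y j \<le> H" using dec act[OF that(1)] by (auto simp: decreasing_on_def)
      then have "admissible H c y j = {..y j}"
        using that right by (auto simp: admissible_def J_def)
      ultimately show ?thesis using that act[OF that(1)] by (simp add: N_def)
    qed
    \<comment> \<open>N consists of the unweighted rows at Suc c, N' of their differences; A has the unit row of a strip not yet started\<close>
    define N' where "N' = (\<lambda>j. if j \<in> act c
        then (\<lambda>i. \<Sum>x\<in>admissible H c y j. strip_gf q H up (a i) c x) else N j)"
    define A where "A = (\<lambda>j. if j \<in> act c
        then (\<lambda>i. \<Sum>x\<in>admissible H c y j. strip_gf q H up (a i) c x) else stage q H c y j)"
    have "rdet k N = rdet k (\<lambda>j. if j \<in> J then (\<lambda>i. N j i - N (f j) i) else N j)"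
    proof (rule rdet_subtract_rows[symmetric, where m = b])
      fix j assume "j \<in> J"
      then show "f j < k \<and> b (f j) < b j"
        using f[of j] act[of j] act_nested[of j "Suc c" "f j"] by (auto simp: J_def act_def)
    qed (auto simp: J_def act_def)
    also have "\<dots> = rdet k N'"
    proof (rule rdet_cong)
      fix j i assume "i < k"
      then show "(if j \<in> J then (\<lambda>i. N j i - N (f j) i) else N j) i = N' j i"
        using adm[of j i] adm'[of j i] by (auto simp: J_def N'_def)
    qed
    also have "rdet k N' = rdet k A"
    proof (cases "\<exists>r<k. a r = Suc c")
      case True
      then obtain r where r: "r < k" "a r = Suc c" by blast
      have other: "a j \<noteq> Suc c" if "j < k" "j \<noteq> r" for j
        using start_inj[of j r] r that by auto
      have rows: "N' j i = A j i" if "j < k" "j \<noteq> r" for i j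
        using other[OF that] no_end[OF that(1)] that by (auto simp: N'_def A_def N_def stage_def act_def)
      have "rdet k N' = rdet k (N'(r := \<lambda>i. if i = r then 1 else 0))"
      proof (rule rdet_unit_column[symmetric, OF r(1)])
        fix j assume j: "j < k"
        show "N' j r = (if j = r then 1 else 0)"
        proof (cases "j = r")
          case True
          then show ?thesis using r start_le_end[of r] by (auto simp: N'_def N_def act_def)
        next
          case False
          then show ?thesis
            using other[OF j False] no_end[OF j] r j
            by (auto simp: rows A_def stage_def strip_gf_before_start act_def)
        qed
      qed
      also have "\<dots> = rdet k A"
        by (rule rdet_cong) (use rows r in \<open>auto simp: A_def stage_def act_def\<close>)
      finally show ?thesis .
    next
      case False
      show ?thesis
      proof (rule rdet_cong)
        fix j i assume "j < k"
        moreover from this False have "a j \<noteq> Suc c" by blast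
        ultimately show "N' j i = A j i"
          using no_end[of j] by (auto simp: N'_def A_def N_def stage_def act_def)
      qed
    qed
    also have "\<dots> = (\<Sum>x\<in>PiE (act c) (admissible H c y). rdet k (\<lambda>j. if j \<in> act c
        then (\<lambda>i. strip_gf q H up (a i) c (x j)) else stage q H c y j))"
      unfolding A_def by (rule rdet_sum_rows) (auto simp: act_def)
    also have "\<dots> = (\<Sum>x\<in>PiE (act c) (admissible H c y). rdet k (stage q H c x))"
      by (intro sum.cong refl rdet_cong) (auto simp: stage_def act_def)
    finally show ?thesis .
  qed
  finally show ?thesis .
qed

text \<open>The families of entries, listed by content, that interlace at all contents up to the given one. Fixing the value
beyond it makes every family occur once.\<close>

primrec chains :: "nat \<Rightarrow> nat \<Rightarrow> (nat \<Rightarrow> nat) \<Rightarrow> (nat \<Rightarrow> nat \<Rightarrow> nat) set" where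
  "chains H 0 y = {(\<lambda>_. undefined)(0 := y)}"
| "chains H (Suc c) y = (\<Union>x\<in>PiE (act c) (admissible H c y). (\<lambda>h. h(Suc c := y)) ` chains H c x)"

lemma chains_iff:
  "h \<in> chains H n y \<longleftrightarrow> h n = y \<and> (\<forall>c>n. h c = undefined) \<and>
     (\<forall>c<n. h c \<in> PiE (act c) (admissible H c (h (Suc c))))"
proof (induction n arbitrary: h y)
  case 0
  show ?case by (auto simp: fun_eq_iff)
next
  case (Suc n)
  show ?case
  proof
    assume "h \<in> chains H (Suc n) y"
    then obtain x g where x: "x \<in> PiE (act n) (admissible H n y)" "g \<in> chains H n x"
      "h = g(Suc n := y)" by auto
    have "g n = x" "\<forall>c>n. g c = undefined" "\<forall>c<n. g c \<in> PiE (act c) (admissible H c (g (Suc c)))"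
      using x(2)[unfolded Suc.IH] by simp_all
    then show "h (Suc n) = y \<and> (\<forall>c>Suc n. h c = undefined) \<and>
        (\<forall>c<Suc n. h c \<in> PiE (act c) (admissible H c (h (Suc c))))"
      using x(1,3) by (auto simp: less_Suc_eq)
  next
    assume h: "h (Suc n) = y \<and> (\<forall>c>Suc n. h c = undefined) \<and>
        (\<forall>c<Suc n. h c \<in> PiE (act c) (admissible H c (h (Suc c))))"
    define g where "g = h(Suc n := undefined)"
    have "g \<in> chains H n (h n)"
      unfolding Suc.IH using h by (auto simp: g_def)
    moreover have "h = g(Suc n := y)" using h by (auto simp: g_def)
    moreover have "h n \<in> PiE (act n) (admissible H n y)" using h by auto
    ultimately show "h \<in> chains H (Suc n) y" by auto
  qed
qed

lemma finite_chains [simp]: "finite (chains H n y)"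
  by (induction n arbitrary: y) (auto intro!: finite_PiE)

lemma stage_eq_sum_chains:
  fixes q :: "'r::comm_ring_1"
  assumes "decreasing_on H n y"
  shows "rdet k (stage q H n y) = (\<Sum>h\<in>chains H n y. \<Prod>c\<le>n. \<Prod>j\<in>act c. q ^ h c j)"
  using assms
proof (induction n arbitrary: y)
  case 0
  have "act 0 = {}" using start_pos by (force simp: act_def)
  moreover have "rdet k (stage q H 0 y) = rdet k (\<lambda>j i. if i = j then 1 else 0)"
    by (rule rdet_cong) (use start_pos in \<open>force simp: stage_def\<close>)
  ultimately show ?case by (simp add: rdet_identity)
next
  case (Suc n)
  have "rdet k (stage q H (Suc n) y) = (\<Prod>j\<in>act (Suc n). q ^ y j) *
      (\<Sum>x\<in>PiE (act n) (admissible H n y). rdet k (stage q H n x))"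
    using stage_step_up[OF _ Suc.prems] stage_step_right[OF _ Suc.prems] by blast
  also have "\<dots> = (\<Prod>j\<in>act (Suc n). q ^ y j) * (\<Sum>x\<in>PiE (act n) (admissible H n y).
      \<Sum>h\<in>chains H n x. \<Prod>c\<le>n. \<Prod>j\<in>act c. q ^ h c j)"
    by (intro arg_cong2[where f = "(*)"] refl sum.cong Suc.IH) (rule admissible_decreasing)
  also have "\<dots> = (\<Sum>x\<in>PiE (act n) (admissible H n y). \<Sum>h\<in>(\<lambda>h. h(Suc n := y)) ` chains H n x.
      \<Prod>c\<le>Suc n. \<Prod>j\<in>act c. q ^ h c j)"
    unfolding sum_distrib_left
  proof (rule sum.cong[OF refl])
    fix x
    have inj: "inj_on (\<lambda>h. h(Suc n := y)) (chains H n x)"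
    proof (rule inj_onI)
      fix g h assume gh: "g \<in> chains H n x" "h \<in> chains H n x" "g(Suc n := y) = h(Suc n := y)"
      then have "g (Suc n) = undefined" "h (Suc n) = undefined" by (auto simp: chains_iff)
      with gh(3) show "g = h" by (metis fun_upd_idem_iff fun_upd_upd)
    qed
    have eq: "(\<Prod>c\<le>Suc n. \<Prod>j\<in>act c. q ^ (h(Suc n := y)) c j) =
        (\<Prod>j\<in>act (Suc n). q ^ y j) * (\<Prod>c\<le>n. \<Prod>j\<in>act c. q ^ h c j)" for h :: "nat \<Rightarrow> nat \<Rightarrow> nat"
    proof -
      have "(\<Prod>c\<le>n. \<Prod>j\<in>act c. q ^ (h(Suc n := y)) c j) = (\<Prod>c\<le>n. \<Prod>j\<in>act c. q ^ h c j)"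
        by (intro prod.cong refl) auto
      then show ?thesis by (simp add: mult.commute)
    qed
    show "(\<Sum>h\<in>chains H n x. (\<Prod>j\<in>act (Suc n). q ^ y j) * (\<Prod>c\<le>n. \<Prod>j\<in>act c. q ^ h c j)) =
       (\<Sum>h\<in>(\<lambda>h. h(Suc n := y)) ` chains H n x. \<Prod>c\<le>Suc n. \<Prod>j\<in>act c. q ^ h c j)"
      unfolding sum.reindex[OF inj] o_def eq ..
  qed
  also have "\<dots> = (\<Sum>h\<in>chains H (Suc n) y. \<Prod>c\<le>Suc n. \<Prod>j\<in>act c. q ^ h c j)"
    unfolding chains.simps
  proof (subst sum.UNION_disjoint)
    show "\<forall>x\<in>PiE (act n) (admissible H n y). \<forall>x'\<in>PiE (act n) (admissible H n y). x \<noteq> x' \<longrightarrow>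
      (\<lambda>h. h(Suc n := y)) ` chains H n x \<inter> (\<lambda>h. h(Suc n := y)) ` chains H n x' = {}"
    proof (intro ballI impI)
      fix x x' :: "nat \<Rightarrow> nat" assume "x \<noteq> x'"
      have "h n = x" if "h \<in> (\<lambda>h. h(Suc n := y)) ` chains H n x" for h x
        using that by (auto simp: chains_iff)
      with \<open>x \<noteq> x'\<close> show "(\<lambda>h. h(Suc n := y)) ` chains H n x \<inter> (\<lambda>h. h(Suc n := y)) ` chains H n x' = {}"
        by blast
    qed
  qed (auto intro!: finite_PiE)
  finally show ?case .
qed

text \<open>Interlacing families join each start with its own end, because starts and ends are nested like parentheses; so no
signs occur.\<close>

theorem det_strip_gf:
  fixes q :: "'r::comm_ring_1"
  assumes N: "\<And>i. i < k \<Longrightarrow> b i < N"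
  shows "rdet k (\<lambda>i j. \<Sum>x\<le>H. strip_gf q H up (a i) (b j) x) =
    (\<Sum>h\<in>chains H N (\<lambda>_. undefined). \<Prod>c\<le>N. \<Prod>j\<in>act c. q ^ h c j)"
proof -
  have "act N = {}" using N by (force simp: act_def)
  then have "decreasing_on H N (\<lambda>_. undefined)" by (simp add: decreasing_on_def)
  then have "(\<Sum>h\<in>chains H N (\<lambda>_. undefined). \<Prod>c\<le>N. \<Prod>j\<in>act c. q ^ h c j) =
     rdet k (stage q H N (\<lambda>_. undefined))" by (rule stage_eq_sum_chains[symmetric])
  also have "\<dots> = rdet k (\<lambda>j i. \<Sum>x\<le>H. strip_gf q H up (a i) (b j) x)"
  proof (rule rdet_cong)
    fix j i assume "j < k"
    then show "stage q H N (\<lambda>_. undefined) j i = (\<Sum>x\<le>H. strip_gf q H up (a i) (b j) x)"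
      using N[of j] start_le_end[of j] by (simp add: stage_def)
  qed
  also have "\<dots> = rdet k (\<lambda>i j. \<Sum>x\<le>H. strip_gf q H up (a i) (b j) x)"
    by (rule rdet_transpose)
  finally show ?thesis by simp
qed

end

section \<open>The rim of a Young diagram\<close>

text \<open>The number of the diagonal of a cell, counted from the lower left corner; it is positive on the diagram.\<close>

definition content :: "nat list \<Rightarrow> cell \<Rightarrow> nat" where
  "content lam u = snd u + length lam - fst u"

text \<open>The southeast boundary strip of the diagram, parametrised by content.\<close>

definition rim :: "nat list \<Rightarrow> nat \<Rightarrow> cell" where
  "rim lam c = (THE u. u \<in> diagram lam \<and> content lam u = c \<and> (Suc (fst u), Suc (snd u)) \<notin> diagram lam)"

definition contents :: "nat list \<Rightarrow> nat set" where
  "contents lam = content lam ` diagram lam"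

definition rim_up :: "nat list \<Rightarrow> nat \<Rightarrow> bool" where
  "rim_up lam c \<longleftrightarrow> c \<in> contents lam \<and> eastmost_of_row lam (rim lam c)"

locale young =
  fixes lam :: "nat list"
  assumes partition: "int_partition lam"
begin

abbreviation Y :: "cell set" where "Y \<equiv> diagram lam"

lemma part_antimono: "1 \<le> i' \<Longrightarrow> i' \<le> i \<Longrightarrow> part lam i \<le> part lam i'"
  using partition sorted_wrt_nth_less[of "(\<ge>)" lam "i' - 1" "i - 1"]
  by (cases "i' = i") (auto simp: part_def int_partition_def)

lemma diagram_bounds: "u \<in> Y \<Longrightarrow> 1 \<le> fst u \<and> fst u \<le> length lam \<and> 1 \<le> snd u"
  by (auto simp: diagram_def)

lemma diagram_down_closed:
  "(i, j) \<in> Y \<Longrightarrow> 1 \<le> i' \<Longrightarrow> i' \<le> i \<Longrightarrow> 1 \<le> j' \<Longrightarrow> j' \<le> j \<Longrightarrow> (i', j') \<in> Y"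
  using part_antimono[of i' i] by (auto simp: diagram_def)

lemma diagram_down:
  "u \<in> Y \<Longrightarrow> 1 \<le> i' \<Longrightarrow> i' \<le> fst u \<Longrightarrow> 1 \<le> j' \<Longrightarrow> j' \<le> snd u \<Longrightarrow> (i', j') \<in> Y"
  using diagram_down_closed[of "fst u" "snd u" i' j'] by simp

lemma finite_diagram: "finite Y"
proof (rule finite_subset)
  show "Y \<subseteq> {1..length lam} \<times> {1..part lam 1}"
  proof
    fix u assume "u \<in> Y"
    then show "u \<in> {1..length lam} \<times> {1..part lam 1}"
      using part_antimono[of 1 "fst u"] by (auto simp: diagram_def)
  qed
qed simp

lemma content_add: "u \<in> Y \<Longrightarrow> content lam u + fst u = snd u + length lam"
  using diagram_bounds[of u] by (simp add: content_def)

lemma contents_iff: "c \<in> contents lam \<longleftrightarrow> 1 \<le> c \<and> c < length lam + part lam 1"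
proof
  assume "c \<in> contents lam"
  then obtain i j where u: "(i, j) \<in> Y" "c = content lam (i, j)" by (auto simp: contents_def)
  then show "1 \<le> c \<and> c < length lam + part lam 1"
    using part_antimono[of 1 i] by (auto simp: diagram_def content_def)
next
  assume c: "1 \<le> c \<and> c < length lam + part lam 1"
  show "c \<in> contents lam"
  proof (cases "c \<le> length lam")
    case True
    then have "(length lam + 1 - c, 1) \<in> Y"
      using c partition by (auto simp: diagram_def part_def int_partition_def Suc_le_eq)
    moreover have "content lam (length lam + 1 - c, 1) = c"
      using c True by (simp add: content_def)
    ultimately show ?thesis by (force simp: contents_def)
  next
    case False
    then have "(1, c + 1 - length lam) \<in> Y"
      using c by (auto simp: diagram_def part_def split: if_splits)
    moreover have "content lam (1, c + 1 - length lam) = c"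
      using False by (simp add: content_def)
    ultimately show ?thesis by (force simp: contents_def)
  qed
qed

text \<open>Of two cells on a diagonal, the upper one cannot be followed on the diagonal by a cell outside the diagram.\<close>

lemma rim_eqI:
  assumes "u \<in> Y" "(Suc (fst u), Suc (snd u)) \<notin> Y"
  shows "rim lam (content lam u) = u"
  unfolding rim_def
proof (rule the_equality)
  fix v assume v: "v \<in> Y \<and> content lam v = content lam u \<and> (Suc (fst v), Suc (snd v)) \<notin> Y"
  have e: "fst u + snd v = fst v + snd u"
    using content_add[of u] content_add[of v] v assms by linarith
  have "\<not> fst u < fst v"
  proof
    assume "fst u < fst v"
    then show False
      using assms v e diagram_down_closed[of "fst v" "snd v" "Suc (fst u)" "Suc (snd u)"] by simp
  qed
  moreover have "\<not> fst v < fst u"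
  proof
    assume "fst v < fst u"
    then show False
      using assms v e diagram_down_closed[of "fst u" "snd u" "Suc (fst v)" "Suc (snd v)"] by simp
  qed
  ultimately show "v = u" using e by (simp add: prod_eq_iff)
qed (use assms in simp)

lemma rim_above:
  assumes "u \<in> Y"
  shows "\<exists>d. rim lam (content lam u) = (fst u + d, snd u + d) \<and> (fst u + d, snd u + d) \<in> Y \<and>
    (Suc (fst u + d), Suc (snd u + d)) \<notin> Y \<and> content lam (fst u + d, snd u + d) = content lam u"
proof -
  let ?P = "\<lambda>d. (fst u + d, snd u + d) \<in> Y"
  have bound: "d \<le> length lam" if "?P d" for d using diagram_bounds[OF that] by simp
  have "?P 0" using assms by simp
  then obtain d where d: "?P d" "\<not> ?P (Suc d)"
    using GreatestI_nat[of ?P 0 "length lam"] Greatest_le_nat[of ?P _ "length lam"] bound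
    by (meson Suc_n_not_le_n)
  moreover have c: "content lam (fst u + d, snd u + d) = content lam u" by (simp add: content_def)
  ultimately show ?thesis using rim_eqI[OF d(1)] by (intro exI[of _ d] conjI) simp_all
qed

lemma rim_props:
  assumes "c \<in> contents lam"
  shows "rim lam c \<in> Y" "content lam (rim lam c) = c" "(Suc (fst (rim lam c)), Suc (snd (rim lam c))) \<notin> Y"
  using assms rim_above by (force simp: contents_def)+

lemma rim_step_right:
  assumes c: "c \<in> contents lam" and r: "\<not> rim_up lam c"
  shows "Suc c \<in> contents lam \<and> rim lam (Suc c) = (fst (rim lam c), Suc (snd (rim lam c)))"
proof -
  note R = rim_props[OF c]
  obtain v where v: "v \<in> Y" "fst v = fst (rim lam c)" "snd (rim lam c) < snd v"
    using r c R(1) by (auto simp: rim_up_def eastmost_of_row_def not_le)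
  let ?u = "(fst (rim lam c), Suc (snd (rim lam c)))"
  have u: "?u \<in> Y"
    using v diagram_bounds[OF R(1)] by (intro diagram_down[of v]) simp_all
  moreover have "content lam ?u = Suc c"
    using R(2) diagram_bounds[OF R(1)] by (simp add: content_def Suc_diff_le)
  moreover have "(Suc (fst ?u), Suc (snd ?u)) \<notin> Y"
    using R(3) diagram_down_closed[of "Suc (fst ?u)" "Suc (snd ?u)" "Suc (fst ?u)" "snd ?u"] by auto
  ultimately show ?thesis using rim_eqI[of ?u] by (force simp: contents_def)
qed

lemma rim_step_up:
  assumes c: "c \<in> contents lam" "Suc c \<in> contents lam" and up: "rim_up lam c"
  shows "rim lam c = (Suc (fst (rim lam (Suc c))), snd (rim lam (Suc c)))"
proof -
  note R = rim_props[OF c(1)]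
  obtain i j where ij: "rim lam c = (i, j)" by fastforce
  have east: "v \<in> Y \<Longrightarrow> fst v = i \<Longrightarrow> snd v \<le> j" for v
    using up ij by (auto simp: rim_up_def eastmost_of_row_def)
  \<comment> \<open>in row 1 the rim can only go on to the right\<close>
  have "i \<noteq> 1"
  proof
    assume "i = 1"
    obtain v where v: "v \<in> Y" "content lam v = Suc c" using c(2) by (auto simp: contents_def)
    have "snd v = j + fst v"
      using content_add[OF v(1)] content_add[OF R(1)] R(2) v(2) ij \<open>i = 1\<close> by simp
    then have "(1, Suc j) \<in> Y"
      using v diagram_bounds[OF v(1)] by (intro diagram_down[of v]) simp_all
    then show False using east[of "(1, Suc j)"] \<open>i = 1\<close> by simp
  qed
  then have i: "2 \<le> i" "1 \<le> j" using diagram_bounds[OF R(1)] ij by auto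
  have u: "(i - 1, j) \<in> Y" using R(1) ij i diagram_down_closed[of i j "i - 1" j] by simp
  have "(Suc (i - 1), Suc j) \<notin> Y" using east[of "(i, Suc j)"] i by auto
  moreover have "content lam (i - 1, j) = Suc c"
    using R(2) ij i diagram_bounds[OF R(1)] by (simp add: content_def)
  ultimately have "rim lam (Suc c) = (i - 1, j)" using rim_eqI[OF u] by simp
  then show ?thesis using ij i by simp
qed

lemma contents_between:
  "c \<in> contents lam \<Longrightarrow> c' \<in> contents lam \<Longrightarrow> c \<le> e \<Longrightarrow> e \<le> c' \<Longrightarrow> e \<in> contents lam"
  by (auto simp: contents_iff)

lemma rim_mono:
  assumes "c \<in> contents lam" "c' \<in> contents lam" "c \<le> c'"
  shows "fst (rim lam c') \<le> fst (rim lam c) \<and> snd (rim lam c) \<le> snd (rim lam c')"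
  using assms(3,2)
proof (induction c' rule: dec_induct)
  case (step n)
  then have n: "n \<in> contents lam" using contents_between[OF assms(1) step.prems] by simp
  show ?case
    using step.IH[OF n] rim_step_up[OF n step.prems] rim_step_right[OF n] by (cases "rim_up lam n") auto
qed simp

lemma content_right: "(i, j) \<in> Y \<Longrightarrow> content lam (i, Suc j) = Suc (content lam (i, j))"
  using diagram_bounds[of "(i, j)"] by (simp add: content_def Suc_diff_le)

lemma content_down: "(Suc i, j) \<in> Y \<Longrightarrow> content lam (i, j) = Suc (content lam (Suc i, j))"
  using diagram_bounds[of "(Suc i, j)"] by (simp add: content_def) linarith

end

section \<open>Reverse plane partitions of order-convex shapes\<close>

definition order_convex :: "cell set \<Rightarrow> bool" where
  "order_convex S \<longleftrightarrow> (\<forall>u\<in>S. \<forall>v\<in>S. \<forall>w. fst u \<le> fst w \<and> fst w \<le> fst v \<and> snd u \<le> snd w \<and> snd w \<le> snd v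
     \<longrightarrow> w \<in> S)"

lemma RPP_order_mono:
  assumes S: "order_convex S" and p: "\<pi> \<in> RPP S" and uv: "u \<in> S" "v \<in> S" "fst u \<le> fst v" "snd u \<le> snd v"
  shows "\<pi> u \<le> \<pi> v"
proof -
  have w: "(fst u, snd v) \<in> S" using S uv unfolding order_convex_def by (metis fst_conv order_refl snd_conv)
  then have "\<pi> u \<le> \<pi> (fst u, snd v)" "\<pi> (fst u, snd v) \<le> \<pi> v"
    using p uv by (auto simp: RPP_def)
  then show ?thesis by simp
qed

lemma RPP_adjacentI:
  assumes S: "order_convex S" and out: "\<And>u. u \<notin> S \<Longrightarrow> \<pi> u = 0"
    and right: "\<And>r s. (r, s) \<in> S \<Longrightarrow> (r, Suc s) \<in> S \<Longrightarrow> \<pi> (r, s) \<le> \<pi> (r, Suc s)"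
    and down: "\<And>r s. (r, s) \<in> S \<Longrightarrow> (Suc r, s) \<in> S \<Longrightarrow> \<pi> (r, s) \<le> \<pi> (Suc r, s)"
  shows "\<pi> \<in> RPP S"
proof -
  have row: "\<pi> (r, s) \<le> \<pi> (r, s')" if "s \<le> s'" "(r, s) \<in> S" "(r, s') \<in> S" for r s s'
    using that
  proof (induction s' rule: dec_induct)
    case (step n)
    have "(r, n) \<in> S" using S step by (auto simp: order_convex_def)
    then show ?case using step right[of r n] by (auto intro: order_trans)
  qed simp
  have col: "\<pi> (r, s) \<le> \<pi> (r', s)" if "r \<le> r'" "(r, s) \<in> S" "(r', s) \<in> S" for r r' s
    using that
  proof (induction r' rule: dec_induct)
    case (step n)
    have "(n, s) \<in> S" using S step by (auto simp: order_convex_def)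
    then show ?case using step down[of n s] by (auto intro: order_trans)
  qed simp
  show ?thesis using out row col by (auto simp: RPP_def)
qed

section \<open>Interlacing walks as fillings of a shape\<close>

lemma finite_initial_segment:
  fixes D :: "nat set"
  assumes "finite D" "\<And>d. Suc d \<in> D \<Longrightarrow> d \<in> D"
  shows "D = {..<card D}"
proof -
  have down: "d \<in> D" if "d + e \<in> D" for d e using that by (induction e) (auto intro: assms(2))
  obtain n where n: "n \<notin> D" "\<And>m. m < n \<Longrightarrow> m \<in> D"
    using ex_least_nat_le[of "\<lambda>n. n \<notin> D"] assms(1) by (metis infinite_nat_iff_unbounded_le nat_le_linear finite_nat_set_iff_bounded less_irrefl)
  have "D = {..<n}" using n down by (metis le_add_diff_inverse lessThan_iff not_le subsetI subset_antisym)
  then show ?thesis by simp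
qed

text \<open>A family of strips on the rim, together with a shape that has one cell on a diagonal for each strip active there.
A ribbon of the rim gives a family with one strip; the intervals of a Kreiman decomposition give \<open>lam / mu\<close>.\<close>

locale rim_strips = young lam + strip_family k a b "rim_up lam"
  for lam :: "nat list" and k :: nat and a b :: "nat \<Rightarrow> nat" +
  fixes S :: "cell set"
  assumes end_content: "i < k \<Longrightarrow> b i \<in> contents lam"
    and S_subset: "S \<subseteq> diagram lam"
    and S_convex: "order_convex S"
    and S_southeast: "(r, s) \<in> S \<Longrightarrow> (Suc r, Suc s) \<in> diagram lam \<Longrightarrow> (Suc r, Suc s) \<in> S"
    and S_card: "c \<in> contents lam \<Longrightarrow> card {u \<in> S. content lam u = c} = card (act c)"
begin

definition depth :: "nat \<Rightarrow> nat" where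
  "depth i = card {m. m < k \<and> a m < a i \<and> b i < b m}"

lemma act_contents: "i \<in> act c \<Longrightarrow> c \<in> contents lam"
  using end_content[of i] start_pos[of i] by (auto simp: act_def contents_iff)

lemma depth_act:
  assumes "i \<in> act c"
  shows "depth i = card {m \<in> act c. a m < a i}"
proof -
  have "{m. m < k \<and> a m < a i \<and> b i < b m} = {m \<in> act c. a m < a i}"
    using assms act_nested[of _ c i] by (auto simp: act_def)
  then show ?thesis by (simp add: depth_def)
qed

lemma depth_less_card: "i \<in> act c \<Longrightarrow> depth i < card (act c)"
  unfolding depth_act by (rule psubset_card_mono) auto

lemma depth_strict_mono:
  assumes "i \<in> act c" "j \<in> act c" "a i < a j"
  shows "depth i < depth j"
  unfolding depth_act[OF assms(1)] depth_act[OF assms(2)]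
  by (rule psubset_card_mono) (use assms in auto)

lemma act_start_eq: "i \<in> act c \<Longrightarrow> j \<in> act c \<Longrightarrow> a i = a j \<Longrightarrow> i = j"
  using start_inj by (auto simp: act_def)

lemma depth_less_iff: "i \<in> act c \<Longrightarrow> j \<in> act c \<Longrightarrow> depth i < depth j \<longleftrightarrow> a i < a j"
  using depth_strict_mono act_start_eq by (metis less_asym linorder_neqE_nat less_irrefl)

lemma depth_inj: "inj_on depth (act c)"
  using depth_less_iff act_start_eq by (intro inj_onI) (metis less_irrefl linorder_neqE_nat)

lemma depth_image: "depth ` act c = {..<card (act c)}"
  by (rule card_subset_eq) (auto simp: depth_less_card card_image[OF depth_inj])

text \<open>The number of diagonal steps from a cell to the rim.\<close>

definition level :: "cell \<Rightarrow> nat" where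
  "level u = fst (rim lam (content lam u)) - fst u"

lemma level_rim: "u \<in> Y \<Longrightarrow> rim lam (content lam u) = (fst u + level u, snd u + level u)"
  using rim_above[of u] by (auto simp: level_def)

lemma level_image: "c \<in> contents lam \<Longrightarrow> level ` {u \<in> S. content lam u = c} = {..<card (act c)}"
proof -
  assume c: "c \<in> contents lam"
  let ?D = "level ` {u \<in> S. content lam u = c}"
  have inj: "inj_on level {u \<in> S. content lam u = c}"
  proof (rule inj_onI)
    fix u v assume "u \<in> {u \<in> S. content lam u = c}" "v \<in> {u \<in> S. content lam u = c}" "level u = level v"
    moreover from this have "u \<in> Y" "v \<in> Y" using S_subset by auto
    ultimately show "u = v" using level_rim[of u] level_rim[of v] by (auto simp: prod_eq_iff)
  qed
  have "?D = {..<card ?D}"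
  proof (rule finite_initial_segment)
    show "finite ?D" using finite_subset[OF S_subset finite_diagram] by simp
    fix d assume "Suc d \<in> ?D"
    then obtain r s where u: "(r, s) \<in> S" "content lam (r, s) = c" "level (r, s) = Suc d" by force
    have R: "rim lam c = (r + Suc d, s + Suc d)" using level_rim[of "(r, s)"] u S_subset by auto
    have "(Suc r, Suc s) \<in> Y"
      using R rim_props(1)[OF c] diagram_down_closed[of "r + Suc d" "s + Suc d" "Suc r" "Suc s"] by simp
    then have "(Suc r, Suc s) \<in> S" using S_southeast[OF u(1)] by simp
    moreover have "content lam (Suc r, Suc s) = c" using u(2) by (simp add: content_def)
    moreover have "level (Suc r, Suc s) = d" using R \<open>content lam (Suc r, Suc s) = c\<close> by (simp add: level_def)
    ultimately show "d \<in> ?D" by force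
  qed
  then show ?thesis using S_card[OF c] card_image[OF inj] by simp
qed

text \<open>Strip \<open>i\<close> occupies a diagonal translate of a piece of the rim. For the intervals of a Kreiman decomposition, these
translates cover the same cells as the paths, but strip \<open>i\<close> need not be the path \<open>L_i\<close>.\<close>

definition cell :: "nat \<Rightarrow> nat \<Rightarrow> cell" where
  "cell i c = (fst (rim lam c) - depth i, snd (rim lam c) - depth i)"

lemma cell_props:
  assumes "i \<in> act c"
  shows "cell i c \<in> S" "content lam (cell i c) = c" "level (cell i c) = depth i"
    "rim lam c = (fst (cell i c) + depth i, snd (cell i c) + depth i)"
proof -
  note c = act_contents[OF assms]
  have "depth i \<in> level ` {u \<in> S. content lam u = c}"
    unfolding level_image[OF c] using depth_less_card[OF assms] by simp
  then obtain u where u: "u \<in> S" "content lam u = c" "level u = depth i" by auto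
  then have "rim lam c = (fst u + depth i, snd u + depth i)" using level_rim[of u] S_subset by auto
  then have "cell i c = u" by (simp add: cell_def)
  then show "cell i c \<in> S" "content lam (cell i c) = c" "level (cell i c) = depth i"
    "rim lam c = (fst (cell i c) + depth i, snd (cell i c) + depth i)"
    using u \<open>rim lam c = _\<close> by auto
qed

lemma cell_cover:
  assumes "u \<in> S"
  obtains i where "i \<in> act (content lam u)" "cell i (content lam u) = u"
proof -
  have c: "content lam u \<in> contents lam" using assms S_subset by (auto simp: contents_def)
  have "level u \<in> depth ` act (content lam u)"
    unfolding depth_image using level_image[OF c] assms by blast
  then obtain i where i: "i \<in> act (content lam u)" "depth i = level u" by auto
  then have "cell i (content lam u) = u"
    using cell_props(4)[OF i(1)] level_rim[of u] assms S_subset by (auto simp: prod_eq_iff)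
  with i that show ?thesis by blast
qed

lemma cell_inj: "i \<in> act c \<Longrightarrow> j \<in> act c' \<Longrightarrow> cell i c = cell j c' \<Longrightarrow> i = j \<and> c = c'"
  using cell_props(2,3)[of i c] cell_props(2,3)[of j c'] inj_onD[OF depth_inj[of c], of i j] by auto

definition index :: "cell \<Rightarrow> nat" where
  "index u = (THE i. i \<in> act (content lam u) \<and> cell i (content lam u) = u)"

lemma index_cell: "i \<in> act c \<Longrightarrow> index (cell i c) = i"
  unfolding index_def using cell_inj cell_props(2) by (intro the_equality) (auto simp: cell_props(2))

text \<open>A filling \<open>\<eta>\<close> stands for the reverse plane partition \<open>\<eta> + level\<close>. The level turns the weak inequalities along
the diagonals into the strict ones of interlacing entries.\<close>

definition fillings :: "nat \<Rightarrow> (cell \<Rightarrow> nat) set" where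
  "fillings H = {\<eta>. (\<forall>u. u \<notin> S \<longrightarrow> \<eta> u = 0) \<and> (\<forall>u\<in>S. \<eta> u \<le> H) \<and>
     (\<lambda>u. if u \<in> S then \<eta> u + level u else 0) \<in> RPP S}"

text \<open>Adjacent cells have neighbouring contents, and interlacing at these contents is exactly what the order conditions
between them require.\<close>

lemma chain_to_filling:
  assumes h: "h \<in> chains H N (\<lambda>_. undefined)" and N: "\<And>i. i < k \<Longrightarrow> b i < N"
  shows "(\<lambda>u. if u \<in> S then h (content lam u) (index u) else 0) \<in> fillings H"
proof -
  have adm: "h c i \<in> admissible H c (h (Suc c)) i" if "i \<in> act c" for i c
  proof -
    have "c < N" using that N[of i] by (auto simp: act_def)
    then show ?thesis using h that by (auto simp: chains_iff PiE_iff)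
  qed
  have ub: "h c i \<le> H" if "i \<in> act c" for i c
    using adm[OF that] by (simp add: admissible_def)
  let ?\<eta> = "\<lambda>u. if u \<in> S then h (content lam u) (index u) else 0"
  have "(\<lambda>u. if u \<in> S then ?\<eta> u + level u else 0) \<in> RPP S"
  proof (rule RPP_adjacentI[OF S_convex])
    fix r s assume rs: "(r, s) \<in> S" "(r, Suc s) \<in> S"
    define c where "c = content lam (r, s)"
    have c': "content lam (r, Suc s) = Suc c"
      using content_right[of r s] rs S_subset by (auto simp: c_def)
    obtain i where i: "i \<in> act c" "cell i c = (r, s)"
      using cell_cover[OF rs(1)] by (metis c_def)
    obtain j where j: "j \<in> act (Suc c)" "cell j (Suc c) = (r, Suc s)"
      using cell_cover[OF rs(2)] by (metis c')
    note R = cell_props(4)[OF i(1), unfolded i(2)] cell_props(4)[OF j(1), unfolded j(2)]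
    have v: "?\<eta> (r, s) + level (r, s) = h c i + depth i"
        "?\<eta> (r, Suc s) + level (r, Suc s) = h (Suc c) j + depth j"
      using index_cell[OF i(1)] index_cell[OF j(1)] cell_props(3)[OF i(1)] cell_props(3)[OF j(1)] i j rs
      by (auto simp: c' c_def)
    have "h c i + depth i \<le> h (Suc c) j + depth j"
    proof (cases "rim_up lam c")
      case True
      have "depth i = Suc (depth j)"
        using rim_step_up[OF act_contents[OF i(1)] act_contents[OF j(1)] True] R by simp
      moreover have "a j < a i"
        using depth_less_iff[of j c i] act_up[OF True] i j \<open>depth i = Suc (depth j)\<close> by auto
      ultimately show ?thesis using adm[OF i(1)] j True by (force simp: admissible_def)
    next
      case False
      have "depth i = depth j"
        using rim_step_right[OF act_contents[OF i(1)] False] R by simp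
      moreover have "i = j"
        using inj_onD[OF depth_inj \<open>depth i = depth j\<close>] act_right[OF False] i j by auto
      ultimately show ?thesis using adm[OF i(1)] j False by (force simp: admissible_def)
    qed
    then show "(if (r, s) \<in> S then ?\<eta> (r, s) + level (r, s) else 0) \<le>
        (if (r, Suc s) \<in> S then ?\<eta> (r, Suc s) + level (r, Suc s) else 0)"
      using v rs by simp
  next
    fix r s assume rs: "(r, s) \<in> S" "(Suc r, s) \<in> S"
    define c where "c = content lam (Suc r, s)"
    have c': "content lam (r, s) = Suc c"
      using content_down[of r s] rs S_subset by (auto simp: c_def)
    obtain i where i: "i \<in> act c" "cell i c = (Suc r, s)"
      using cell_cover[OF rs(2)] by (metis c_def)
    obtain j where j: "j \<in> act (Suc c)" "cell j (Suc c) = (r, s)"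
      using cell_cover[OF rs(1)] by (metis c')
    note R = cell_props(4)[OF i(1), unfolded i(2)] cell_props(4)[OF j(1), unfolded j(2)]
    have v: "?\<eta> (Suc r, s) + level (Suc r, s) = h c i + depth i"
        "?\<eta> (r, s) + level (r, s) = h (Suc c) j + depth j"
      using index_cell[OF i(1)] index_cell[OF j(1)] cell_props(3)[OF i(1)] cell_props(3)[OF j(1)] i j rs
      by (auto simp: c' c_def)
    have "h (Suc c) j + depth j \<le> h c i + depth i"
    proof (cases "rim_up lam c")
      case True
      have "depth i = depth j"
        using rim_step_up[OF act_contents[OF i(1)] act_contents[OF j(1)] True] R by simp
      moreover have "i = j"
        using inj_onD[OF depth_inj \<open>depth i = depth j\<close>] act_up[OF True] i j by auto
      ultimately show ?thesis using adm[OF i(1)] j True by (force simp: admissible_def)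
    next
      case False
      have "depth j = Suc (depth i)"
        using rim_step_right[OF act_contents[OF i(1)] False] R by simp
      moreover have "a i < a j"
        using depth_less_iff[of i "Suc c" j] act_right[OF False] i j \<open>depth j = Suc (depth i)\<close> by auto
      ultimately show ?thesis using adm[OF i(1)] j False by (force simp: admissible_def)
    qed
    then show "(if (r, s) \<in> S then ?\<eta> (r, s) + level (r, s) else 0) \<le>
        (if (Suc r, s) \<in> S then ?\<eta> (Suc r, s) + level (Suc r, s) else 0)"
      using v rs by simp
  qed auto
  moreover have "?\<eta> u \<le> H" if "u \<in> S" for u
  proof -
    obtain i where "i \<in> act (content lam u)" "cell i (content lam u) = u" using cell_cover[OF \<open>u \<in> S\<close>] .
    then show ?thesis using index_cell[of i "content lam u"] ub \<open>u \<in> S\<close> by auto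
  qed
  ultimately show ?thesis by (simp add: fillings_def)
qed

text \<open>A strict inequality between the entries of different strips comes from a weak one between two comparable cells of
different level.\<close>

lemma filling_to_chain:
  assumes f: "\<eta> \<in> fillings H" and N: "\<And>i. i < k \<Longrightarrow> b i < N"
  shows "(\<lambda>c. if c \<le> N then (\<lambda>i\<in>act c. \<eta> (cell i c)) else undefined) \<in> chains H N (\<lambda>_. undefined)"
proof -
  let ?h = "\<lambda>c. if c \<le> N then (\<lambda>i\<in>act c. \<eta> (cell i c)) else undefined"
  have le: "\<eta> u + level u \<le> \<eta> v + level v" if "u \<in> S" "v \<in> S" "fst u \<le> fst v" "snd u \<le> snd v" for u v
    using RPP_order_mono[OF S_convex, of "\<lambda>u. if u \<in> S then \<eta> u + level u else 0" u v] f that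
    by (simp add: fillings_def)
  have "\<eta> (cell i c) \<in> admissible H c (?h (Suc c)) i" if i: "i \<in> act c" and cN: "c < N" for i c
  proof -
    note pi = cell_props[OF i]
    have val: "?h (Suc c) j = \<eta> (cell j (Suc c))" if "j \<in> act (Suc c)" for j
      using that cN by simp
    have H: "\<eta> (cell i c) \<le> H" using f pi by (simp add: fillings_def)
    show ?thesis
    proof (cases "rim_up lam c")
      case True
      have R: "rim lam c = (Suc (fst (rim lam (Suc c))), snd (rim lam (Suc c)))" if "j \<in> act (Suc c)" for j
        using rim_step_up[OF act_contents[OF i] act_contents[OF that] True] .
      have "\<eta> (cell i (Suc c)) \<le> \<eta> (cell i c)" if j: "i \<in> act (Suc c)"
        using le[OF cell_props(1)[OF j] pi(1)] cell_props[OF j] R[OF j] pi by simp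
      moreover have "\<eta> (cell i c) < \<eta> (cell j (Suc c))" if j: "j \<in> act (Suc c)" "a j < a i" for j
        using le[OF pi(1) cell_props(1)[OF j(1)]] cell_props[OF j(1)] R[OF j(1)] pi
          depth_strict_mono[of j c i] act_up[OF True] i j by auto
      ultimately show ?thesis using H True val by (auto simp: admissible_def)
    next
      case False
      have R: "rim lam (Suc c) = (fst (rim lam c), Suc (snd (rim lam c)))"
        using rim_step_right[OF act_contents[OF i] False] by simp
      have i': "i \<in> act (Suc c)" using act_right[OF False] i by auto
      have "\<eta> (cell i c) \<le> \<eta> (cell i (Suc c))"
        using le[OF pi(1) cell_props(1)[OF i']] cell_props[OF i'] R pi by simp
      moreover have "\<eta> (cell j (Suc c)) < \<eta> (cell i c)" if j: "j \<in> act (Suc c)" "a i < a j" for j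
        using le[OF cell_props(1)[OF j(1)] pi(1)] cell_props[OF j(1)] R pi
          depth_strict_mono[of i "Suc c" j] i' j by auto
      ultimately show ?thesis using H False val i' by (auto simp: admissible_def)
    qed
  qed
  moreover have "act N = {}" using N by (force simp: act_def)
  ultimately show ?thesis by (auto simp: chains_iff restrict_def)
qed

theorem det_strip_gf_fillings:
  fixes q :: "'r::comm_ring_1"
  shows "rdet k (\<lambda>i j. \<Sum>x\<le>H. strip_gf q H (rim_up lam) (a i) (b j) x) =
    (\<Sum>\<eta>\<in>fillings H. q ^ (\<Sum>u\<in>S. \<eta> u))"
proof -
  \<comment> \<open>a content beyond all strips\<close>
  define N where "N = Suc (Max (insert 0 (b ` {..<k})))"
  have N: "b i < N" if "i < k" for i
    using that Max_ge[of "insert 0 (b ` {..<k})" "b i"] by (simp add: N_def less_Suc_eq_le)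
  have actN: "c \<le> N" if "i \<in> act c" for i c using that N[of i] by (auto simp: act_def)
  let ?to = "\<lambda>h u. if u \<in> S then h (content lam u) (index u) else (0::nat)"
  let ?from = "\<lambda>\<eta> c. if c \<le> N then (\<lambda>i\<in>act c. \<eta> (cell i c)) else undefined :: nat \<Rightarrow> nat"
  have "(\<Sum>h\<in>chains H N (\<lambda>_. undefined). \<Prod>c\<le>N. \<Prod>j\<in>act c. q ^ h c j) =
     (\<Sum>\<eta>\<in>fillings H. q ^ (\<Sum>u\<in>S. \<eta> u))"
  proof (rule sum.reindex_bij_witness[of _ ?from ?to])
    fix h assume h: "h \<in> chains H N (\<lambda>_. undefined)"
    show "?to h \<in> fillings H" by (rule chain_to_filling[OF h N])
    have hc: "h c = (if c < N then restrict (h c) (act c) else if c = N then (\<lambda>_. undefined) else undefined)" for c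
      using h by (auto simp: chains_iff fun_eq_iff PiE_iff extensional_def not_less_iff_gr_or_eq)
    have "act N = {}" using N by (force simp: act_def)
    show "?from (?to h) = h"
    proof
      fix c
      have "?to h (cell i c) = h c i" if "i \<in> act c" for i
        using that cell_props[OF that] index_cell[OF that] by simp
      then have "(\<lambda>i\<in>act c. ?to h (cell i c)) = restrict (h c) (act c)"
        by (rule restrict_ext)
      then show "?from (?to h) c = h c"
        using hc[of c] \<open>act N = {}\<close> by (auto simp: le_less restrict_def split: if_splits)
    qed
    have "(\<Sum>c\<le>N. \<Sum>j\<in>act c. h c j) = (\<Sum>(c, j)\<in>Sigma {..N} act. h c j)"
      by (simp add: sum.Sigma)
    also have "\<dots> = (\<Sum>u\<in>S. ?to h u)"
    proof (rule sum.reindex_bij_witness[of _ "\<lambda>u. (content lam u, index u)" "\<lambda>(c, j). cell j c"])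
      fix u assume u: "u \<in> S"
      obtain i where i: "i \<in> act (content lam u)" "cell i (content lam u) = u" using cell_cover[OF u] .
      then have "index u = i" using index_cell by metis
      then show "(case (content lam u, index u) of (c, j) \<Rightarrow> cell j c) = u"
        "(content lam u, index u) \<in> Sigma {..N} act"
        using i actN by auto
    qed (auto simp: cell_props index_cell)
    finally show "q ^ (\<Sum>u\<in>S. ?to h u) = (\<Prod>c\<le>N. \<Prod>j\<in>act c. q ^ h c j)"
      by (simp only: power_sum[symmetric])
  next
    fix \<eta> assume f: "\<eta> \<in> fillings H"
    show "?from \<eta> \<in> chains H N (\<lambda>_. undefined)" by (rule filling_to_chain[OF f N])
    show "?to (?from \<eta>) = \<eta>"
    proof
      fix u
      show "?to (?from \<eta>) u = \<eta> u"
      proof (cases "u \<in> S")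
        case True
        obtain i where i: "i \<in> act (content lam u)" "cell i (content lam u) = u" using cell_cover[OF True] .
        then have "index u = i" using index_cell by metis
        then show ?thesis using i actN[OF i(1)] True by auto
      next
        case False
        then show ?thesis using f by (cases u) (simp add: fillings_def)
      qed
    qed
  qed
  then show ?thesis using det_strip_gf[of N q H] N by simp
qed

end

section \<open>Sequences counted by their sum\<close>

text \<open>The weight is the sum of all entries for the sequences that vanish beyond \<open>b\<close>, the only ones to which this is
applied.\<close>

definition wgf :: "nat \<Rightarrow> (nat \<Rightarrow> nat) set \<Rightarrow> rat fps" where
  "wgf b A = Abs_fps (\<lambda>n. of_nat (card {g \<in> A. (\<Sum>c\<le>b. g c) = n}))"

definition supported :: "nat \<Rightarrow> (nat \<Rightarrow> nat) set" where
  "supported b = {g. \<forall>c>b. g c = 0}"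

lemma finite_weight_fibre:
  assumes "A \<subseteq> supported b"
  shows "finite {g \<in> A. (\<Sum>c\<le>b. g c) = n}"
proof (rule finite_subset)
  show "{g \<in> A. (\<Sum>c\<le>b. g c) = n} \<subseteq>
      {g. \<forall>c. (c \<in> {..b} \<longrightarrow> g c \<in> {..n}) \<and> (c \<notin> {..b} \<longrightarrow> g c = 0)}"
  proof
    fix g assume g: "g \<in> {g \<in> A. (\<Sum>c\<le>b. g c) = n}"
    then have "g c \<le> n" if "c \<le> b" for c
      using member_le_sum[of c "{..b}" g] that by auto
    then show "g \<in> {g. \<forall>c. (c \<in> {..b} \<longrightarrow> g c \<in> {..n}) \<and> (c \<notin> {..b} \<longrightarrow> g c = 0)}"
      using g assms by (auto simp: supported_def)
  qed
  show "finite {g. \<forall>c. (c \<in> {..b} \<longrightarrow> g c \<in> {..n}) \<and> (c \<notin> {..b} \<longrightarrow> g c = (0::nat))}"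
    by (rule finite_set_of_finite_funs) auto
qed

lemma wgf_Un:
  assumes "A \<subseteq> supported b" "B \<subseteq> supported b"
  shows "wgf b (A \<union> B) = wgf b A + wgf b B - wgf b (A \<inter> B)"
proof (rule fps_ext)
  fix n :: nat
  let ?f = "\<lambda>A :: (nat \<Rightarrow> nat) set. {g \<in> A. (\<Sum>c\<le>b. g c) = n}"
  have "card (?f A) + card (?f B) = card (?f A \<union> ?f B) + card (?f A \<inter> ?f B)"
    by (rule card_Un_Int) (use assms finite_weight_fibre in blast)+
  moreover have "?f A \<union> ?f B = ?f (A \<union> B)" "?f A \<inter> ?f B = ?f (A \<inter> B)" by auto
  ultimately have "card (?f A) + card (?f B) = card (?f (A \<union> B)) + card (?f (A \<inter> B))" by simp
  then have "rat_of_nat (card (?f A)) + of_nat (card (?f B)) =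
      of_nat (card (?f (A \<union> B))) + of_nat (card (?f (A \<inter> B)))"
    by (simp only: of_nat_add[symmetric])
  then show "fps_nth (wgf b (A \<union> B)) n = fps_nth (wgf b A + wgf b B - wgf b (A \<inter> B)) n"
    by (simp add: wgf_def)
qed

lemma wgf_empty: "wgf b {} = 0"
  by (rule fps_ext) (simp add: wgf_def)

lemma wgf_zero: "wgf b {\<lambda>_. 0} = 1"
proof (rule fps_ext)
  fix n :: nat
  have "{g \<in> {\<lambda>_. 0 :: nat}. (\<Sum>c\<le>b. g c) = n} = (if n = 0 then {\<lambda>_. 0} else {})" by auto
  then show "fps_nth (wgf b {\<lambda>_. 0}) n = fps_nth 1 n" by (simp add: wgf_def)
qed

lemma wgf_shift:
  assumes "inj_on \<sigma> A" "\<And>g. g \<in> A \<Longrightarrow> (\<Sum>c\<le>b. \<sigma> g c) = (\<Sum>c\<le>b. g c) + h"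
  shows "wgf b (\<sigma> ` A) = fps_X ^ h * wgf b A"
proof (rule fps_ext)
  fix n :: nat
  have "card {g \<in> \<sigma> ` A. (\<Sum>c\<le>b. g c) = n} = (if n < h then 0 else card {g \<in> A. (\<Sum>c\<le>b. g c) = n - h})"
  proof (cases "n < h")
    case True
    then have empty: "{g \<in> \<sigma> ` A. (\<Sum>c\<le>b. g c) = n} = {}" using assms(2) by auto
    show ?thesis unfolding empty using True by simp
  next
    case False
    then have "{g \<in> \<sigma> ` A. (\<Sum>c\<le>b. g c) = n} = \<sigma> ` {g \<in> A. (\<Sum>c\<le>b. g c) = n - h}"
      using assms(2) by auto
    moreover have "inj_on \<sigma> {g \<in> A. (\<Sum>c\<le>b. g c) = n - h}"
      using assms(1) by (rule inj_on_subset) auto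
    ultimately show ?thesis using False by (simp add: card_image)
  qed
  then show "fps_nth (wgf b (\<sigma> ` A)) n = fps_nth (fps_X ^ h * wgf b A) n"
    by (simp add: wgf_def fps_X_power_mult_nth)
qed

section \<open>Weighted sums over Dyck paths\<close>

context young
begin

lemma dyck_path_content:
  assumes "dyck_path lam D" "i < length D"
  shows "content lam (D ! i) = content lam (D ! 0) + i"
proof -
  have "D ! i \<in> Y" "D ! 0 \<in> Y"
    using assms by (auto simp: dyck_path_def intro: nth_mem)
  then show ?thesis
    using dyck_path_diagonal[OF assms] content_add[of "D ! i"] content_add[of "D ! 0"] by linarith
qed

lemma dyck_path_distinct: "dyck_path lam D \<Longrightarrow> distinct D"
  unfolding distinct_conv_nth using dyck_path_content by (metis add_left_cancel)

lemma dyck_path_Cons_Cons: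
  "dyck_path lam (u # v # D) \<longleftrightarrow> u \<in> Y \<and> (up_step u v \<or> down_step u v) \<and> dyck_path lam (v # D)"
proof
  assume d: "dyck_path lam (u # v # D)"
  have s: "i + 1 < length (u # v # D) \<Longrightarrow> up_step ((u # v # D) ! i) ((u # v # D) ! (i + 1)) \<or>
      down_step ((u # v # D) ! i) ((u # v # D) ! (i + 1))" for i
    using d by (simp add: dyck_path_def)
  show "u \<in> Y \<and> (up_step u v \<or> down_step u v) \<and> dyck_path lam (v # D)"
    using d s[of 0] s[of "Suc _"] by (auto simp: dyck_path_def)
next
  assume d: "u \<in> Y \<and> (up_step u v \<or> down_step u v) \<and> dyck_path lam (v # D)"
  show "dyck_path lam (u # v # D)"
    unfolding dyck_path_def
  proof (intro conjI allI impI)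
    fix i assume "i + 1 < length (u # v # D)"
    then show "up_step ((u # v # D) ! i) ((u # v # D) ! (i + 1)) \<or>
      down_step ((u # v # D) ! i) ((u # v # D) ! (i + 1))"
      using d by (cases i) (auto simp: dyck_path_def)
  qed (use d in \<open>auto simp: dyck_path_def\<close>)
qed

lemma Dyck_bounds:
  assumes "D \<in> Dyck lam u t"
  shows "fst t \<le> fst u \<and> content lam u \<le> content lam t \<and> u \<in> Y"
proof -
  have "fst (last D) \<le> fst (hd D) \<and> content lam (hd D) \<le> content lam (last D) \<and> hd D \<in> Y"
    if "dyck_path lam D" for D
    using that
  proof (induction D)
    case (Cons v D)
    show ?case
    proof (cases D)
      case Nil
      then show ?thesis using Cons.prems by (simp add: dyck_path_def)
    next
      case (Cons w E)
      then have "fst (last D) \<le> fst w \<and> content lam w \<le> content lam (last D)"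
          "v \<in> Y" "up_step v w \<or> down_step v w"
        using Cons.IH Cons.prems dyck_path_Cons_Cons[of v w E] by auto
      then show ?thesis using \<open>D = w # E\<close>
        by (auto simp: up_step_def down_step_def content_def)
    qed
  qed (simp add: dyck_path_def)
  then show ?thesis using assms by (auto simp: Dyck_def)
qed

lemma Dyck_self: "t \<in> Y \<Longrightarrow> Dyck lam t t = {[t]}"
proof (intro Set.set_eqI iffI)
  fix D assume t: "t \<in> Y" and D: "D \<in> Dyck lam t t"
  show "D \<in> {[t]}"
  proof (cases D)
    case (Cons v E)
    show ?thesis
    proof (cases E)
      case (Cons w F)
      with \<open>D = v # E\<close> have "w # F \<in> Dyck lam w t" "v = t" "up_step v w \<or> down_step v w"
        using D by (auto simp: Dyck_def dyck_path_Cons_Cons)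
      then have "content lam w \<le> content lam t" "w \<in> Y" using Dyck_bounds by blast+
      then have False
        using content_add[OF \<open>w \<in> Y\<close>] content_add[OF t] \<open>v = t\<close> \<open>up_step v w \<or> down_step v w\<close>
        by (auto simp: up_step_def down_step_def)
      then show ?thesis ..
    qed (use \<open>D = v # E\<close> D in \<open>auto simp: Dyck_def\<close>)
  qed (use D in \<open>simp add: Dyck_def dyck_path_def\<close>)
qed (simp add: Dyck_def dyck_path_def)

lemma Dyck_first_step:
  assumes u: "u \<in> Y" "u \<noteq> t"
  shows "Dyck lam u t = Cons u ` Dyck lam (fst u - 1, snd u) t \<union> Cons u ` Dyck lam (fst u, Suc (snd u)) t"
proof (intro Set.set_eqI iffI)
  fix D assume D: "D \<in> Dyck lam u t"
  then have "D \<noteq> []" by (simp add: Dyck_def dyck_path_def)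
  then obtain E where E: "D = u # E" using D by (cases D) (auto simp: Dyck_def)
  with D u have "E \<noteq> []" by (auto simp: Dyck_def)
  then obtain w F where F: "E = w # F" by (cases E) auto
  have "up_step u w \<or> down_step u w" "dyck_path lam E" "last E = t"
    using D E F by (auto simp: Dyck_def dyck_path_Cons_Cons)
  then have "w = (fst u - 1, snd u) \<or> w = (fst u, Suc (snd u))" "E \<in> Dyck lam w t"
    using F by (auto simp: up_step_def down_step_def Dyck_def prod_eq_iff)
  then show "D \<in> Cons u ` Dyck lam (fst u - 1, snd u) t \<union> Cons u ` Dyck lam (fst u, Suc (snd u)) t"
    using E by auto
next
  fix D assume "D \<in> Cons u ` Dyck lam (fst u - 1, snd u) t \<union> Cons u ` Dyck lam (fst u, Suc (snd u)) t"
  then obtain w E where E: "D = u # E" "E \<in> Dyck lam w t" "w = (fst u - 1, snd u) \<or> w = (fst u, Suc (snd u))"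
    by blast
  then have "E \<noteq> []" by (simp add: Dyck_def dyck_path_def)
  then obtain F where F: "E = w # F" using E(2) by (cases E) (auto simp: Dyck_def)
  have "up_step u w \<or> down_step u w"
    using E(3) diagram_bounds[OF u(1)] by (auto simp: up_step_def down_step_def)
  then show "D \<in> Dyck lam u t"
    using E F u by (auto simp: Dyck_def dyck_path_Cons_Cons)
qed

lemma finite_Dyck [simp]: "finite (Dyck lam u t)"
proof (rule finite_subset)
  show "Dyck lam u t \<subseteq> {D. set D \<subseteq> Y \<and> length D \<le> card Y}"
    using dyck_path_distinct finite_diagram
    by (auto simp: Dyck_def dyck_path_def) (metis card_mono distinct_card dyck_path_def)
  show "finite {D. set D \<subseteq> Y \<and> length D \<le> card Y}"
    by (rule finite_lists_length_le[OF finite_diagram])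
qed

lemma valleys_Cons_Cons:
  "valleys (x # y # zs) =
    (if zs \<noteq> [] \<and> down_step x y \<and> up_step y (hd zs) then {y} else {}) \<union> valleys (y # zs)"
proof (intro Set.set_eqI iffI)
  fix u assume "u \<in> valleys (x # y # zs)"
  then obtain i where i: "0 < i" "i + 1 < length (x # y # zs)" "u = (x # y # zs) ! i"
    "down_step ((x # y # zs) ! (i - 1)) ((x # y # zs) ! i)"
    "up_step ((x # y # zs) ! i) ((x # y # zs) ! (i + 1))"
    unfolding valleys_def by blast
  then obtain j where j: "i = Suc j" by (cases i) auto
  show "u \<in> (if zs \<noteq> [] \<and> down_step x y \<and> up_step y (hd zs) then {y} else {}) \<union> valleys (y # zs)"
  proof (cases j)
    case 0
    then show ?thesis using i j by (auto simp: hd_conv_nth)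
  next
    case (Suc m)
    then have "u \<in> valleys (y # zs)"
      unfolding valleys_def using i j by (intro CollectI exI[of _ j]) auto
    then show ?thesis by blast
  qed
next
  fix u assume u: "u \<in> (if zs \<noteq> [] \<and> down_step x y \<and> up_step y (hd zs) then {y} else {}) \<union> valleys (y # zs)"
  show "u \<in> valleys (x # y # zs)"
  proof (cases "u \<in> valleys (y # zs)")
    case True
    then obtain j where "0 < j" "j + 1 < length (y # zs)" "u = (y # zs) ! j"
      "down_step ((y # zs) ! (j - 1)) ((y # zs) ! j)" "up_step ((y # zs) ! j) ((y # zs) ! (j + 1))"
      unfolding valleys_def by blast
    then show ?thesis
      unfolding valleys_def by (intro CollectI exI[of _ "Suc j"]) (auto simp: nth_Cons')
  next
    case False
    then have "zs \<noteq> []" "down_step x y" "up_step y (hd zs)" "u = y" using u by (auto split: if_splits)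
    then show ?thesis
      unfolding valleys_def by (intro CollectI exI[of _ 1]) (auto simp: hd_conv_nth)
  qed
qed

lemma valleys_singleton: "valleys [x] = {}"
  by (auto simp: valleys_def)

lemma hd_not_valley:
  assumes "dyck_path lam (y # zs)"
  shows "y \<notin> valleys (y # zs)"
proof
  assume "y \<in> valleys (y # zs)"
  then obtain i where "0 < i" "i + 1 < length (y # zs)" "(y # zs) ! i = (y # zs) ! 0"
    unfolding valleys_def by auto
  then show False
    using nth_eq_iff_index_eq[OF dyck_path_distinct[OF assms], of i 0] by auto
qed

lemma valleys_subset: "valleys D \<subseteq> set D"
  by (auto simp: valleys_def)

lemma hook_length_pos: "u \<in> Y \<Longrightarrow> 0 < hook_length lam u"
proof -
  assume u: "u \<in> Y"
  obtain i j where ij: "u = (i, j)" by fastforce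
  have fin: "finite {i'. (i', j) \<in> Y}"
    by (rule finite_subset[of _ "{..length lam}"]) (auto simp: diagram_def)
  have "{1..i} \<subseteq> {i'. (i', j) \<in> Y}"
    using u ij diagram_down[OF u] diagram_bounds[OF u] by auto
  then have "i \<le> conj_part lam j"
    unfolding conj_part_def using card_mono[OF fin, of "{1..i}"] by simp
  moreover have "j \<le> part lam i" using u ij by (simp add: diagram_def)
  ultimately show ?thesis using ij by (simp add: hook_length_def)
qed

definition path_weight :: "cell list \<Rightarrow> rat fps" where
  "path_weight D = (\<Prod>u\<in>set D. 1 / (1 - fps_X ^ hook_length lam u)) * (\<Prod>u\<in>valleys D. fps_X ^ hook_length lam u)"

definition Dyck_gf :: "cell \<Rightarrow> cell \<Rightarrow> rat fps" where
  "Dyck_gf u t = (\<Sum>D\<in>Dyck lam u t. path_weight D)"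

lemma one_minus_X_power:
  assumes "0 < h"
  shows "(1 - fps_X ^ h) * (1 / (1 - fps_X ^ h)) = (1 :: rat fps)"
proof -
  have nz: "fps_nth (1 - fps_X ^ h :: rat fps) 0 \<noteq> 0" using assms by simp
  show ?thesis
    unfolding fps_divide_unit[OF nz] mult_1_left by (rule inverse_mult_eq_1'[OF nz])
qed

lemma path_weight_Cons_up:
  assumes "dyck_path lam (u # v # D)" "up_step u v"
  shows "(1 - fps_X ^ hook_length lam u) * path_weight (u # v # D) = path_weight (v # D)"
proof -
  have "\<not> down_step u v" using assms(2) by (simp add: up_step_def down_step_def)
  then have "valleys (u # v # D) = valleys (v # D)" by (simp add: valleys_Cons_Cons)
  moreover have "u \<notin> set (v # D)" using dyck_path_distinct[OF assms(1)] by simp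
  moreover have "0 < hook_length lam u"
    using assms(1) hook_length_pos by (simp add: dyck_path_Cons_Cons)
  note one_minus_X_power[OF this]
  ultimately show ?thesis
    unfolding path_weight_def list.set(2)[of u "v # D"]
    by (subst prod.insert) (simp_all add: mult.assoc[symmetric])
qed

text \<open>The weight that the first cell of a path acquires when a right step is put in front of the path.\<close>

definition valley_if_up :: "cell list \<Rightarrow> rat fps" where
  "valley_if_up D = (if tl D \<noteq> [] \<and> up_step (hd D) (hd (tl D)) then fps_X ^ hook_length lam (hd D) else 1)"

lemma path_weight_Cons_right:
  assumes "dyck_path lam (u # v # D)" "down_step u v"
  shows "(1 - fps_X ^ hook_length lam u) * path_weight (u # v # D) = path_weight (v # D) * valley_if_up (v # D)"
proof -
  have d: "dyck_path lam (v # D)" using assms(1) by (simp add: dyck_path_Cons_Cons)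
  have "finite (valleys (v # D))" by (rule finite_subset[OF valleys_subset]) simp
  then have "(\<Prod>u\<in>valleys (u # v # D). fps_X ^ hook_length lam u) =
      valley_if_up (v # D) * (\<Prod>u\<in>valleys (v # D). fps_X ^ hook_length lam u)"
    using hd_not_valley[OF d] assms(2) by (simp add: valleys_Cons_Cons valley_if_up_def)
  then have V: "(\<Prod>u\<in>valleys (u # v # D). fps_X ^ hook_length lam u) =
      valley_if_up (v # D) * (\<Prod>u\<in>valleys (v # D). fps_X ^ hook_length lam u)" .
  have "u \<notin> set (v # D)" using dyck_path_distinct[OF assms(1)] by simp
  then have P: "(\<Prod>w\<in>set (u # v # D). 1 / (1 - fps_X ^ hook_length lam w)) =
      1 / (1 - fps_X ^ hook_length lam u) * (\<Prod>w\<in>set (v # D). 1 / (1 - fps_X ^ hook_length lam w) :: rat fps)"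
    unfolding list.set(2)[of u "v # D"] by (intro prod.insert) auto
  have "0 < hook_length lam u"
    using assms(1) hook_length_pos by (simp add: dyck_path_Cons_Cons)
  note one = one_minus_X_power[OF this]
  have *: "x * ((i * p) * (w * y)) = p * y * w" if "x * i = 1" for x i p w y :: "rat fps"
  proof -
    have "x * ((i * p) * (w * y)) = (x * i) * (p * y * w)" by (simp only: ac_simps)
    then show ?thesis using that by simp
  qed
  show ?thesis
    unfolding path_weight_def V P by (rule *[OF one])
qed

lemma Dyck_ConsE:
  assumes "D \<in> Dyck lam u t"
  obtains E where "D = u # E"
  using assms by (cases D) (auto simp: Dyck_def dyck_path_def)

lemma sum_up_part:
  assumes u: "u \<in> Y"
  shows "(\<Sum>D\<in>Cons u ` Dyck lam (fst u - 1, snd u) t. (1 - fps_X ^ hook_length lam u) * path_weight D) =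
    Dyck_gf (fst u - 1, snd u) t"
  unfolding Dyck_gf_def
proof (subst sum.reindex)
  let ?v = "(fst u - 1, snd u)"
  show "sum ((\<lambda>D. (1 - fps_X ^ hook_length lam u) * path_weight D) \<circ> Cons u) (Dyck lam ?v t) =
      sum path_weight (Dyck lam ?v t)"
  proof (rule sum.cong[OF refl])
    fix D assume D: "D \<in> Dyck lam ?v t"
    then obtain E where E: "D = ?v # E" by (rule Dyck_ConsE)
    have "up_step u ?v" using diagram_bounds[OF u] by (simp add: up_step_def)
    moreover from this have "dyck_path lam (u # ?v # E)"
      using D E u by (simp add: Dyck_def dyck_path_Cons_Cons)
    ultimately show "((\<lambda>D. (1 - fps_X ^ hook_length lam u) * path_weight D) \<circ> Cons u) D = path_weight D"
      using path_weight_Cons_up E by simp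
  qed
qed simp

lemma up_right_disjoint:
  "Cons u ` Dyck lam (fst u - 1, snd u) t \<inter> Cons u ` Dyck lam (fst u, Suc (snd u)) t = {}"
  by (auto simp: Dyck_def)

text \<open>On the paths that begin with an up step, the change of weight at \<open>v\<close> takes away the fraction \<open>1 - q^h(v)\<close>. It cancels
the denominator at \<open>v\<close> and leaves the paths from the cell above \<open>v\<close>.\<close>

lemma sum_valley_if_up:
  assumes v: "v \<in> Y" and t: "t \<in> Y"
  shows "(\<Sum>D\<in>Dyck lam v t. path_weight D * valley_if_up D) = Dyck_gf v t - Dyck_gf (fst v - 1, snd v) t"
proof (cases "v = t")
  case True
  have "Dyck lam (fst t - 1, snd t) t = {}"
    using Dyck_bounds[of _ "(fst t - 1, snd t)" t] diagram_bounds[OF t] content_add[OF t] t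
    by (force simp: content_def)
  then show ?thesis using True by (simp add: Dyck_gf_def Dyck_self t valley_if_up_def)
next
  case False
  let ?U = "Cons v ` Dyck lam (fst v - 1, snd v) t" and ?R = "Cons v ` Dyck lam (fst v, Suc (snd v)) t"
  have split: "Dyck lam v t = ?U \<union> ?R" by (rule Dyck_first_step[OF v False])
  have U: "path_weight D * valley_if_up D = path_weight D - (1 - fps_X ^ hook_length lam v) * path_weight D"
    if mem: "D \<in> ?U" for D
  proof -
    obtain F where F: "D = v # F" "F \<in> Dyck lam (fst v - 1, snd v) t" using mem by blast
    obtain E where "F = (fst v - 1, snd v) # E" by (rule Dyck_ConsE[OF F(2)])
    with F(1) have "D = v # (fst v - 1, snd v) # E" by simp
    then have "valley_if_up D = fps_X ^ hook_length lam v"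
      using diagram_bounds[OF v] by (simp add: valley_if_up_def up_step_def)
    then show ?thesis by (simp add: algebra_simps)
  qed
  have R: "path_weight D * valley_if_up D = path_weight D" if mem: "D \<in> ?R" for D
  proof -
    obtain F where F: "D = v # F" "F \<in> Dyck lam (fst v, Suc (snd v)) t" using mem by blast
    obtain E where "F = (fst v, Suc (snd v)) # E" by (rule Dyck_ConsE[OF F(2)])
    with F(1) have "D = v # (fst v, Suc (snd v)) # E" by simp
    then have "valley_if_up D = 1" by (simp add: valley_if_up_def up_step_def)
    then show ?thesis by simp
  qed
  have "(\<Sum>D\<in>Dyck lam v t. path_weight D * valley_if_up D) =
      (\<Sum>D\<in>?U. path_weight D * valley_if_up D) + (\<Sum>D\<in>?R. path_weight D * valley_if_up D)"
    unfolding split by (rule sum.union_disjoint) (auto simp: up_right_disjoint[simplified])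
  also have "\<dots> = (\<Sum>D\<in>?U. path_weight D) - Dyck_gf (fst v - 1, snd v) t + (\<Sum>D\<in>?R. path_weight D)"
  proof (rule arg_cong2[where f = "(+)"])
    have "(\<Sum>D\<in>?U. path_weight D * valley_if_up D) =
        (\<Sum>D\<in>?U. path_weight D - (1 - fps_X ^ hook_length lam v) * path_weight D)"
      by (rule sum.cong[OF refl U])
    also have "\<dots> = (\<Sum>D\<in>?U. path_weight D) - Dyck_gf (fst v - 1, snd v) t"
      unfolding sum_subtractf sum_up_part[OF v] ..
    finally show "(\<Sum>D\<in>?U. path_weight D * valley_if_up D) =
        (\<Sum>D\<in>?U. path_weight D) - Dyck_gf (fst v - 1, snd v) t" .
  qed (rule sum.cong[OF refl R])
  also have "\<dots> = Dyck_gf v t - Dyck_gf (fst v - 1, snd v) t"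
    unfolding Dyck_gf_def[of v] split
    by (subst sum.union_disjoint) (auto simp: up_right_disjoint[simplified])
  finally show ?thesis .
qed

text \<open>After a first step up, only the denominator at \<open>u\<close> splits off; after a first step to the right, the next cell may
have become a valley.\<close>

lemma Dyck_gf_recursion:
  assumes u: "u \<in> Y" "u \<noteq> t" and t: "t \<in> Y"
  shows "(1 - fps_X ^ hook_length lam u) * Dyck_gf u t = Dyck_gf (fst u - 1, snd u) t +
    (if (fst u, Suc (snd u)) \<in> Y
     then Dyck_gf (fst u, Suc (snd u)) t - Dyck_gf (fst u - 1, Suc (snd u)) t else 0)"
proof -
  let ?v = "(fst u, Suc (snd u))"
  let ?U = "Cons u ` Dyck lam (fst u - 1, snd u) t" and ?R = "Cons u ` Dyck lam ?v t"
  have right: "(\<Sum>D\<in>?R. (1 - fps_X ^ hook_length lam u) * path_weight D) =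
     (\<Sum>D\<in>Dyck lam ?v t. path_weight D * valley_if_up D)"
  proof (subst sum.reindex)
    show "sum ((\<lambda>D. (1 - fps_X ^ hook_length lam u) * path_weight D) \<circ> Cons u) (Dyck lam ?v t) =
        (\<Sum>D\<in>Dyck lam ?v t. path_weight D * valley_if_up D)"
    proof (rule sum.cong[OF refl])
      fix D assume D: "D \<in> Dyck lam ?v t"
      then obtain E where E: "D = ?v # E" by (rule Dyck_ConsE)
      have "down_step u ?v" by (simp add: down_step_def)
      moreover from this have "dyck_path lam (u # ?v # E)"
        using D E u by (simp add: Dyck_def dyck_path_Cons_Cons)
      ultimately show "((\<lambda>D. (1 - fps_X ^ hook_length lam u) * path_weight D) \<circ> Cons u) D =
          path_weight D * valley_if_up D"
        using path_weight_Cons_right E by simp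
    qed
  qed simp
  have "(1 - fps_X ^ hook_length lam u) * Dyck_gf u t =
     (\<Sum>D\<in>?U \<union> ?R. (1 - fps_X ^ hook_length lam u) * path_weight D)"
    unfolding Dyck_gf_def sum_distrib_left Dyck_first_step[OF u] ..
  also have "\<dots> = (\<Sum>D\<in>?U. (1 - fps_X ^ hook_length lam u) * path_weight D) +
      (\<Sum>D\<in>?R. (1 - fps_X ^ hook_length lam u) * path_weight D)"
    by (rule sum.union_disjoint) (auto simp: up_right_disjoint[simplified])
  also have "\<dots> = Dyck_gf (fst u - 1, snd u) t + (\<Sum>D\<in>Dyck lam ?v t. path_weight D * valley_if_up D)"
    unfolding sum_up_part[OF u(1)] right ..
  also have "(\<Sum>D\<in>Dyck lam ?v t. path_weight D * valley_if_up D) = (if ?v \<in> Y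
     then Dyck_gf ?v t - Dyck_gf (fst u - 1, Suc (snd u)) t else 0)"
  proof (cases "?v \<in> Y")
    case True
    then show ?thesis using sum_valley_if_up[OF True t] by simp
  next
    case False
    then have "Dyck lam ?v t = {}" using Dyck_bounds by blast
    then show ?thesis using False by simp
  qed
  finally show ?thesis .
qed

lemma Dyck_gf_self:
  assumes "t \<in> Y"
  shows "(1 - fps_X ^ hook_length lam t) * Dyck_gf t t = 1"
  using one_minus_X_power[OF hook_length_pos[OF assms]]
  by (simp add: Dyck_gf_def Dyck_self assms path_weight_def valleys_singleton)

lemma Dyck_gf_above: "fst u < fst t \<Longrightarrow> Dyck_gf u t = 0"
  using Dyck_bounds[of _ u t] by (force simp: Dyck_gf_def intro: sum.neutral)

end

section \<open>Fillings of the rim\<close>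

context young
begin

lemma conj_part_props:
  assumes "(i, j) \<in> Y"
  shows "(conj_part lam j, j) \<in> Y" "i \<le> conj_part lam j" "(i', j) \<in> Y \<Longrightarrow> i' \<le> conj_part lam j"
proof -
  define C where "C = {i. (i, j) \<in> Y}"
  have fin: "finite C" unfolding C_def
    by (rule finite_subset[of _ "{..length lam}"]) (auto simp: diagram_def)
  have "i \<in> C" using assms by (simp add: C_def)
  define m where "m = Max C"
  have m: "m \<in> C" "\<And>i. i \<in> C \<Longrightarrow> i \<le> m"
    using Max_in[OF fin] Max_ge[OF fin] \<open>i \<in> C\<close> by (auto simp: m_def)
  have "C = {1..m}"
  proof (intro Set.set_eqI iffI)
    fix x assume "x \<in> {1..m}"
    then show "x \<in> C"
      using diagram_down_closed[of m j x j] m(1) diagram_bounds[of "(m, j)"] by (simp add: C_def)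
  next
    fix x assume "x \<in> C"
    then show "x \<in> {1..m}"
      using m(2) diagram_bounds[of "(x, j)"] by (simp add: C_def)
  qed
  then have "conj_part lam j = m" by (simp add: conj_part_def C_def)
  then show "(conj_part lam j, j) \<in> Y" "i \<le> conj_part lam j" "(i', j) \<in> Y \<Longrightarrow> i' \<le> conj_part lam j"
    using m assms by (auto simp: C_def)
qed

definition col_bottom :: "nat \<Rightarrow> nat" where
  "col_bottom j = content lam (conj_part lam j, j)"

definition row_end :: "nat \<Rightarrow> nat" where
  "row_end i = content lam (i, part lam i)"

lemma rim_col_bottom:
  assumes "(i, j) \<in> Y"
  shows "rim lam (col_bottom j) = (conj_part lam j, j)" "col_bottom j \<in> contents lam"
proof -
  note C = conj_part_props[OF assms]
  have "(Suc (conj_part lam j), Suc j) \<notin> Y"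
  proof
    assume "(Suc (conj_part lam j), Suc j) \<in> Y"
    then have "(Suc (conj_part lam j), j) \<in> Y"
      using diagram_down_closed[of "Suc (conj_part lam j)" "Suc j" "Suc (conj_part lam j)" j]
        diagram_bounds[OF assms] by simp
    then show False using C(3)[of "Suc (conj_part lam j)"] by simp
  qed
  then show "rim lam (col_bottom j) = (conj_part lam j, j)"
    using rim_eqI[OF C(1)] by (simp add: col_bottom_def)
  show "col_bottom j \<in> contents lam" using C(1) by (auto simp: contents_def col_bottom_def)
qed

lemma rim_row_end:
  assumes "(i, j) \<in> Y"
  shows "rim lam (row_end i) = (i, part lam i)" "row_end i \<in> contents lam" "rim_up lam (row_end i)"
    "(i, part lam i) \<in> Y" "j \<le> part lam i"
proof -
  show j: "j \<le> part lam i" and e: "(i, part lam i) \<in> Y" using assms by (auto simp: diagram_def)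
  have "(Suc i, Suc (part lam i)) \<notin> Y"
    using part_antimono[of i "Suc i"] diagram_bounds[OF assms] by (auto simp: diagram_def)
  then show r: "rim lam (row_end i) = (i, part lam i)"
    using rim_eqI[OF e] by (simp add: row_end_def)
  show c: "row_end i \<in> contents lam" using e by (auto simp: contents_def row_end_def)
  show "rim_up lam (row_end i)"
    using c e r by (auto simp: rim_up_def eastmost_of_row_def diagram_def)
qed

lemma rim_up_row_end: "rim_up lam c \<Longrightarrow> c = row_end (fst (rim lam c))"
proof -
  assume up: "rim_up lam c"
  then have c: "c \<in> contents lam" and east: "eastmost_of_row lam (rim lam c)" by (auto simp: rim_up_def)
  obtain i j where ij: "rim lam c = (i, j)" by fastforce
  have Y: "(i, j) \<in> Y" using rim_props(1)[OF c] ij by simp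
  have "part lam i \<le> j"
    using east rim_row_end(4)[OF Y] by (auto simp: ij eastmost_of_row_def)
  then have "j = part lam i" using rim_row_end(5)[OF Y] by simp
  then show ?thesis using rim_props(2)[OF c] ij by (simp add: row_end_def)
qed

lemma hook_length_contents:
  assumes "(i, j) \<in> Y"
  shows "hook_length lam (i, j) + col_bottom j = Suc (row_end i)" "col_bottom j \<le> row_end i"
proof -
  note C = conj_part_props[OF assms] and R = rim_row_end[OF assms]
  note e = content_add[OF C(1)] content_add[OF R(4)]
  have b: "1 \<le> i" "1 \<le> j" using diagram_bounds[OF assms] by auto
  show "hook_length lam (i, j) + col_bottom j = Suc (row_end i)"
    using e C(2) R(5) b diagram_bounds[OF C(1)] diagram_bounds[OF assms]
    by (simp add: hook_length_def col_bottom_def row_end_def)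
  then show "col_bottom j \<le> row_end i"
    using hook_length_pos[OF assms] by simp
qed

text \<open>Sequences on the contents from \<open>s\<close> to \<open>b\<close> that satisfy the conditions of a reverse plane partition along the rim, with
equality at the up steps that leave rows below row \<open>i\<close>. They can be seen as the reverse plane partitions of the
rim of the diagram cut off below row \<open>i\<close>, whose lowest cells have absorbed the parts of the rim that are cut off.\<close>

definition ribbon_fillings :: "nat \<Rightarrow> nat \<Rightarrow> nat \<Rightarrow> (nat \<Rightarrow> nat) set" where
  "ribbon_fillings i s b = {g. (\<forall>c. \<not> (s \<le> c \<and> c \<le> b) \<longrightarrow> g c = 0) \<and> (\<forall>c. s \<le> c \<and> c < b \<longrightarrow>
     (if rim_up lam c then (if fst (rim lam c) \<le> i then g (Suc c) \<le> g c else g (Suc c) = g c)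
      else g c \<le> g (Suc c)))}"

lemma ribbon_fillingsD:
  assumes "g \<in> ribbon_fillings i s b"
  shows "\<not> (s \<le> c \<and> c \<le> b) \<Longrightarrow> g c = 0"
    and "s \<le> c \<Longrightarrow> c < b \<Longrightarrow> rim_up lam c \<Longrightarrow> g (Suc c) \<le> g c"
    and "s \<le> c \<Longrightarrow> c < b \<Longrightarrow> rim_up lam c \<Longrightarrow> i < fst (rim lam c) \<Longrightarrow> g (Suc c) = g c"
    and "s \<le> c \<Longrightarrow> c < b \<Longrightarrow> \<not> rim_up lam c \<Longrightarrow> g c \<le> g (Suc c)"
proof -
  have step: "if rim_up lam c then if fst (rim lam c) \<le> i then g (Suc c) \<le> g c else g (Suc c) = g c
      else g c \<le> g (Suc c)" if "s \<le> c" "c < b" for c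
    using assms that unfolding ribbon_fillings_def by blast
  show "\<not> (s \<le> c \<and> c \<le> b) \<Longrightarrow> g c = 0"
    using assms unfolding ribbon_fillings_def by blast
  show "g (Suc c) \<le> g c" if "s \<le> c" "c < b" "rim_up lam c"
    using step[OF that(1,2)] that(3) by (simp split: if_splits)
  show "g (Suc c) = g c" if "s \<le> c" "c < b" "rim_up lam c" "i < fst (rim lam c)"
    using step[OF that(1,2)] that(3,4) by simp
  show "g c \<le> g (Suc c)" if "s \<le> c" "c < b" "\<not> rim_up lam c"
    using step[OF that(1,2)] that(3) by simp
qed

lemma ribbon_fillings_supported: "ribbon_fillings i s b \<subseteq> supported b"
  by (auto simp: ribbon_fillings_def supported_def)

context
  fixes i j b :: nat
  assumes ij: "(i, j) \<in> Y" and b: "b \<in> contents lam" "row_end i \<le> b"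
begin

lemma below_row_end:
  assumes "col_bottom j \<le> c" "c < row_end i" "rim_up lam c"
  shows "i < fst (rim lam c)"
proof -
  have "c \<in> contents lam" using assms(3) by (simp add: rim_up_def)
  then have "i \<le> fst (rim lam c)"
    using rim_mono[of c "row_end i"] rim_row_end[OF ij] assms by simp
  moreover have "fst (rim lam c) \<noteq> i" using rim_up_row_end[OF assms(3)] assms(2) by auto
  ultimately show ?thesis by simp
qed

lemma increasing_to_row_end:
  assumes g: "g \<in> ribbon_fillings i (col_bottom j) b" and c: "col_bottom j \<le> c" "c \<le> row_end i"
  shows "g (col_bottom j) \<le> g c"
  using c
proof (induction c rule: dec_induct)
  case (step n)
  then have "g n \<le> g (Suc n)"
    using ribbon_fillingsD(3,4)[OF g, of n] below_row_end[of n] b by (cases "rim_up lam n") auto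
  then show ?case using step by simp
qed simp

text \<open>The contents involved are those of the rim cells below and to the right of \<open>(i, j)\<close>; their number is the hook length
of \<open>(i, j)\<close>.\<close>

definition raise :: "(nat \<Rightarrow> nat) \<Rightarrow> nat \<Rightarrow> nat" where
  "raise g c = (if col_bottom j \<le> c \<and> c \<le> row_end i then Suc (g c) else g c)"

lemma raise_fillings:
  assumes g: "g \<in> ribbon_fillings i (col_bottom j) b"
  shows "raise g \<in> ribbon_fillings i (col_bottom j) b"
proof -
  have rowend: "rim_up lam (row_end i)" "fst (rim lam (row_end i)) = i" using rim_row_end[OF ij] by simp_all
  show ?thesis
    unfolding ribbon_fillings_def
  proof (intro CollectI conjI allI impI)
    fix c assume "\<not> (col_bottom j \<le> c \<and> c \<le> b)"
    then show "raise g c = 0" using ribbon_fillingsD(1)[OF g, of c] b by (auto simp: raise_def)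
  next
    fix c assume c: "col_bottom j \<le> c \<and> c < b"
    consider "c < row_end i" | "c = row_end i" | "row_end i < c" by linarith
    then show "if rim_up lam c then if fst (rim lam c) \<le> i then raise g (Suc c) \<le> raise g c
        else raise g (Suc c) = raise g c else raise g c \<le> raise g (Suc c)"
    proof cases
      case 1
      then show ?thesis
        using ribbon_fillingsD(2-4)[OF g, of c] c by (auto simp: raise_def)
    next
      case 2
      then show ?thesis
        using ribbon_fillingsD(2-4)[OF g, of c] c rowend by (auto simp: raise_def)
    next
      case 3
      then show ?thesis
        using ribbon_fillingsD(2-4)[OF g, of c] c by (auto simp: raise_def)
    qed
  qed
qed

text \<open>A filling weakly increases up to the end of row \<open>i\<close>, and there it must not be exceeded by the following entry. So 1
can be subtracted throughout unless the first entry is zero or the following entry is equal.\<close>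

lemma not_raised:
  "ribbon_fillings i (col_bottom j) b - raise ` ribbon_fillings i (col_bottom j) b =
    {g \<in> ribbon_fillings i (col_bottom j) b. g (col_bottom j) = 0} \<union>
    {g \<in> ribbon_fillings i (col_bottom j) b. row_end i < b \<and> g (Suc (row_end i)) = g (row_end i)}"
proof (intro subset_antisym subsetI)
  let ?A = "ribbon_fillings i (col_bottom j) b"
  let ?Z = "{g \<in> ?A. g (col_bottom j) = 0}"
  let ?E = "{g \<in> ?A. row_end i < b \<and> g (Suc (row_end i)) = g (row_end i)}"
  note se = hook_length_contents(2)[OF ij]
  have rowend: "rim_up lam (row_end i)" "fst (rim lam (row_end i)) = i" using rim_row_end[OF ij] by simp_all
  fix g assume g: "g \<in> ?A - raise ` ?A"
  show "g \<in> ?Z \<union> ?E"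
  proof (rule ccontr)
    assume n: "g \<notin> ?Z \<union> ?E"
    define g' where "g' = (\<lambda>c. if col_bottom j \<le> c \<and> c \<le> row_end i then g c - 1 else g c)"
    have pos: "0 < g c" if "col_bottom j \<le> c" "c \<le> row_end i" for c
      using increasing_to_row_end[of g c] that g n by auto
    have "raise g' = g" using pos by (auto simp: fun_eq_iff raise_def g'_def)
    moreover have "g' \<in> ?A"
      unfolding ribbon_fillings_def
    proof (intro CollectI conjI allI impI)
      fix c assume "\<not> (col_bottom j \<le> c \<and> c \<le> b)"
      then show "g' c = 0" using ribbon_fillingsD(1)[of g i "col_bottom j" b c] g b by (auto simp: g'_def)
    next
      fix c assume c: "col_bottom j \<le> c \<and> c < b"
      have gA: "g \<in> ?A" using g by simp
      consider "c < row_end i" | "c = row_end i" | "row_end i < c" by linarith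
      then show "if rim_up lam c then if fst (rim lam c) \<le> i then g' (Suc c) \<le> g' c
          else g' (Suc c) = g' c else g' c \<le> g' (Suc c)"
      proof cases
        case 1
        then show ?thesis
          using ribbon_fillingsD(2-4)[OF gA, of c] c by (auto simp: g'_def)
      next
        case 2
        have "g (Suc c) < g c" using ribbon_fillingsD(2)[OF gA, of c] c 2 rowend n gA by auto
        then show ?thesis using 2 rowend se by (auto simp: g'_def)
      next
        case 3
        then show ?thesis
          using ribbon_fillingsD(2-4)[OF gA, of c] c by (auto simp: g'_def)
      qed
    qed
    ultimately show False using g by (metis DiffD2 image_eqI)
  qed
next
  let ?A = "ribbon_fillings i (col_bottom j) b"
  let ?Z = "{g \<in> ?A. g (col_bottom j) = 0}"
  let ?E = "{g \<in> ?A. row_end i < b \<and> g (Suc (row_end i)) = g (row_end i)}"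
  note se = hook_length_contents(2)[OF ij]
  have rowend: "rim_up lam (row_end i)" "fst (rim lam (row_end i)) = i" using rim_row_end[OF ij] by simp_all
  fix g assume g: "g \<in> ?Z \<union> ?E"
  have "g \<noteq> raise h" if h: "h \<in> ?A" for h
  proof
    assume "g = raise h"
    then have "g (col_bottom j) \<noteq> 0" "g (row_end i) = Suc (h (row_end i))" "g (Suc (row_end i)) = h (Suc (row_end i))"
      using se by (auto simp: raise_def)
    moreover from this g have "row_end i < b" by auto
    moreover have "h (Suc (row_end i)) \<le> h (row_end i)"
      using ribbon_fillingsD(2)[OF h se \<open>row_end i < b\<close> rowend(1)] .
    ultimately show False using g by auto
  qed
  then show "g \<in> ?A - raise ` ?A" using g by blast
qed

lemma wgf_not_raised:
  "(1 - fps_X ^ hook_length lam (i, j)) * wgf b (ribbon_fillings i (col_bottom j) b) =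
    wgf b ({g \<in> ribbon_fillings i (col_bottom j) b. g (col_bottom j) = 0} \<union>
      {g \<in> ribbon_fillings i (col_bottom j) b. row_end i < b \<and> g (Suc (row_end i)) = g (row_end i)})"
proof -
  let ?A = "ribbon_fillings i (col_bottom j) b"
  note supp = ribbon_fillings_supported[of i "col_bottom j" b]
  have "wgf b (raise ` ?A) = fps_X ^ hook_length lam (i, j) * wgf b ?A"
  proof (rule wgf_shift)
    show "inj_on raise ?A"
    proof (rule inj_onI, rule ext)
      fix g h c assume "raise g = raise h"
      then have "raise g c = raise h c" by simp
      then show "g c = h c" by (simp add: raise_def split: if_splits)
    qed
    fix g
    have "(\<Sum>c\<le>b. raise g c) = (\<Sum>c\<le>b. g c + (if c \<in> {col_bottom j..row_end i} then 1 else 0))"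
      by (intro sum.cong refl) (simp add: raise_def)
    also have "\<dots> = (\<Sum>c\<le>b. g c) + card ({..b} \<inter> {col_bottom j..row_end i})"
      unfolding sum.distrib by (subst sum.inter_restrict[symmetric]) simp_all
    also have "{..b} \<inter> {col_bottom j..row_end i} = {col_bottom j..row_end i}" using b by auto
    also have "card \<dots> = hook_length lam (i, j)" using hook_length_contents[OF ij] by simp
    finally show "(\<Sum>c\<le>b. raise g c) = (\<Sum>c\<le>b. g c) + hook_length lam (i, j)" .
  qed
  moreover have "wgf b ?A = wgf b (raise ` ?A \<union> (?A - raise ` ?A))"
    using raise_fillings by (intro arg_cong[where f = "wgf b"]) blast
  moreover have "wgf b (raise ` ?A \<union> (?A - raise ` ?A)) =
      wgf b (raise ` ?A) + wgf b (?A - raise ` ?A) - wgf b (raise ` ?A \<inter> (?A - raise ` ?A))"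
    by (rule wgf_Un) (use supp raise_fillings in blast)+
  moreover have "raise ` ?A \<inter> (?A - raise ` ?A) = {}" by blast
  ultimately have "(1 - fps_X ^ hook_length lam (i, j)) * wgf b ?A = wgf b (?A - raise ` ?A)"
    by (simp add: wgf_empty algebra_simps)
  then show ?thesis unfolding not_raised .
qed

text \<open>Before the bottom of column \<open>j + 1\<close> is reached, the rim goes up inside column \<open>j\<close> through rows below row \<open>i\<close>,
where the entries do not change.\<close>

lemma start_zero_next_column:
  assumes nxt: "(i, Suc j) \<in> Y" and i': "i' \<le> i"
  shows "{g \<in> ribbon_fillings i' (col_bottom j) b. g (col_bottom j) = 0} = ribbon_fillings i' (col_bottom (Suc j)) b"
proof -
  let ?s = "col_bottom j" and ?s' = "col_bottom (Suc j)"
  note S = rim_col_bottom[OF ij] and S' = rim_col_bottom[OF nxt]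
  have s'end: "?s' \<le> row_end i" by (rule hook_length_contents(2)[OF nxt])
  have less: "?s < ?s'"
  proof (rule ccontr)
    assume "\<not> ?s < ?s'"
    then show False using rim_mono[OF S'(2) S(2)] S(1) S'(1) by simp
  qed
  have inner: "rim_up lam c \<and> i < fst (rim lam c)" if c: "?s \<le> c" "Suc c < ?s'" for c
  proof -
    have K: "c \<in> contents lam" "Suc c \<in> contents lam"
      using contents_between[OF S(2) S'(2)] c by auto
    have "rim_up lam c"
    proof (rule ccontr)
      assume r: "\<not> rim_up lam c"
      have "rim lam (Suc c) = (fst (rim lam c), Suc (snd (rim lam c)))"
        using rim_step_right[OF K(1) r] by simp
      moreover have "j \<le> snd (rim lam c)" using rim_mono[OF S(2) K(1) c(1)] S(1) by simp
      moreover have "snd (rim lam (Suc c)) \<le> Suc j" "conj_part lam (Suc j) \<le> fst (rim lam (Suc c))"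
        using rim_mono[OF K(2) S'(2)] S'(1) c(2) by auto
      ultimately have col: "snd (rim lam (Suc c)) = Suc j"
        and row: "conj_part lam (Suc j) \<le> fst (rim lam (Suc c))" by simp_all
      have "(fst (rim lam (Suc c)), Suc j) \<in> Y"
        using rim_props(1)[OF K(2)] unfolding col[symmetric] by simp
      then have "fst (rim lam (Suc c)) \<le> conj_part lam (Suc j)"
        by (rule conj_part_props(3)[OF nxt])
      with row have row': "fst (rim lam (Suc c)) = conj_part lam (Suc j)" by (rule le_antisym[rotated])
      have "rim lam (Suc c) = rim lam ?s'"
        unfolding S'(1) by (rule prod_eqI) (simp_all only: fst_conv snd_conv row' col)
      then have "content lam (rim lam (Suc c)) = content lam (rim lam ?s')" by (rule arg_cong)
      then have "Suc c = ?s'" unfolding rim_props(2)[OF K(2)] rim_props(2)[OF S'(2)] .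
      then show False using c by simp
    qed
    then show ?thesis using below_row_end[of c] c s'end by simp
  qed
  have last: "\<not> rim_up lam c" if c: "Suc c = ?s'" for c
  proof
    assume up: "rim_up lam c"
    then have K: "c \<in> contents lam" by (simp add: rim_up_def)
    have "rim lam c = (Suc (fst (rim lam ?s')), snd (rim lam ?s'))"
      using rim_step_up[OF K, unfolded c, OF S'(2) up] .
    then have "(Suc (conj_part lam (Suc j)), Suc j) \<in> Y"
      using rim_props(1)[OF K] unfolding S'(1) by simp
    then show False using conj_part_props(3)[OF nxt, of "Suc (conj_part lam (Suc j))"] by simp
  qed
  show ?thesis
  proof (intro subset_antisym subsetI)
    fix g assume "g \<in> {g \<in> ribbon_fillings i' ?s b. g ?s = 0}"
    then have g: "g \<in> ribbon_fillings i' ?s b" "g ?s = 0" by auto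
    have zero: "g c = 0" if "?s \<le> c" "c < ?s'" for c
      using that
    proof (induction c rule: dec_induct)
      case (step n)
      then show ?case
        using inner[of n] ribbon_fillingsD(3)[OF g(1), of n] s'end b i' by simp
    qed (rule g(2))
    show "g \<in> ribbon_fillings i' ?s' b"
      unfolding ribbon_fillings_def
    proof (intro CollectI conjI allI impI)
      fix c assume "\<not> (?s' \<le> c \<and> c \<le> b)"
      then show "g c = 0"
        using ribbon_fillingsD(1)[OF g(1), of c] zero[of c] by (cases "?s \<le> c") auto
    next
      fix c assume "?s' \<le> c \<and> c < b"
      then show "if rim_up lam c then if fst (rim lam c) \<le> i' then g (Suc c) \<le> g c
          else g (Suc c) = g c else g c \<le> g (Suc c)"
        using ribbon_fillingsD(2-4)[OF g(1), of c] less by auto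
    qed
  next
    fix g assume g: "g \<in> ribbon_fillings i' ?s' b"
    have zero: "g c = 0" if "c < ?s'" for c using ribbon_fillingsD(1)[OF g, of c] that by auto
    have "g \<in> ribbon_fillings i' ?s b"
      unfolding ribbon_fillings_def
    proof (intro CollectI conjI allI impI)
      fix c assume "\<not> (?s \<le> c \<and> c \<le> b)"
      then show "g c = 0" using ribbon_fillingsD(1)[OF g, of c] less by auto
    next
      fix c assume c: "?s \<le> c \<and> c < b"
      consider "Suc c < ?s'" | "Suc c = ?s'" | "?s' \<le> c" by linarith
      then show "if rim_up lam c then if fst (rim lam c) \<le> i' then g (Suc c) \<le> g c
          else g (Suc c) = g c else g c \<le> g (Suc c)"
      proof cases
        case 1
        then show ?thesis using zero[of c] zero[of "Suc c"] by simp
      next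
        case 2
        then show ?thesis using zero[of c] last[OF 2] by simp
      next
        case 3
        then show ?thesis using ribbon_fillingsD(2-4)[OF g, of c] c by auto
      qed
    qed
    then show "g \<in> {g \<in> ribbon_fillings i' ?s b. g ?s = 0}" using zero[OF less] by simp
  qed
qed

text \<open>The last cell of row \<open>i\<close> is the only one from which the rim goes up out of row \<open>i\<close>.\<close>

lemma equal_at_row_end:
  assumes "row_end i < b"
  shows "{g \<in> ribbon_fillings i (col_bottom j) b. row_end i < b \<and> g (Suc (row_end i)) = g (row_end i)} =
    ribbon_fillings (i - 1) (col_bottom j) b"
proof (intro subset_antisym subsetI)
  let ?s = "col_bottom j"
  have i: "1 \<le> i" using diagram_bounds[OF ij] by simp
  {
    fix g assume "g \<in> {g \<in> ribbon_fillings i ?s b. row_end i < b \<and> g (Suc (row_end i)) = g (row_end i)}"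
    then have g: "g \<in> ribbon_fillings i ?s b" "g (Suc (row_end i)) = g (row_end i)" by auto
    show "g \<in> ribbon_fillings (i - 1) ?s b"
      unfolding ribbon_fillings_def
    proof (intro CollectI conjI allI impI)
      fix c assume "\<not> (?s \<le> c \<and> c \<le> b)"
      then show "g c = 0" using ribbon_fillingsD(1)[OF g(1), of c] by auto
    next
      fix c assume c: "?s \<le> c \<and> c < b"
      have "g (Suc c) = g c" if "rim_up lam c" "fst (rim lam c) = i"
        using rim_up_row_end[OF that(1)] that(2) g(2) by simp
      then show "if rim_up lam c then if fst (rim lam c) \<le> i - 1 then g (Suc c) \<le> g c
          else g (Suc c) = g c else g c \<le> g (Suc c)"
        using ribbon_fillingsD(2-4)[OF g(1), of c] c by (cases "fst (rim lam c) = i") auto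
    qed
  next
    fix g assume g: "g \<in> ribbon_fillings (i - 1) ?s b"
    have "g (Suc (row_end i)) = g (row_end i)"
      using ribbon_fillingsD(3)[OF g, of "row_end i"] hook_length_contents(2)[OF ij] assms
        rim_row_end[OF ij] i by simp
    moreover have "g \<in> ribbon_fillings i ?s b"
      unfolding ribbon_fillings_def
    proof (intro CollectI conjI allI impI)
      fix c assume "\<not> (?s \<le> c \<and> c \<le> b)"
      then show "g c = 0" using ribbon_fillingsD(1)[OF g, of c] by auto
    next
      fix c assume c: "?s \<le> c \<and> c < b"
      show "if rim_up lam c then if fst (rim lam c) \<le> i then g (Suc c) \<le> g c
          else g (Suc c) = g c else g c \<le> g (Suc c)"
        using ribbon_fillingsD(2-4)[OF g, of c] c by auto
    qed
    ultimately show "g \<in> {g \<in> ribbon_fillings i ?s b. row_end i < b \<and> g (Suc (row_end i)) = g (row_end i)}"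
      using assms by simp
  }
qed

lemma start_zero_last_column:
  assumes "(i, Suc j) \<notin> Y" and g: "g \<in> ribbon_fillings i (col_bottom j) b" "g (col_bottom j) = 0"
    and c: "col_bottom j \<le> c" "c \<le> row_end i"
  shows "g c = 0"
  using c
proof (induction c rule: dec_induct)
  case (step n)
  note S = rim_col_bottom[OF ij] and R = rim_row_end[OF ij]
  have K: "n \<in> contents lam" "Suc n \<in> contents lam"
    using contents_between[OF S(2) R(2)] step by auto
  have j: "part lam i = j"
    using R(4,5) assms(1) diagram_down_closed[of i "part lam i" i "Suc j"] diagram_bounds[OF ij]
    by (cases "part lam i = j") auto
  have "rim_up lam n"
  proof (rule ccontr)
    assume "\<not> rim_up lam n"
    then have "snd (rim lam (Suc n)) = Suc (snd (rim lam n))" using rim_step_right[OF K(1)] by simp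
    moreover have "j \<le> snd (rim lam n)" using rim_mono[OF S(2) K(1)] S(1) step by simp
    moreover have "snd (rim lam (Suc n)) \<le> j" using rim_mono[OF K(2) R(2)] R(1) step j by simp
    ultimately show False by simp
  qed
  then show ?case
    using ribbon_fillingsD(3)[OF g(1), of n] below_row_end[of n] step b by simp
qed (rule g(2))

end

text \<open>Inclusion-exclusion over the two cases of \<open>not_raised\<close> gives the recursion of \<open>Dyck_gf_recursion\<close>.\<close>

lemma wgf_ribbon_fillings:
  assumes t: "t \<in> Y" "rim lam b = t" "b \<in> contents lam" "rim_up lam b"
    and ij: "(i, j) \<in> Y" "fst t \<le> i"
  shows "wgf b (ribbon_fillings i (col_bottom j) b) = Dyck_gf (i, j) t"
  using ij
\<comment> \<open>all cells on the right of the recursion have larger content\<close>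
proof (induction "length lam + part lam 1 - content lam (i, j)" arbitrary: i j rule: less_induct)
  case less
  note ij = less.prems(1)
  let ?X = "1 - fps_X ^ hook_length lam (i, j) :: rat fps"
  let ?A = "\<lambda>i. ribbon_fillings i (col_bottom j) b"
  have t_end: "b = row_end (fst t)" using rim_up_row_end[OF t(4)] t(2) by simp
  have te: "(fst t, snd t) \<in> Y" using t(1) by simp
  have sndt: "snd t = part lam (fst t)" using rim_row_end(1)[OF te] t_end t(2) by (simp add: prod_eq_iff)
  have end_le: "row_end i \<le> b"
  proof (rule ccontr)
    assume "\<not> row_end i \<le> b"
    then have "fst (rim lam (row_end i)) \<le> fst (rim lam b)" "b \<noteq> row_end i"
      using rim_mono[OF t(3) rim_row_end(2)[OF ij]] by auto
    then have "i = fst t" using rim_row_end(1)[OF ij] t(2) less.prems(2) by simp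
    then show False using t_end \<open>b \<noteq> row_end i\<close> by simp
  qed
  have end_less: "row_end i < b \<longleftrightarrow> i \<noteq> fst t"
  proof
    assume "row_end i < b"
    then show "i \<noteq> fst t" using t_end by auto
  next
    assume "i \<noteq> fst t"
    then have "row_end i \<noteq> b" using rim_row_end(1)[OF ij] t(2) by auto
    then show "row_end i < b" using end_le by simp
  qed
  have hook: "0 < hook_length lam (i, j)" by (rule hook_length_pos[OF ij])
  have small: "content lam u < length lam + part lam 1" if "u \<in> Y" for u
    using that contents_iff by (auto simp: contents_def)
  have up: "wgf b (ribbon_fillings (i - 1) (col_bottom j) b) = Dyck_gf (i - 1, j) t" if "i \<noteq> fst t"
  proof -
    have "fst t < i" using that less.prems(2) by simp
    moreover have "1 \<le> fst t" "1 \<le> j" using diagram_bounds[OF ij] diagram_bounds[OF t(1)] by auto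
    ultimately have "1 \<le> i - 1" "1 \<le> j" by linarith+
    then have "(i - 1, j) \<in> Y" by (intro diagram_down_closed[OF ij]) simp_all
    moreover have "content lam (i - 1, j) = Suc (content lam (i, j))"
      using content_down[of "i - 1" j] ij diagram_bounds[OF ij] by simp
    ultimately show ?thesis using less.hyps[of "i - 1" j] small[OF ij] that less.prems(2) by simp
  qed
  have right: "wgf b (ribbon_fillings i (col_bottom (Suc j)) b) = Dyck_gf (i, Suc j) t" if "(i, Suc j) \<in> Y"
    using less.hyps[of i "Suc j"] small[OF ij] content_right[OF ij] that less.prems(2) by simp
  have upright: "wgf b (ribbon_fillings (i - 1) (col_bottom (Suc j)) b) = Dyck_gf (i - 1, Suc j) t"
    if "(i, Suc j) \<in> Y" "i \<noteq> fst t"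
  proof -
    have "fst t < i" using that(2) less.prems(2) by simp
    moreover have "1 \<le> fst t" using diagram_bounds[OF t(1)] by simp
    ultimately have "1 \<le> i - 1" by linarith
    then have "(i - 1, Suc j) \<in> Y" by (intro diagram_down_closed[OF that(1)]) simp_all
    moreover have "content lam (i - 1, Suc j) = Suc (Suc (content lam (i, j)))"
      using content_down[of "i - 1" "Suc j"] content_right[OF ij] that diagram_bounds[OF ij] by simp
    ultimately show ?thesis using less.hyps[of "i - 1" "Suc j"] small[OF ij] that less.prems(2) by simp
  qed
  have cancel: "f = g" if "?X * f = ?X * g" for f g :: "rat fps"
  proof -
    have "?X \<noteq> 0" using one_minus_X_power[OF hook] by (metis mult_zero_left zero_neq_one)
    then show ?thesis using that by simp
  qed
  let ?Z = "{g \<in> ?A i. g (col_bottom j) = 0}"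
  let ?E = "{g \<in> ?A i. row_end i < b \<and> g (Suc (row_end i)) = g (row_end i)}"
  have main: "?X * wgf b (?A i) = wgf b (?Z \<union> ?E)"
    by (rule wgf_not_raised[OF ij t(3) end_le])
  show ?case
  proof (rule cancel)
    show "?X * wgf b (?A i) = ?X * Dyck_gf (i, j) t"
    proof (cases "i = fst t")
      case False
      then have A1: "?E = ?A (i - 1)" using equal_at_row_end[OF ij t(3) end_le] end_less by blast
      have ne: "(i, j) \<noteq> t" using False by auto
      show ?thesis
      proof (cases "(i, Suc j) \<in> Y")
        case True
        have A0: "?Z = ribbon_fillings i (col_bottom (Suc j)) b"
          by (rule start_zero_next_column[OF ij t(3) end_le True]) simp
        have "?Z \<inter> ?E = {g \<in> ?E. g (col_bottom j) = 0}" by blast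
        also have "\<dots> = ribbon_fillings (i - 1) (col_bottom (Suc j)) b"
          unfolding A1 by (rule start_zero_next_column[OF ij t(3) end_le True]) simp
        finally have A01: "?Z \<inter> ?E = ribbon_fillings (i - 1) (col_bottom (Suc j)) b" .
        have "wgf b (?Z \<union> ?E) = wgf b ?Z + wgf b ?E - wgf b (?Z \<inter> ?E)"
          by (rule wgf_Un) (use ribbon_fillings_supported[of i "col_bottom j" b] in blast)+
        also have "\<dots> = Dyck_gf (i, Suc j) t + Dyck_gf (i - 1, j) t - Dyck_gf (i - 1, Suc j) t"
          unfolding A01 unfolding A0 A1 up[OF False] right[OF True] upright[OF True False] ..
        finally show ?thesis
          using main Dyck_gf_recursion[OF ij ne t(1)] True by simp
      next
        case no: False
        have "?Z \<subseteq> ?E"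
        proof
          fix g assume "g \<in> ?Z"
          then have g: "g \<in> ?A i" "g (col_bottom j) = 0" by auto
          have "g (row_end i) = 0"
            by (rule start_zero_last_column[OF ij t(3) end_le no g]) (auto intro: hook_length_contents(2)[OF ij])
          moreover have "g (Suc (row_end i)) \<le> g (row_end i)"
            using ribbon_fillingsD(2)[OF g(1), of "row_end i"] hook_length_contents(2)[OF ij]
              end_less False rim_row_end(3)[OF ij] by simp
          ultimately show "g \<in> ?E" using g end_less False by simp
        qed
        then have "?Z \<union> ?E = ?A (i - 1)" using A1 by blast
        then show ?thesis
          using main up[OF False] Dyck_gf_recursion[OF ij ne t(1)] no by simp
      qed
    next
      case True
      then have empty: "?E = {}" using end_less by auto
      have main': "?X * wgf b (?A i) = wgf b ?Z" using main unfolding empty by simp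
      show ?thesis
      proof (cases "(i, Suc j) \<in> Y")
        case yes: True
        have "j \<noteq> snd t" using yes sndt True by (auto simp: diagram_def)
        then have ne: "(i, j) \<noteq> t" by auto
        have "?Z = ribbon_fillings i (col_bottom (Suc j)) b"
          by (rule start_zero_next_column[OF ij t(3) end_le yes]) simp
        then have "?X * wgf b (?A i) = Dyck_gf (i, Suc j) t"
          using main' right[OF yes] by simp
        moreover have "i - 1 < fst t" using True diagram_bounds[OF ij] by simp
        then have "Dyck_gf (i - 1, j) t = 0" "Dyck_gf (i - 1, Suc j) t = 0"
          using Dyck_gf_above by simp_all
        ultimately show ?thesis using Dyck_gf_recursion[OF ij ne t(1)] yes by simp
      next
        case no: False
        have "j = snd t"
          using no sndt True rim_row_end(4,5)[OF ij] diagram_bounds[OF ij]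
            diagram_down_closed[of i "part lam i" i "Suc j"] by (cases "j = part lam i") auto
        then have eq: "(i, j) = t" using True by simp
        have "?Z = {\<lambda>_. 0}"
        proof (intro subset_antisym subsetI)
          fix g assume "g \<in> ?Z"
          then have g: "g \<in> ?A i" "g (col_bottom j) = 0" by auto
          have "g c = 0" for c
            using start_zero_last_column[OF ij t(3) end_le no g, of c] ribbon_fillingsD(1)[OF g(1), of c]
              True t_end by (cases "col_bottom j \<le> c \<and> c \<le> b") auto
          then show "g \<in> {\<lambda>_. 0}" by auto
        qed (auto simp: ribbon_fillings_def)
        then show ?thesis using main' wgf_zero Dyck_gf_self[OF t(1)] eq by simp
      qed
    qed
  qed
qed

end

section \<open>Ribbons and the entries of the determinant\<close>

context young
begin

definition ribbon :: "nat \<Rightarrow> nat \<Rightarrow> cell set" where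
  "ribbon a b = rim lam ` {a..b}"

context
  fixes a b :: nat
  assumes ab: "a \<in> contents lam" "b \<in> contents lam"
begin

lemma ribbon_contents: "c \<in> {a..b} \<Longrightarrow> c \<in> contents lam"
  using contents_between[OF ab] by simp

lemma ribbon_subset: "ribbon a b \<subseteq> Y"
  unfolding ribbon_def using rim_props(1)[OF ribbon_contents] by blast

lemma rim_in_ribbon: "c \<in> {a..b} \<Longrightarrow> rim lam c \<in> ribbon a b"
  by (simp add: ribbon_def)

lemma ribbonE:
  assumes "u \<in> ribbon a b"
  shows "content lam u \<in> {a..b}" "rim lam (content lam u) = u"
proof -
  obtain c where c: "c \<in> {a..b}" "u = rim lam c" using assms by (auto simp: ribbon_def)
  then have "content lam u = c" using rim_props(2)[OF ribbon_contents] by simp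
  then show "content lam u \<in> {a..b}" "rim lam (content lam u) = u" using c by simp_all
qed

lemma ribbon_not_southeast: "u \<in> ribbon a b \<Longrightarrow> (Suc (fst u), Suc (snd u)) \<notin> Y"
  using rim_props(3)[OF ribbon_contents] ribbonE by metis

text \<open>Comparable cells of the rim lie in one row or in one column.\<close>

lemma ribbon_order_convex: "order_convex (ribbon a b)"
  unfolding order_convex_def
proof (intro ballI allI impI)
  fix u v w
  assume u: "u \<in> ribbon a b" and v: "v \<in> ribbon a b"
    and w: "fst u \<le> fst w \<and> fst w \<le> fst v \<and> snd u \<le> snd w \<and> snd w \<le> snd v"
  have Yu: "u \<in> Y" and Yv: "v \<in> Y" using u v ribbon_subset by auto
  note bu = diagram_bounds[OF Yu] and bv = diagram_bounds[OF Yv]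
  have Yw: "w \<in> Y"
    using diagram_down[OF Yv, of "fst w" "snd w"] w bu by simp
  have "(Suc (fst w), Suc (snd w)) \<notin> Y"
  proof
    assume "(Suc (fst w), Suc (snd w)) \<in> Y"
    then have "(Suc (fst u), Suc (snd u)) \<in> Y"
      by (rule diagram_down_closed) (use w in auto)
    then show False using ribbon_not_southeast[OF u] by simp
  qed
  then have "rim lam (content lam w) = w" by (rule rim_eqI[OF Yw])
  moreover have "content lam w \<in> {a..b}"
  proof -
    have "fst u = fst v \<or> snd u = snd v"
    proof (rule ccontr)
      assume "\<not> (fst u = fst v \<or> snd u = snd v)"
      then have "(Suc (fst u), Suc (snd u)) \<in> Y"
        using w by (intro diagram_down[OF Yv]) auto
      then show False using ribbon_not_southeast[OF u] by simp
    qed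
    then have "fst u = fst w \<and> fst w = fst v \<or> snd u = snd w \<and> snd w = snd v" using w by auto
    then have "content lam u \<le> content lam w \<and> content lam w \<le> content lam v \<or>
        content lam v \<le> content lam w \<and> content lam w \<le> content lam u"
    proof
      assume "fst u = fst w \<and> fst w = fst v"
      then show ?thesis
        using w content_add[OF Yu] content_add[OF Yv] content_add[OF Yw] by (intro disjI1) linarith
    next
      assume "snd u = snd w \<and> snd w = snd v"
      then show ?thesis
        using w content_add[OF Yu] content_add[OF Yv] content_add[OF Yw] by (intro disjI2) linarith
    qed
    then show ?thesis using ribbonE(1)[OF u] ribbonE(1)[OF v] by auto
  qed
  ultimately show "w \<in> ribbon a b" by (metis rim_in_ribbon)
qed

lemma sum_ribbon: "(\<Sum>u\<in>ribbon a b. f u) = (\<Sum>c\<in>{a..b}. f (rim lam c))"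
  unfolding ribbon_def
proof (subst sum.reindex)
  show "inj_on (rim lam) {a..b}"
    using rim_props(2)[OF ribbon_contents] by (intro inj_onI) metis
qed (simp add: o_def)

lemma RPP_ribbon_iff:
  assumes out: "\<And>u. u \<notin> ribbon a b \<Longrightarrow> \<pi> u = 0"
  shows "\<pi> \<in> RPP (ribbon a b) \<longleftrightarrow> (\<forall>c. a \<le> c \<and> c < b \<longrightarrow>
     (if rim_up lam c then \<pi> (rim lam (Suc c)) \<le> \<pi> (rim lam c) else \<pi> (rim lam c) \<le> \<pi> (rim lam (Suc c))))"
proof (intro iffI allI impI)
  fix c assume p: "\<pi> \<in> RPP (ribbon a b)" and c: "a \<le> c \<and> c < b"
  have K: "c \<in> contents lam" "Suc c \<in> contents lam" using ribbon_contents c by auto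
  have mem: "rim lam c \<in> ribbon a b" "rim lam (Suc c) \<in> ribbon a b" using rim_in_ribbon c by auto
  note mono = RPP_order_mono[OF ribbon_order_convex p]
  show "if rim_up lam c then \<pi> (rim lam (Suc c)) \<le> \<pi> (rim lam c) else \<pi> (rim lam c) \<le> \<pi> (rim lam (Suc c))"
  proof (cases "rim_up lam c")
    case True
    have "fst (rim lam c) = Suc (fst (rim lam (Suc c)))" "snd (rim lam c) = snd (rim lam (Suc c))"
      using rim_step_up[OF K True] by (metis fst_conv snd_conv)+
    then show ?thesis using True mono[OF mem(2,1)] by simp
  next
    case False
    have "fst (rim lam (Suc c)) = fst (rim lam c)" "snd (rim lam (Suc c)) = Suc (snd (rim lam c))"
      using rim_step_right[OF K(1) False] by simp_all
    then show ?thesis using False mono[OF mem] by simp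
  qed
next
  assume step: "\<forall>c. a \<le> c \<and> c < b \<longrightarrow>
     (if rim_up lam c then \<pi> (rim lam (Suc c)) \<le> \<pi> (rim lam c) else \<pi> (rim lam c) \<le> \<pi> (rim lam (Suc c)))"
  show "\<pi> \<in> RPP (ribbon a b)"
  proof (rule RPP_adjacentI[OF ribbon_order_convex out])
    fix r s assume rs: "(r, s) \<in> ribbon a b" "(r, Suc s) \<in> ribbon a b"
    define c where "c = content lam (r, s)"
    have c': "content lam (r, Suc s) = Suc c"
      using content_right[of r s] rs ribbon_subset by (auto simp: c_def)
    have R: "rim lam c = (r, s)" "rim lam (Suc c) = (r, Suc s)"
      using ribbonE(2)[OF rs(1)] ribbonE(2)[OF rs(2)] c' by (simp_all add: c_def)
    have c: "a \<le> c" "c < b" using ribbonE(1)[OF rs(1)] ribbonE(1)[OF rs(2)] c' by (simp_all add: c_def)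
    have K: "c \<in> contents lam" "Suc c \<in> contents lam" using ribbon_contents c by auto
    have "\<not> rim_up lam c" using rim_step_up[OF K] R by auto
    then show "\<pi> (r, s) \<le> \<pi> (r, Suc s)" using step c R by force
  next
    fix r s assume rs: "(r, s) \<in> ribbon a b" "(Suc r, s) \<in> ribbon a b"
    define c where "c = content lam (Suc r, s)"
    have c': "content lam (r, s) = Suc c"
      using content_down[of r s] rs ribbon_subset by (auto simp: c_def)
    have R: "rim lam c = (Suc r, s)" "rim lam (Suc c) = (r, s)"
      using ribbonE(2)[OF rs(1)] ribbonE(2)[OF rs(2)] c' by (simp_all add: c_def)
    have c: "a \<le> c" "c < b" using ribbonE(1)[OF rs(1)] ribbonE(1)[OF rs(2)] c' by (simp_all add: c_def)
    have K: "c \<in> contents lam" using ribbon_contents c by auto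
    have "rim_up lam c" using rim_step_right[OF K] R by auto
    then show "\<pi> (r, s) \<le> \<pi> (Suc r, s)" using step c R by force
  qed
qed

end

lemma RPP_gf_ribbon:
  assumes a: "a \<in> contents lam" "southmost_of_column lam (rim lam a)" and b: "b \<in> contents lam"
  shows "RPP_gf (ribbon a b) = wgf b (ribbon_fillings (fst (rim lam a)) a b)"
proof (rule fps_ext)
  fix n :: nat
  note ab = a(1) b
  let ?i = "fst (rim lam a)"
  let ?P = "{\<pi> \<in> RPP (ribbon a b). (\<Sum>u\<in>ribbon a b. \<pi> u) = n}"
  let ?G = "{g \<in> ribbon_fillings ?i a b. (\<Sum>c\<le>b. g c) = n}"
  let ?to = "\<lambda>\<pi> c. if a \<le> c \<and> c \<le> b then \<pi> (rim lam c) else (0::nat)"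
  let ?from = "\<lambda>g u. if u \<in> ribbon a b then g (content lam u) else (0::nat)"
  have low: "fst (rim lam c) \<le> ?i" if "a \<le> c" "c < b" for c
    using rim_mono[OF a(1) ribbon_contents[OF ab]] that by auto
  have sum: "(\<Sum>c\<le>b. if a \<le> c \<and> c \<le> b then f c else 0) = (\<Sum>c\<in>{a..b}. f c)" for f :: "nat \<Rightarrow> nat"
    by (rule sum.mono_neutral_cong_right) auto
  have "bij_betw ?to ?P ?G"
  proof (rule bij_betw_byWitness[where f' = ?from])
    show "\<forall>\<pi>\<in>?P. ?from (?to \<pi>) = \<pi>"
    proof (intro ballI ext)
      fix \<pi> u assume "\<pi> \<in> ?P"
      then have "u \<notin> ribbon a b \<Longrightarrow> \<pi> u = 0" unfolding RPP_def by blast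
      then show "?from (?to \<pi>) u = \<pi> u"
        using ribbonE[OF ab, of u] by (cases "u \<in> ribbon a b") simp_all
    qed
    show "\<forall>g\<in>?G. ?to (?from g) = g"
    proof (intro ballI ext)
      fix g c assume "g \<in> ?G"
      then have g: "g \<in> ribbon_fillings ?i a b" by simp
      show "?to (?from g) c = g c"
        using ribbon_fillingsD(1)[OF g, of c] rim_in_ribbon[OF ab, of c]
          rim_props(2)[OF ribbon_contents[OF ab, of c]] by (cases "a \<le> c \<and> c \<le> b") auto
    qed
    show "?to ` ?P \<subseteq> ?G"
    proof
      fix g assume "g \<in> ?to ` ?P"
      then obtain \<pi> where p: "\<pi> \<in> RPP (ribbon a b)" "(\<Sum>u\<in>ribbon a b. \<pi> u) = n" and g: "g = ?to \<pi>" by auto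
      have out: "\<And>u. u \<notin> ribbon a b \<Longrightarrow> \<pi> u = 0" using p(1) unfolding RPP_def by blast
      have "g \<in> ribbon_fillings ?i a b"
        unfolding ribbon_fillings_def g
        using iffD1[OF RPP_ribbon_iff[OF ab out] p(1)] low by simp
      moreover have "(\<Sum>c\<le>b. g c) = n" unfolding g sum using p(2) sum_ribbon[OF ab, of \<pi>] by simp
      ultimately show "g \<in> ?G" by simp
    qed
    show "?from ` ?G \<subseteq> ?P"
    proof
      fix \<pi> assume "\<pi> \<in> ?from ` ?G"
      then obtain g where g: "g \<in> ribbon_fillings ?i a b" "(\<Sum>c\<le>b. g c) = n" and p: "\<pi> = ?from g" by auto
      have val: "\<pi> (rim lam c) = g c" if "c \<in> {a..b}" for c
        using rim_in_ribbon[OF ab that] rim_props(2)[OF ribbon_contents[OF ab that]] by (simp add: p)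
      have "\<pi> \<in> RPP (ribbon a b)"
      proof (subst RPP_ribbon_iff[OF ab], simp add: p, intro allI impI)
        fix c assume c: "a \<le> c \<and> c < b"
        then show "if rim_up lam c then \<pi> (rim lam (Suc c)) \<le> \<pi> (rim lam c)
            else \<pi> (rim lam c) \<le> \<pi> (rim lam (Suc c))"
          using ribbon_fillingsD(2,4)[OF g(1), of c] val[of c] val[of "Suc c"] by simp
      qed
      moreover have "(\<Sum>u\<in>ribbon a b. \<pi> u) = (\<Sum>c\<le>b. if a \<le> c \<and> c \<le> b then g c else 0)"
        unfolding sum sum_ribbon[OF ab] using val by simp
      moreover have "\<dots> = (\<Sum>c\<le>b. g c)"
        using ribbon_fillingsD(1)[OF g(1)] by (intro sum.cong) auto
      ultimately show "\<pi> \<in> ?P" using g(2) by simp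
    qed
  qed
  then have "card ?P = card ?G" by (rule bij_betw_same_card)
  then show "fps_nth (RPP_gf (ribbon a b)) n = fps_nth (wgf b (ribbon_fillings ?i a b)) n"
    by (simp add: RPP_gf_def wgf_def)
qed

lemma rim_southmost:
  assumes "southmost_of_column lam s"
  shows "rim lam (content lam s) = s" "content lam s \<in> contents lam"
    "fst s = conj_part lam (snd s)" "content lam s = col_bottom (snd s)"
proof -
  have s: "s \<in> Y" "\<And>v. v \<in> Y \<Longrightarrow> snd v = snd s \<Longrightarrow> fst v \<le> fst s"
    using assms by (auto simp: southmost_of_column_def)
  have s': "(fst s, snd s) \<in> Y" using s(1) by simp
  show e: "fst s = conj_part lam (snd s)"
    using conj_part_props(1,2)[OF s'] s(2)[of "(conj_part lam (snd s), snd s)"] by simp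
  show c: "content lam s = col_bottom (snd s)" unfolding col_bottom_def e[symmetric] by simp
  show "rim lam (content lam s) = s" unfolding c rim_col_bottom(1)[OF s'] e[symmetric] by simp
  show "content lam s \<in> contents lam" unfolding c by (rule rim_col_bottom(2)[OF s'])
qed

lemma rim_eastmost:
  assumes "eastmost_of_row lam t"
  shows "rim lam (content lam t) = t" "content lam t \<in> contents lam" "rim_up lam (content lam t)"
proof -
  have t: "t \<in> Y" "\<And>v. v \<in> Y \<Longrightarrow> fst v = fst t \<Longrightarrow> snd v \<le> snd t"
    using assms by (auto simp: eastmost_of_row_def)
  have t': "(fst t, snd t) \<in> Y" using t(1) by simp
  have "snd t = part lam (fst t)"
    using rim_row_end(4,5)[OF t'] t(2)[of "(fst t, part lam (fst t))"] by simp
  then have e: "t = (fst t, part lam (fst t))" by (simp add: prod_eq_iff)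
  have c: "content lam t = row_end (fst t)" unfolding row_end_def e[symmetric] ..
  show "rim lam (content lam t) = t" unfolding c rim_row_end(1)[OF t'] using e by simp
  show "content lam t \<in> contents lam" unfolding c by (rule rim_row_end(2)[OF t'])
  show "rim_up lam (content lam t)" unfolding c by (rule rim_row_end(3)[OF t'])
qed

lemma rim_path_Dyck:
  assumes ab: "a \<in> contents lam" "b \<in> contents lam" "a \<le> b"
  shows "map (rim lam) [a..<Suc b] \<in> Dyck lam (rim lam a) (rim lam b)"
proof -
  let ?L = "map (rim lam) [a..<Suc b]"
  have "up_step (?L ! i) (?L ! (i + 1)) \<or> down_step (?L ! i) (?L ! (i + 1))" if i: "i + 1 < length ?L" for i
  proof -
    have K: "a + i \<in> contents lam" "Suc (a + i) \<in> contents lam"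
      using contents_between[OF ab(1,2)] i by (auto simp del: upt_Suc)
    have L: "?L ! i = rim lam (a + i)" "?L ! (i + 1) = rim lam (Suc (a + i))"
      using i by (simp_all del: upt_Suc)
    show ?thesis
    proof (cases "rim_up lam (a + i)")
      case True
      have "rim lam (a + i) = (Suc (fst (rim lam (Suc (a + i)))), snd (rim lam (Suc (a + i))))"
        by (rule rim_step_up[OF K True])
      then show ?thesis unfolding L by (metis add.commute fst_conv plus_1_eq_Suc snd_conv up_step_def)
    next
      case False
      show ?thesis unfolding L using rim_step_right[OF K(1) False] by (simp add: down_step_def)
    qed
  qed
  moreover have "set ?L \<subseteq> Y"
    using rim_props(1)[OF contents_between[OF ab(1,2)]] by (auto simp del: upt_Suc)
  ultimately show ?thesis
    using ab(3) by (simp add: Dyck_def dyck_path_def hd_map last_map del: upt_Suc)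
qed

text \<open>The rim meets each diagonal in its lowest cell, and a path is determined by its cells on the diagonals.\<close>

lemma lowest_path_rim:
  assumes ab: "a \<in> contents lam" "b \<in> contents lam" "a \<le> b"
  shows "lowest_path lam (rim lam a) (rim lam b) = map (rim lam) [a..<Suc b]"
  unfolding lowest_path_def
proof (rule the_equality)
  let ?L = "map (rim lam) [a..<Suc b]"
  have L: "?L \<in> Dyck lam (rim lam a) (rim lam b)" by (rule rim_path_Dyck[OF ab])
  have diag: "content lam u = content lam v" if "u \<in> Y" "v \<in> Y" "fst u + snd v = fst v + snd u" for u v
    using content_add[OF that(1)] content_add[OF that(2)] that(3) by linarith
  have sub: "D \<in> Dyck lam s t \<Longrightarrow> v \<in> set D \<Longrightarrow> v \<in> Y" for D s t v by (auto simp: Dyck_def dyck_path_def)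
  have setL: "rim lam (content lam u) = u" if "u \<in> set ?L" for u
  proof -
    have "u \<in> ribbon a b" using that by (auto simp: ribbon_def simp del: upt_Suc)
    then show ?thesis using ribbonE(2)[OF ab(1,2)] by blast
  qed
  have low: "\<forall>D\<in>Dyck lam (rim lam a) (rim lam b). \<forall>u\<in>set ?L. \<forall>v\<in>set D. fst u + snd v = fst v + snd u \<longrightarrow> fst v \<le> fst u"
  proof (intro ballI impI)
    fix D u v assume D: "D \<in> Dyck lam (rim lam a) (rim lam b)" "u \<in> set ?L" "v \<in> set D"
      and e: "fst u + snd v = fst v + snd u"
    have "content lam u = content lam v" by (rule diag[OF sub[OF L D(2)] sub[OF D(1,3)] e])
    then show "fst v \<le> fst u" using rim_above[OF sub[OF D(1,3)]] setL[OF D(2)] by auto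
  qed
  show "?L \<in> Dyck lam (rim lam a) (rim lam b) \<and> (\<forall>D\<in>Dyck lam (rim lam a) (rim lam b). \<forall>u\<in>set ?L.
      \<forall>v\<in>set D. fst u + snd v = fst v + snd u \<longrightarrow> fst v \<le> fst u)"
    using L low by blast
  fix D assume D: "D \<in> Dyck lam (rim lam a) (rim lam b) \<and> (\<forall>E\<in>Dyck lam (rim lam a) (rim lam b). \<forall>u\<in>set D.
      \<forall>v\<in>set E. fst u + snd v = fst v + snd u \<longrightarrow> fst v \<le> fst u)"
  then have dyck: "dyck_path lam D" "D \<noteq> []" "D ! 0 = rim lam a" "last D = rim lam b"
    by (auto simp: Dyck_def dyck_path_def hd_conv_nth)
  have cont: "content lam (D ! i) = a + i" if "i < length D" for i
    using dyck_path_content[OF dyck(1) that] dyck(3) rim_props(2)[OF ab(1)] by simp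
  have "content lam (last D) = a + (length D - 1)"
    using cont[of "length D - 1"] dyck(2) by (simp add: last_conv_nth)
  then have len: "length D = Suc b - a"
    using dyck(2,4) rim_props(2)[OF ab(2)] ab(3) by (cases D) auto
  show "D = ?L"
  proof (rule nth_equalityI)
    show "length D = length ?L" using len by (simp del: upt_Suc)
    fix i assume i: "i < length D"
    have Li: "?L ! i = rim lam (a + i)" "i < length ?L" using i len by (simp_all del: upt_Suc)
    then have mem: "rim lam (a + i) \<in> set ?L" by (metis nth_mem)
    have K: "a + i \<in> contents lam" using contents_between[OF ab(1,2)] i len by simp
    have Di: "D ! i \<in> Y" "D ! i \<in> set D" using i dyck(1) by (auto simp: dyck_path_def intro: nth_mem)
    have "content lam (rim lam (a + i)) = content lam (D ! i)"
      using cont[OF i] rim_props(2)[OF K] by simp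
    then have e: "fst (D ! i) + snd (rim lam (a + i)) = fst (rim lam (a + i)) + snd (D ! i)"
      using content_add[OF Di(1)] content_add[OF rim_props(1)[OF K]] by linarith
    then have "fst (rim lam (a + i)) \<le> fst (D ! i)" using D L mem Di(2) by blast
    moreover have "fst (D ! i) \<le> fst (rim lam (a + i))"
      using low D mem Di(2) e by (metis add.commute)
    ultimately have "D ! i = rim lam (a + i)" using e by (simp add: prod_eq_iff)
    then show "D ! i = ?L ! i" using Li by simp
  qed
qed

lemma E_gf_eq_ribbon:
  assumes s: "southmost_of_column lam s" and t: "eastmost_of_row lam t"
  shows "E_gf lam s t = (if content lam s \<le> content lam t
    then RPP_gf (ribbon (content lam s) (content lam t)) else 0)"
proof (cases "content lam s \<le> content lam t")
  case True
  note S = rim_southmost[OF s] and T = rim_eastmost[OF t]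
  have "Dyck lam s t \<noteq> {}" using rim_path_Dyck[OF S(2) T(2) True] S(1) T(1) by auto
  moreover have "set (lowest_path lam s t) = ribbon (content lam s) (content lam t)"
    using lowest_path_rim[OF S(2) T(2) True] S(1) T(1)
    by (simp add: ribbon_def atLeastLessThanSuc_atLeastAtMost del: upt_Suc)
  ultimately show ?thesis using True by (simp add: E_gf_def)
next
  case False
  then have "Dyck lam s t = {}" using Dyck_bounds by blast
  then show ?thesis using False by (simp add: E_gf_def)
qed

text \<open>All rows that meet the ribbon are at most the row of \<open>s\<close>, the lowest one, so its reverse plane partitions are ribbon
fillings in which no equality is imposed.\<close>

theorem E_gf_eq_Dyck_gf:
  assumes s: "southmost_of_column lam s" and t: "eastmost_of_row lam t"
  shows "E_gf lam s t = Dyck_gf s t"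
proof (cases "content lam s \<le> content lam t")
  case True
  note S = rim_southmost[OF s] and T = rim_eastmost[OF t]
  have Y: "s \<in> Y" "t \<in> Y" using s t by (auto simp: southmost_of_column_def eastmost_of_row_def)
  have "E_gf lam s t = RPP_gf (ribbon (content lam s) (content lam t))"
    using E_gf_eq_ribbon[OF s t] True by simp
  also have "\<dots> = wgf (content lam t) (ribbon_fillings (fst s) (content lam s) (content lam t))"
    using RPP_gf_ribbon[OF S(2) _ T(2)] S(1) s by simp
  also have "\<dots> = Dyck_gf (fst s, snd s) t"
    unfolding S(4)
  proof (rule wgf_ribbon_fillings[OF Y(2) T(1,2,3)])
    show "(fst s, snd s) \<in> Y" using Y(1) by simp
    show "fst t \<le> fst s" using rim_mono[OF S(2) T(2) True] S(1) T(1) by simp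
  qed
  finally show ?thesis by simp
next
  case False
  then have "Dyck lam s t = {}" using Dyck_bounds by blast
  then show ?thesis using E_gf_eq_ribbon[OF s t] False by (simp add: Dyck_gf_def)
qed

end

section \<open>Truncation of formal power series\<close>

definition agree_upto :: "nat \<Rightarrow> 'a fps \<Rightarrow> 'a fps \<Rightarrow> bool" where
  "agree_upto n f g \<longleftrightarrow> (\<forall>m\<le>n. fps_nth f m = fps_nth g m)"

lemma agree_upto_mult:
  fixes f g f' g' :: "'a::comm_ring_1 fps"
  assumes "agree_upto n f f'" "agree_upto n g g'"
  shows "agree_upto n (f * g) (f' * g')"
  unfolding agree_upto_def fps_mult_nth
proof (intro allI impI sum.cong refl)
  fix m i assume "m \<le> n" "i \<in> {0..m}"
  then show "fps_nth f i * fps_nth g (m - i) = fps_nth f' i * fps_nth g' (m - i)"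
    using assms by (simp add: agree_upto_def)
qed

lemma agree_upto_prod:
  fixes f g :: "'b \<Rightarrow> 'a::comm_ring_1 fps"
  assumes "\<And>x. x \<in> S \<Longrightarrow> agree_upto n (f x) (g x)"
  shows "agree_upto n (\<Prod>x\<in>S. f x) (\<Prod>x\<in>S. g x)"
  using assms
proof (induction S rule: infinite_finite_induct)
  case (insert x S)
  then show ?case by (simp add: agree_upto_mult)
qed (simp_all add: agree_upto_def)

lemma rdet_agree_upto:
  fixes A B :: "nat \<Rightarrow> nat \<Rightarrow> 'a::comm_ring_1 fps"
  assumes "\<And>i j. i < k \<Longrightarrow> j < k \<Longrightarrow> agree_upto n (A i j) (B i j)"
  shows "fps_nth (rdet k A) n = fps_nth (rdet k B) n"
  unfolding rdet_Leibniz fps_sum_nth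
proof (intro sum.cong refl)
  fix p assume "p \<in> {p. p permutes {..<k}}"
  then have p: "p i < k" if "i < k" for i using that permutes_in_image[of p "{..<k}" i] by simp
  have "agree_upto n (\<Prod>i<k. A i (p i)) (\<Prod>i<k. B i (p i))"
    by (rule agree_upto_prod) (use p assms in auto)
  then have "agree_upto n (signof p * (\<Prod>i<k. A i (p i))) (signof p * (\<Prod>i<k. B i (p i)))"
    by (rule agree_upto_mult[rotated]) (simp add: agree_upto_def)
  then show "fps_nth (signof p * (\<Prod>i<k. A i (p i))) n = fps_nth (signof p * (\<Prod>i<k. B i (p i))) n"
    by (simp add: agree_upto_def)
qed

lemma rdet_1: "rdet 1 A = A 0 0"
  unfolding rdet_def by (subst det_single) auto

lemma fps_nth_sum_X_power:
  assumes "finite F"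
  shows "fps_nth (\<Sum>x\<in>F. fps_X ^ w x :: 'a::comm_ring_1 fps) n = of_nat (card {x \<in> F. w x = n})"
proof -
  have "fps_nth (\<Sum>x\<in>F. fps_X ^ w x :: 'a fps) n = (\<Sum>x\<in>F. if w x = n then 1 else 0)"
    unfolding fps_sum_nth by (intro sum.cong refl) auto
  also have "\<dots> = (\<Sum>x\<in>{x \<in> F. w x = n}. 1)"
    by (rule sum.inter_filter[OF assms, symmetric])
  finally show ?thesis by simp
qed

context rim_strips
begin

lemma finite_S: "finite S"
  using finite_subset[OF S_subset finite_diagram] .

lemma finite_fillings: "finite (fillings H)"
proof (rule finite_subset)
  show "fillings H \<subseteq> {\<eta>. \<forall>u. (u \<in> S \<longrightarrow> \<eta> u \<in> {..H}) \<and> (u \<notin> S \<longrightarrow> \<eta> u = 0)}"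
  proof
    fix \<eta> assume "\<eta> \<in> fillings H"
    then have "\<forall>u. u \<notin> S \<longrightarrow> \<eta> u = 0" "\<forall>u\<in>S. \<eta> u \<le> H"
      unfolding fillings_def by blast+
    then show "\<eta> \<in> {\<eta>. \<forall>u. (u \<in> S \<longrightarrow> \<eta> u \<in> {..H}) \<and> (u \<notin> S \<longrightarrow> \<eta> u = 0)}" by blast
  qed
  show "finite {\<eta>. \<forall>u. (u \<in> S \<longrightarrow> \<eta> u \<in> {..H}) \<and> (u \<notin> S \<longrightarrow> \<eta> u = (0::nat))}"
    by (rule finite_set_of_finite_funs[OF finite_S]) simp
qed

lemma fps_nth_det_strip_gf:
  "fps_nth (rdet k (\<lambda>i j. \<Sum>x\<le>H. strip_gf fps_X H (rim_up lam) (a i) (b j) x) :: 'r::comm_ring_1 fps) n =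
    of_nat (card {\<eta> \<in> fillings H. (\<Sum>u\<in>S. \<eta> u) = n})"
  unfolding det_strip_gf_fillings by (rule fps_nth_sum_X_power[OF finite_fillings])

end

context young
begin

text \<open>The ribbon is a family with a single strip, all of whose cells have level 0. The bound \<open>H\<close> on the entries holds
automatically if their sum is at most \<open>H\<close>.\<close>

lemma E_gf_agrees_strip_gf:
  assumes s: "southmost_of_column lam s" and t: "eastmost_of_row lam t"
  shows "agree_upto H (\<Sum>x\<le>H. strip_gf fps_X H (rim_up lam) (content lam s) (content lam t) x) (E_gf lam s t)"
proof (cases "content lam s \<le> content lam t")
  case False
  then show ?thesis
    by (simp add: E_gf_eq_ribbon[OF s t] strip_gf_before_start agree_upto_def)
next
  case True
  note S = rim_southmost[OF s] and T = rim_eastmost[OF t]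
  let ?a = "content lam s" and ?b = "content lam t"
  let ?S = "ribbon ?a ?b"
  interpret one: strip_family 1 "\<lambda>_. ?a" "\<lambda>_. ?b" "rim_up lam"
  proof unfold_locales
    show "1 \<le> ?a" using S(2) contents_iff by simp
    fix c assume c: "?a = Suc c"
    show "\<not> rim_up lam c"
    proof
      assume up: "rim_up lam c"
      then have K: "c \<in> contents lam" by (simp add: rim_up_def)
      have "rim lam c = (Suc (fst (rim lam ?a)), snd (rim lam ?a))"
        using rim_step_up[OF K _ up] S(2) c by simp
      then have "(Suc (fst s), snd s) \<in> Y" using rim_props(1)[OF K] S(1) by simp
      then show False using s by (auto simp: southmost_of_column_def)
    qed
  qed (use True T in simp_all)
  interpret one: rim_strips lam 1 "\<lambda>_. ?a" "\<lambda>_. ?b" ?S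
  proof unfold_locales
    show "?S \<subseteq> Y" by (rule ribbon_subset[OF S(2) T(2)])
    show "order_convex ?S" by (rule ribbon_order_convex[OF S(2) T(2)])
    show "(Suc r, Suc c) \<in> ?S" if "(r, c) \<in> ?S" "(Suc r, Suc c) \<in> Y" for r c
      using ribbon_not_southeast[OF S(2) T(2) that(1)] that(2) by simp
    fix c assume "c \<in> contents lam"
    show "card {u \<in> ?S. content lam u = c} = card (one.act c)"
    proof (cases "c \<in> {?a..?b}")
      case True
      have "{u \<in> ?S. content lam u = c} = {rim lam c}"
        using ribbonE(2)[OF S(2) T(2)] rim_in_ribbon[OF S(2) T(2) True]
          rim_props(2)[OF \<open>c \<in> contents lam\<close>] by auto
      moreover have "one.act c = {0}" unfolding one.act_def using True by auto
      ultimately show ?thesis by simp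
    next
      case False
      then have empty: "{u \<in> ?S. content lam u = c} = {}" "one.act c = {}"
        unfolding one.act_def using ribbonE(1)[OF S(2) T(2)] by auto
      show ?thesis unfolding empty by simp
    qed
  qed (use T in simp)
  have "one.level u = 0" if "u \<in> ?S" for u
    using ribbonE(2)[OF S(2) T(2) that] by (simp add: one.level_def)
  then have fill: "one.fillings H = {\<pi> \<in> RPP ?S. \<forall>u\<in>?S. \<pi> u \<le> H}" for H
  proof -
    have eq: "(\<lambda>u. if u \<in> ?S then \<pi> u + one.level u else 0) = \<pi>"
      if "\<forall>u. u \<notin> ?S \<longrightarrow> \<pi> u = 0" for \<pi> :: "cell \<Rightarrow> nat"
    proof
      fix u show "(if u \<in> ?S then \<pi> u + one.level u else 0) = \<pi> u"
        using that \<open>\<And>u. u \<in> ?S \<Longrightarrow> one.level u = 0\<close>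
        by (cases u; cases "u \<in> ?S") simp_all
    qed
    show ?thesis
    proof (intro Set.set_eqI iffI)
      fix \<pi> assume "\<pi> \<in> one.fillings H"
      then have "\<forall>u. u \<notin> ?S \<longrightarrow> \<pi> u = 0" "\<forall>u\<in>?S. \<pi> u \<le> H"
        "(\<lambda>u. if u \<in> ?S then \<pi> u + one.level u else 0) \<in> RPP ?S"
        unfolding one.fillings_def by blast+
      then show "\<pi> \<in> {\<pi> \<in> RPP ?S. \<forall>u\<in>?S. \<pi> u \<le> H}" using eq[of \<pi>] by simp
    next
      fix \<pi> assume "\<pi> \<in> {\<pi> \<in> RPP ?S. \<forall>u\<in>?S. \<pi> u \<le> H}"
      then have p: "\<pi> \<in> RPP ?S" "\<forall>u\<in>?S. \<pi> u \<le> H" by auto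
      have out: "\<forall>u. u \<notin> ?S \<longrightarrow> \<pi> u = 0" using p(1) unfolding RPP_def by blast
      show "\<pi> \<in> one.fillings H"
        unfolding one.fillings_def using out p(2) p(1) eq[OF out] by simp
    qed
  qed
  show ?thesis
    unfolding agree_upto_def
  proof (intro allI impI)
    fix n assume n: "n \<le> H"
    have "fps_nth (\<Sum>x\<le>H. strip_gf fps_X H (rim_up lam) ?a ?b x :: rat fps) n =
        of_nat (card {\<eta> \<in> one.fillings H. (\<Sum>u\<in>?S. \<eta> u) = n})"
      using one.fps_nth_det_strip_gf[of H n] unfolding rdet_1 .
    also have "{\<eta> \<in> one.fillings H. (\<Sum>u\<in>?S. \<eta> u) = n} = {\<pi> \<in> RPP ?S. (\<Sum>u\<in>?S. \<pi> u) = n}"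
      unfolding fill
    proof (intro Set.set_eqI iffI)
      fix \<pi> assume p: "\<pi> \<in> {\<pi> \<in> RPP ?S. (\<Sum>u\<in>?S. \<pi> u) = n}"
      have "\<pi> u \<le> H" if "u \<in> ?S" for u
        using member_le_sum[OF that _ one.finite_S, of \<pi>] p n by simp
      then show "\<pi> \<in> {\<eta> \<in> {\<pi> \<in> RPP ?S. \<forall>u\<in>?S. \<pi> u \<le> H}. (\<Sum>u\<in>?S. \<eta> u) = n}" using p by simp
    qed simp
    also have "of_nat (card \<dots>) = fps_nth (E_gf lam s t) n"
      using E_gf_eq_ribbon[OF s t] True by (simp add: RPP_gf_def)
    finally show "fps_nth (\<Sum>x\<le>H. strip_gf fps_X H (rim_up lam) ?a ?b x :: rat fps) n = fps_nth (E_gf lam s t) n" .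
  qed
qed

end

section \<open>The intervals of a Kreiman decomposition\<close>

locale kreiman = young lam for lam :: "nat list" +
  fixes mu :: "nat list" and Ls :: "cell list list"
  assumes mu_partition: "int_partition mu"
    and decomposition: "kreiman_outer_decomposition lam mu Ls"
begin

definition k :: nat where "k = length Ls"
definition a :: "nat \<Rightarrow> nat" where "a i = content lam (hd (Ls ! i))"
definition b :: "nat \<Rightarrow> nat" where "b i = content lam (last (Ls ! i))"
definition S :: "cell set" where "S = diagram lam - diagram mu"
definition path_cell :: "nat \<Rightarrow> nat \<Rightarrow> cell" where "path_cell i c = Ls ! i ! (c - a i)"
text \<open>The number of diagonal steps from path \<open>L_i\<close> to the rim on the diagonal of content \<open>c\<close>.\<close>

definition height :: "nat \<Rightarrow> nat \<Rightarrow> nat" where "height i c = fst (rim lam c) - fst (path_cell i c)"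

lemma path:
  assumes "i < k"
  shows "dyck_path lam (Ls ! i)" "Ls ! i \<noteq> []" "southmost_of_column lam (hd (Ls ! i))"
    "eastmost_of_row lam (last (Ls ! i))" "Ls ! i \<in> set Ls"
proof -
  show m: "Ls ! i \<in> set Ls" using assms by (simp add: k_def)
  show "dyck_path lam (Ls ! i)" "southmost_of_column lam (hd (Ls ! i))" "eastmost_of_row lam (last (Ls ! i))"
    using m decomposition by (auto simp: kreiman_outer_decomposition_def)
  then show "Ls ! i \<noteq> []" by (simp add: dyck_path_def)
qed

lemma disjoint_paths: "i < k \<Longrightarrow> j < k \<Longrightarrow> i \<noteq> j \<Longrightarrow> set (Ls ! i) \<inter> set (Ls ! j) = {}"
  using decomposition by (simp add: kreiman_outer_decomposition_def k_def)

lemma paths_cover: "(\<Union>i<k. set (Ls ! i)) = S"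
proof -
  have "(\<Union>L\<in>set Ls. set L) = S"
    using decomposition unfolding kreiman_outer_decomposition_def S_def by blast
  moreover have "set Ls = (\<lambda>i. Ls ! i) ` {..<k}" by (auto simp: set_conv_nth k_def)
  ultimately show ?thesis by simp
qed

lemma length_path:
  assumes "i < k"
  shows "b i + 1 = a i + length (Ls ! i)"
proof -
  note P = path[OF assms]
  have "b i = a i + (length (Ls ! i) - 1)"
    using dyck_path_content[OF P(1), of "length (Ls ! i) - 1"] P(2)
    by (simp add: a_def b_def hd_conv_nth last_conv_nth)
  then show ?thesis using P(2) by (cases "Ls ! i") auto
qed

lemma path_start_le_end: "i < k \<Longrightarrow> a i \<le> b i"
  using length_path[of i] path(2)[of i] by (cases "Ls ! i") auto

lemma path_cell_props:
  assumes "i < k" "a i \<le> c" "c \<le> b i"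
  shows "path_cell i c \<in> set (Ls ! i)" "content lam (path_cell i c) = c" "path_cell i c \<in> Y" "c \<in> contents lam"
proof -
  note P = path[OF assms(1)]
  have l: "c - a i < length (Ls ! i)" using length_path[OF assms(1)] assms by simp
  show p: "path_cell i c \<in> set (Ls ! i)" using l by (simp add: path_cell_def)
  show c: "content lam (path_cell i c) = c"
    using dyck_path_content[OF P(1) l] assms(2) P(2) by (simp add: path_cell_def a_def hd_conv_nth)
  show y: "path_cell i c \<in> Y" using p P(1) by (auto simp: dyck_path_def)
  show "c \<in> contents lam" using imageI[OF y, of "content lam"] c by (simp add: contents_def)
qed

lemma path_cell_cover:
  assumes "i < k" "u \<in> set (Ls ! i)"
  shows "a i \<le> content lam u \<and> content lam u \<le> b i \<and> path_cell i (content lam u) = u"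
proof -
  note P = path[OF assms(1)]
  obtain m where m: "m < length (Ls ! i)" "u = Ls ! i ! m" using assms(2) by (metis in_set_conv_nth)
  then have "content lam u = a i + m"
    using dyck_path_content[OF P(1) m(1)] P(2) by (simp add: a_def hd_conv_nth)
  then show ?thesis using m length_path[OF assms(1)] by (simp add: path_cell_def)
qed

lemma height_rim:
  assumes "i < k" "a i \<le> c" "c \<le> b i"
  shows "rim lam c = (fst (path_cell i c) + height i c, snd (path_cell i c) + height i c)"
  using rim_above[OF path_cell_props(3)[OF assms]] unfolding path_cell_props(2)[OF assms] height_def by auto

lemma rim_hd_last:
  assumes "i < k"
  shows "rim lam (a i) = hd (Ls ! i)" "rim lam (b i) = last (Ls ! i)"
    "path_cell i (a i) = rim lam (a i)" "path_cell i (b i) = rim lam (b i)"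
proof -
  note P = path[OF assms]
  show r: "rim lam (a i) = hd (Ls ! i)" "rim lam (b i) = last (Ls ! i)"
    using rim_southmost(1)[OF P(3)] rim_eastmost(1)[OF P(4)] by (simp_all add: a_def b_def)
  show "path_cell i (a i) = rim lam (a i)" unfolding r using P(2) by (simp add: path_cell_def hd_conv_nth)
  show "path_cell i (b i) = rim lam (b i)" unfolding r
  proof -
    have "b i - a i = length (Ls ! i) - 1" using length_path[OF assms] by simp
    then show "path_cell i (b i) = last (Ls ! i)" using P(2) by (simp add: path_cell_def last_conv_nth)
  qed
qed

lemma height_start: "i < k \<Longrightarrow> height i (a i) = 0"
  by (simp add: height_def rim_hd_last)

lemma height_end: "i < k \<Longrightarrow> height i (b i) = 0"
  by (simp add: height_def rim_hd_last)

lemma path_cell_step: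
  assumes "i < k" "a i \<le> c" "c < b i"
  shows "up_step (path_cell i c) (path_cell i (Suc c)) \<or> down_step (path_cell i c) (path_cell i (Suc c))"
proof -
  have "c - a i + 1 < length (Ls ! i)" using length_path[OF assms(1)] assms by simp
  moreover have "Suc c - a i = c - a i + 1" using assms by simp
  ultimately show ?thesis using path(1)[OF assms(1)] by (simp add: dyck_path_def path_cell_def)
qed

lemma height_step:
  assumes i: "i < k" "a i \<le> c" "c < b i"
  shows "rim_up lam c \<Longrightarrow> up_step (path_cell i c) (path_cell i (Suc c)) \<Longrightarrow> height i c = height i (Suc c)"
    and "rim_up lam c \<Longrightarrow> down_step (path_cell i c) (path_cell i (Suc c)) \<Longrightarrow> height i c = Suc (height i (Suc c))"
    and "\<not> rim_up lam c \<Longrightarrow> down_step (path_cell i c) (path_cell i (Suc c)) \<Longrightarrow> height i c = height i (Suc c)"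
    and "\<not> rim_up lam c \<Longrightarrow> up_step (path_cell i c) (path_cell i (Suc c)) \<Longrightarrow> height i (Suc c) = Suc (height i c)"
proof -
  have K: "c \<in> contents lam" "Suc c \<in> contents lam" using path_cell_props(4)[of i] i by auto
  have H: "fst (rim lam c) = fst (path_cell i c) + height i c" "snd (rim lam c) = snd (path_cell i c) + height i c"
    "fst (rim lam (Suc c)) = fst (path_cell i (Suc c)) + height i (Suc c)"
    "snd (rim lam (Suc c)) = snd (path_cell i (Suc c)) + height i (Suc c)"
    using height_rim[of i c] height_rim[of i "Suc c"] i by simp_all
  {
    assume up: "rim_up lam c"
    have "fst (rim lam c) = Suc (fst (rim lam (Suc c)))" "snd (rim lam c) = snd (rim lam (Suc c))"
      using arg_cong[OF rim_step_up[OF K up], of fst] arg_cong[OF rim_step_up[OF K up], of snd] by simp_all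
    note R = this H
    {
      assume "up_step (path_cell i c) (path_cell i (Suc c))"
      then show "height i c = height i (Suc c)" using R unfolding up_step_def by linarith
    next
      assume "down_step (path_cell i c) (path_cell i (Suc c))"
      then show "height i c = Suc (height i (Suc c))" using R unfolding down_step_def by linarith
    }
  next
    assume right: "\<not> rim_up lam c"
    have "fst (rim lam (Suc c)) = fst (rim lam c)" "snd (rim lam (Suc c)) = Suc (snd (rim lam c))"
      using rim_step_right[OF K(1) right] by simp_all
    note R = this H
    {
      assume "down_step (path_cell i c) (path_cell i (Suc c))"
      then show "height i c = height i (Suc c)" using R unfolding down_step_def by linarith
    next
      assume "up_step (path_cell i c) (path_cell i (Suc c))"
      then show "height i (Suc c) = Suc (height i c)" using R unfolding up_step_def by linarith
    }
  }
qed

lemma height_distinct: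
  assumes "i < k" "j < k" "i \<noteq> j" "a i \<le> c" "c \<le> b i" "a j \<le> c" "c \<le> b j"
  shows "height i c \<noteq> height j c"
proof
  assume "height i c = height j c"
  then have "path_cell i c = path_cell j c"
    using height_rim[of i c] height_rim[of j c] assms by (simp add: prod_eq_iff)
  then show False
    using path_cell_props(1)[of i c] path_cell_props(1)[of j c] disjoint_paths[of i j] assms by auto
qed

text \<open>Over a given step of the rim, a path keeps its height or changes it by 1, in a direction that depends only on the rim.
Paths in strict order would therefore have to meet before they could cross.\<close>

lemma height_order_step:
  assumes "i < k" "j < k" "i \<noteq> j" "a i \<le> c" "Suc c \<le> b i" "a j \<le> c" "Suc c \<le> b j"
    and "height j c < height i c"
  shows "height j (Suc c) < height i (Suc c)"
proof -
  have ne: "height i (Suc c) \<noteq> height j (Suc c)" using height_distinct[of i j "Suc c"] assms by simp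
  have up: "height m c = height m (Suc c) \<or> height m c = Suc (height m (Suc c))"
    if "m < k" "a m \<le> c" "Suc c \<le> b m" "rim_up lam c" for m
    using path_cell_step[of m c] height_step(1,2)[of m c] that by auto
  have right: "height m (Suc c) = height m c \<or> height m (Suc c) = Suc (height m c)"
    if "m < k" "a m \<le> c" "Suc c \<le> b m" "\<not> rim_up lam c" for m
    using path_cell_step[of m c] height_step(3,4)[of m c] that by auto
  have "height i (Suc c) \<ge> height j (Suc c)"
  proof (cases "rim_up lam c")
    case True
    then show ?thesis
      using up[OF assms(1,4,5)] up[OF assms(2,6,7)] assms(8) by linarith
  next
    case False
    then show ?thesis
      using right[OF assms(1,4,5)] right[OF assms(2,6,7)] assms(8) by linarith
  qed
  then show ?thesis using ne by simp
qed

lemma height_order: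
  assumes ij: "i < k" "j < k" "a i < a j" and c: "a j \<le> c" "c \<le> b i" "c \<le> b j"
  shows "height j c < height i c"
  using c
proof (induction c rule: dec_induct)
  case base
  have "i \<noteq> j" using ij by auto
  then have "height i (a j) \<noteq> height j (a j)" using height_distinct[of i j "a j"] ij base by simp
  then show ?case using height_start[OF ij(2)] by simp
next
  case (step n)
  then show ?case using height_order_step[of i j n] ij by auto
qed

text \<open>At its end a path is on the rim, so the path that ends first cannot be the higher one.\<close>

lemma paths_nested:
  assumes ij: "i < k" "j < k" "a i < a j" "a j \<le> b i"
  shows "b j < b i"
proof (rule ccontr)
  assume "\<not> b j < b i"
  then have "height j (b i) < height i (b i)" using height_order[OF ij(1-3)] ij(4) by simp
  then show False using height_end[OF ij(1)] by simp
qed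

sublocale strip_family k a b "rim_up lam"
proof unfold_locales
  fix i assume i: "i < k"
  show "1 \<le> a i" using path_cell_props(4)[OF i order_refl path_start_le_end[OF i]] contents_iff by simp
  show "a i \<le> b i" by (rule path_start_le_end[OF i])
  show "rim_up lam (b i)" unfolding b_def by (rule rim_eastmost(3)[OF path(4)[OF i]])
  show "\<not> rim_up lam c" if c: "a i = Suc c" for c
  proof
    assume up: "rim_up lam c"
    then have K: "c \<in> contents lam" by (simp add: rim_up_def)
    have "Suc c \<in> contents lam" using path_cell_props(4)[OF i order_refl path_start_le_end[OF i]] c by simp
    then have "rim lam c = (Suc (fst (rim lam (a i))), snd (rim lam (a i)))"
      using rim_step_up[OF K _ up] c by simp
    then have "(Suc (fst (hd (Ls ! i))), snd (hd (Ls ! i))) \<in> Y"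
      using rim_props(1)[OF K] rim_hd_last(1)[OF i] by simp
    then show False using path(3)[OF i] by (auto simp: southmost_of_column_def)
  qed
  fix j assume j: "j < k"
  show "i = j" if "a i = a j"
  proof (rule ccontr)
    assume "i \<noteq> j"
    then show False
      using height_distinct[of i j "a i"] i j that path_start_le_end[OF i] path_start_le_end[OF j]
        height_start[OF i] height_start[OF j] by simp
  qed
  show "b j < b i" if "a i < a j" "a j \<le> b i" using paths_nested[OF i j that] .
qed

lemma actD: "i \<in> act c \<Longrightarrow> i < k \<and> a i \<le> c \<and> c \<le> b i"
  by (simp add: act_def)

lemma S_diagonal: "{u \<in> S. content lam u = c} = (\<lambda>i. path_cell i c) ` act c"
proof (intro Set.set_eqI iffI)
  fix u assume "u \<in> {u \<in> S. content lam u = c}"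
  then obtain i where i: "i < k" "u \<in> set (Ls ! i)" "content lam u = c" using paths_cover by blast
  then show "u \<in> (\<lambda>i. path_cell i c) ` act c" using path_cell_cover[OF i(1,2)] by (force simp: act_def)
next
  fix u assume "u \<in> (\<lambda>i. path_cell i c) ` act c"
  then obtain i where i: "i < k" "a i \<le> c" "c \<le> b i" "u = path_cell i c" by (auto simp: act_def)
  then have "u \<in> set (Ls ! i)" "content lam u = c" using path_cell_props(1,2)[OF i(1-3)] by simp_all
  then show "u \<in> {u \<in> S. content lam u = c}" using i(1) paths_cover by blast
qed

sublocale rim_strips lam k a b S
proof unfold_locales
  interpret mu: young mu by unfold_locales (rule mu_partition)
  show "S \<subseteq> Y" by (auto simp: S_def)
  show "order_convex S"
    unfolding order_convex_def
  proof (intro ballI allI impI)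
    fix u v w assume u: "u \<in> S" and v: "v \<in> S"
      and w: "fst u \<le> fst w \<and> fst w \<le> fst v \<and> snd u \<le> snd w \<and> snd w \<le> snd v"
    have b: "1 \<le> fst u" "1 \<le> snd u" using u diagram_bounds[of u] by (auto simp: S_def)
    then have "(fst w, snd w) \<in> Y" using v w by (intro diagram_down[of v]) (auto simp: S_def)
    moreover have "w \<notin> diagram mu"
    proof
      assume "w \<in> diagram mu"
      then have "(fst u, snd u) \<in> diagram mu" using b w by (intro mu.diagram_down[of w]) auto
      then show False using u by (simp add: S_def)
    qed
    ultimately show "w \<in> S" by (simp add: S_def)
  qed
  show "(Suc r, Suc s) \<in> S" if rs: "(r, s) \<in> S" "(Suc r, Suc s) \<in> Y" for r s
  proof -
    have b: "1 \<le> r" "1 \<le> s" using rs diagram_bounds[of "(r, s)"] by (auto simp: S_def)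
    have "(Suc r, Suc s) \<notin> diagram mu"
    proof
      assume "(Suc r, Suc s) \<in> diagram mu"
      then have "(r, s) \<in> diagram mu" by (rule mu.diagram_down_closed) (use b in auto)
      then show False using rs by (simp add: S_def)
    qed
    then show ?thesis using rs by (simp add: S_def)
  qed
  show "b i \<in> contents lam" if "i < k" for i
    using path_cell_props(4)[OF that path_start_le_end[OF that] order_refl] .
  show "card {u \<in> S. content lam u = c} = card (act c)" if "c \<in> contents lam" for c
    unfolding S_diagonal
  proof (rule card_image, rule inj_onI)
    fix i j assume ij: "i \<in> act c" "j \<in> act c" "path_cell i c = path_cell j c"
    show "i = j"
    proof (rule ccontr)
      assume "i \<noteq> j"
      then have "height i c \<noteq> height j c" using height_distinct[of i j c] ij actD by simp
      then show False using ij by (simp add: height_def)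
    qed
  qed
qed

end

section \<open>Ranks and fillings\<close>

context kreiman
begin

text \<open>For the coefficient of \<open>q^n\<close> it suffices to admit the entries up to \<open>n\<close>.\<close>

lemma det_E_gf_nth:
  "fps_nth (rdet k (\<lambda>i j. E_gf lam (hd (Ls ! i)) (last (Ls ! j)))) n =
    of_nat (card {\<eta> \<in> fillings n. (\<Sum>u\<in>S. \<eta> u) = n})"
proof -
  have "fps_nth (rdet k (\<lambda>i j. \<Sum>x\<le>n. strip_gf fps_X n (rim_up lam) (a i) (b j) x) :: rat fps) n =
      fps_nth (rdet k (\<lambda>i j. E_gf lam (hd (Ls ! i)) (last (Ls ! j)))) n"
    by (rule rdet_agree_upto) (use path in \<open>auto simp: a_def b_def intro: E_gf_agrees_strip_gf\<close>)
  then show ?thesis unfolding fps_nth_det_strip_gf by simp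
qed

text \<open>Some path contains the rim cell of content \<open>c\<close>, and a path with a larger interval is strictly above path \<open>j\<close>.\<close>

lemma innermost_on_rim:
  assumes j: "j \<in> act c" "\<And>i. i \<in> act c \<Longrightarrow> i \<noteq> j \<Longrightarrow> a i < a j"
  shows "height j c = 0" "path_cell j c = rim lam c"
proof -
  have "0 < card (act c)" unfolding card_gt_0_iff using j(1) by auto
  then have "0 \<in> level ` {u \<in> S. content lam u = c}"
    unfolding level_image[OF act_contents[OF j(1)]] by simp
  then obtain i where i: "i \<in> act c" "level (path_cell i c) = 0" unfolding S_diagonal by auto
  then have hi: "height i c = 0"
    using path_cell_props(2)[of i c] actD[OF i(1)] by (simp add: level_def height_def)
  show h: "height j c = 0"
  proof (cases "i = j")
    case False
    then have "height j c < height i c"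
      using height_order[of i j c] j(2)[OF i(1)] actD[OF i(1)] actD[OF j(1)] by simp
    then show ?thesis using hi by simp
  qed (use hi in simp)
  show "path_cell j c = rim lam c"
    using height_rim[of j c] actD[OF j(1)] h by simp
qed

lemma nested_iff_strictly_below:
  assumes i: "i < k" and j: "j < k"
  shows "strictly_below (Ls ! j) (Ls ! i) \<longleftrightarrow> a i < a j \<and> b j < b i"
proof
  assume sb: "strictly_below (Ls ! j) (Ls ! i)"
  have within: "a i \<le> c \<and> c \<le> b i" if c: "a j \<le> c" "c \<le> b j" for c
  proof -
    obtain d v where v: "v \<in> set (Ls ! i)" "path_cell j c = (fst v + d, snd v + d)"
      by (rule strictly_belowE[OF sb path_cell_props(1)[OF j c]])
    have "content lam v = c" using path_cell_props(2)[OF j c] v(2) by (simp add: content_def)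
    then show ?thesis using path_cell_cover[OF i v(1)] by simp
  qed
  have "i \<noteq> j"
  proof
    assume "i = j"
    then show False using sb path(2)[OF i] by (simp add: strictly_below_def)
  qed
  then have "a i < a j"
    using within[of "a j"] path_start_le_end[OF j] start_inj[OF i j] by (metis le_less order_refl)
  moreover from this have "b j < b i" using nested[OF i j] within[of "a j"] path_start_le_end[OF j] within[of "b j"] by simp
  ultimately show "a i < a j \<and> b j < b i" ..
next
  assume ab: "a i < a j \<and> b j < b i"
  then have "i \<noteq> j" by auto
  have "\<exists>d. \<exists>v\<in>set (Ls ! i). u = (fst v + d, snd v + d)" if u: "u \<in> set (Ls ! j)" for u
  proof -
    let ?c = "content lam u"
    have c: "a j \<le> ?c" "?c \<le> b j" "path_cell j ?c = u" using path_cell_cover[OF j u] by auto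
    have ci: "a i \<le> ?c" "?c \<le> b i" using c ab by auto
    have less: "height j ?c < height i ?c" using height_order[OF i j] ab c by simp
    have "fst u + height j ?c = fst (path_cell i ?c) + height i ?c" "snd u + height j ?c = snd (path_cell i ?c) + height i ?c"
      using height_rim[OF i ci] height_rim[OF j c(1,2)] c(3) by simp_all
    then have "fst u = fst (path_cell i ?c) + (height i ?c - height j ?c)"
      "snd u = snd (path_cell i ?c) + (height i ?c - height j ?c)" using less by linarith+
    then have "u = (fst (path_cell i ?c) + (height i ?c - height j ?c), snd (path_cell i ?c) + (height i ?c - height j ?c))"
      by (intro prod_eqI) simp_all
    then show ?thesis using path_cell_props(1)[OF i ci] by blast
  qed
  then show "strictly_below (Ls ! j) (Ls ! i)"
    using disjoint_paths[OF i j \<open>i \<noteq> j\<close>] by (auto simp: strictly_below_def weakly_below_def)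
qed

end

locale ranked_kreiman = kreiman +
  assumes ranked_poset: "ranked (set Ls) strictly_below"
    and above: "\<And>i j. i < length Ls \<Longrightarrow> j < length Ls \<Longrightarrow> strictly_below (Ls ! i) (Ls ! j) \<Longrightarrow>
      first_step_up (Ls ! j) \<and> last_step_down (Ls ! j) \<and> peaks (Ls ! j) \<subseteq> high_peaks lam (Ls ! j)"
begin

definition rank :: "nat \<Rightarrow> nat" where
  "rank i = poset_rank (set Ls) strictly_below (Ls ! i)"

lemma rank_function: "is_rank_function (set Ls) strictly_below (poset_rank (set Ls) strictly_below)"
  unfolding poset_rank_def using ranked_poset unfolding ranked_def by (rule someI_ex)

lemma rank_minimal:
  assumes j: "j < k" and none: "\<And>m. m < k \<Longrightarrow> \<not> strictly_below (Ls ! m) (Ls ! j)"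
  shows "rank j = 0"
proof -
  have "\<not> strictly_below y (Ls ! j)" if "y \<in> set Ls" for y
    using that none by (auto simp: in_set_conv_nth k_def)
  then have "minimal_in (set Ls) strictly_below (Ls ! j)"
    using path(5)[OF j] by (simp add: minimal_in_def)
  then show ?thesis using rank_function by (simp add: is_rank_function_def rank_def)
qed

text \<open>A path between the two in the poset would be active at \<open>c\<close> and have a depth strictly in between.\<close>

lemma rank_cover:
  assumes ij: "i \<in> act c" "j \<in> act c" "depth j = Suc (depth i)"
  shows "rank i = Suc (rank j)"
proof -
  have i: "i < k" and j: "j < k" using ij actD by auto
  have a: "a i < a j" using depth_less_iff[of i c j] ij by simp
  have "strictly_below (Ls ! j) (Ls ! i)"
    using nested_iff_strictly_below[OF i j] a act_nested[OF ij(1,2) a] by simp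
  moreover have "\<not> (strictly_below (Ls ! j) z \<and> strictly_below z (Ls ! i))" if z: "z \<in> set Ls" for z
  proof
    assume sb: "strictly_below (Ls ! j) z \<and> strictly_below z (Ls ! i)"
    obtain m where m: "m < k" "z = Ls ! m" using z by (auto simp: in_set_conv_nth k_def)
    have n: "a m < a j" "b j < b m" "a i < a m" "b m < b i"
      using sb nested_iff_strictly_below[OF m(1) j] nested_iff_strictly_below[OF i m(1)] m(2) by auto
    then have "m \<in> act c" using m(1) actD[OF ij(2)] by (simp add: act_def)
    then have "depth i < depth m" "depth m < depth j" using depth_strict_mono n ij by blast+
    then show False using ij(3) by simp
  qed
  ultimately have "covers_in (set Ls) strictly_below (Ls ! i) (Ls ! j)"
    using path(5)[OF i] path(5)[OF j] by (simp add: covers_in_def)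
  then show ?thesis using rank_function by (simp add: is_rank_function_def rank_def)
qed

lemma rank_depth_act:
  assumes "i \<in> act c" "j \<in> act c"
  shows "rank i + depth i = rank j + depth j"
proof -
  have "0 < card (act c)" unfolding card_gt_0_iff using assms(1) by auto
  then have "0 \<in> depth ` act c" unfolding depth_image by simp
  then obtain o' where o': "o' \<in> act c" "depth o' = 0" by auto
  have "rank m + n = rank o'" if "m \<in> act c" "depth m = n" for m n
    using that
  proof (induction n arbitrary: m)
    case 0
    then have "m = o'" using inj_onD[OF depth_inj[of c], of m o'] o' by simp
    then show ?case by simp
  next
    case (Suc n)
    have "Suc n < card (act c)" using depth_less_card[OF Suc.prems(1)] Suc.prems(2) by simp
    then have "n \<in> depth ` act c" unfolding depth_image by simp
    then obtain m' where m': "m' \<in> act c" "depth m' = n" by auto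
    then have "rank m' = Suc (rank m)" using rank_cover[OF m'(1) Suc.prems(1)] Suc.prems(2) by simp
    then show ?case using Suc.IH[OF m'] by simp
  qed
  then show ?thesis using assms by metis
qed

text \<open>On each component of the shape this is the rank of the outermost path, which has depth 0.\<close>

definition offset :: "cell \<Rightarrow> nat" where
  "offset u = rank (index u) + level u"

lemma index_act:
  assumes "u \<in> S"
  shows "index u \<in> act (content lam u)" "cell (index u) (content lam u) = u" "level u = depth (index u)"
proof -
  obtain i where i: "i \<in> act (content lam u)" "cell i (content lam u) = u" by (rule cell_cover[OF assms])
  then have "index u = i" using index_cell[OF i(1)] by simp
  then show "index u \<in> act (content lam u)" "cell (index u) (content lam u) = u" "level u = depth (index u)"
    using i cell_props(3)[OF i(1)] by simp_all
qed

text \<open>The strips active at one of two neighbouring contents are among those active at the other.\<close>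

lemma offset_adjacent:
  assumes "u \<in> S" "v \<in> S" "content lam v = Suc (content lam u)"
  shows "offset u = offset v"
proof -
  note u = index_act[OF assms(1)] and v = index_act[OF assms(2)]
  show ?thesis
  proof (cases "rim_up lam (content lam u)")
    case True
    then have "index v \<in> act (content lam u)" using act_up v(1) assms(3) by auto
    then show ?thesis unfolding offset_def u(3) v(3) by (rule rank_depth_act[OF u(1)])
  next
    case False
    then have "index u \<in> act (content lam v)" using act_right u(1) assms(3) by auto
    then show ?thesis unfolding offset_def u(3) v(3) by (rule rank_depth_act[OF _ v(1)])
  qed
qed

lemma offset_order:
  assumes uv: "u \<in> S" "v \<in> S" "fst u \<le> fst v" "snd u \<le> snd v"
  shows "offset u = offset v"
proof -
  have between: "w \<in> S" if "fst u \<le> fst w" "fst w \<le> fst v" "snd u \<le> snd w" "snd w \<le> snd v" for w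
    using S_convex uv(1,2) that unfolding order_convex_def by blast
  have row: "offset (fst u, s) = offset u" if "snd u \<le> s" "s \<le> snd v" for s
    using that
  proof (induction s rule: dec_induct)
    case (step n)
    have mem: "(fst u, n) \<in> S" "(fst u, Suc n) \<in> S"
      using between[of "(fst u, n)"] between[of "(fst u, Suc n)"] uv step by simp_all
    then have "content lam (fst u, Suc n) = Suc (content lam (fst u, n))"
      using content_right[of "fst u" n] S_subset by blast
    then show ?case using offset_adjacent[OF mem] step by simp
  qed simp
  have col: "offset (r, snd v) = offset (fst u, snd v)" if "fst u \<le> r" "r \<le> fst v" for r
    using that
  proof (induction r rule: dec_induct)
    case (step n)
    have mem: "(n, snd v) \<in> S" "(Suc n, snd v) \<in> S"
      using between[of "(n, snd v)"] between[of "(Suc n, snd v)"] uv step by simp_all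
    then have "content lam (n, snd v) = Suc (content lam (Suc n, snd v))"
      using content_down[of n "snd v"] S_subset by blast
    then show ?case using offset_adjacent[OF mem(2,1)] step by simp
  qed simp
  show ?thesis using row[of "snd v"] col[of "fst v"] uv by simp
qed

lemma cell_at_level:
  assumes "c \<in> contents lam" "d < card (act c)" "rim lam c = (r + d, s + d)"
  shows "(r, s) \<in> S"
proof -
  have "d \<in> level ` {u \<in> S. content lam u = c}" unfolding level_image[OF assms(1)] using assms(2) by simp
  then obtain u where u: "u \<in> S" "content lam u = c" "level u = d" by blast
  then have "rim lam c = (fst u + d, snd u + d)" using level_rim[of u] S_subset by blast
  then have "u = (r, s)" using assms(3) by (simp add: prod_eq_iff)
  then show ?thesis using u(1) by simp
qed

text \<open>A cell without a northwest neighbour has the greatest level on its diagonal.\<close>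

lemma innermost_top:
  assumes v: "v \<in> S" and top: "(fst v - 1, snd v - 1) \<notin> S"
  shows "card (act (content lam v)) = Suc (level v)"
    and "i \<in> act (content lam v) \<Longrightarrow> i \<noteq> index v \<Longrightarrow> a i < a (index v)"
proof -
  let ?c = "content lam v"
  note j = index_act[OF v]
  have K: "?c \<in> contents lam" by (rule act_contents[OF j(1)])
  have b: "1 \<le> fst v" "1 \<le> snd v" using diagram_bounds[of v] v S_subset by auto
  have R: "rim lam ?c = (fst v + level v, snd v + level v)" using level_rim[of v] v S_subset by auto
  have "\<not> Suc (level v) < card (act ?c)"
  proof
    assume less: "Suc (level v) < card (act ?c)"
    have "(fst v - 1, snd v - 1) \<in> S"
      by (rule cell_at_level[OF K less]) (use R b in simp)
    then show False using top by simp
  qed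
  then show card: "card (act ?c) = Suc (level v)" using depth_less_card[OF j(1)] j(3) by simp
  show "a i < a (index v)" if i: "i \<in> act ?c" "i \<noteq> index v"
  proof -
    have "depth i \<noteq> depth (index v)" using inj_onD[OF depth_inj[of ?c], of i "index v"] i j(1) by auto
    then have "depth i < depth (index v)" using depth_less_card[OF i(1)] card j(3) by simp
    then show ?thesis using depth_less_iff[OF i(1) j(1)] by simp
  qed
qed

text \<open>The innermost path \<open>j\<close> is on the rim at content \<open>c\<close> and goes on, so no strip ends there. Over an up step of the rim,
the next diagonal then has at least as many cells. Over a right step, path \<open>j\<close> rises to height 1, so another path
must start on the rim, and the next diagonal has more cells. In both cases these include the cell above \<open>v\<close>.\<close>

lemma up_step_not_minimal:
  assumes v: "v \<in> S" and top: "(fst v - 1, snd v - 1) \<notin> S"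
    and c: "c = content lam v" and j: "j = index v" "c < b j" "up_step (path_cell j c) (path_cell j (Suc c))"
  shows "(fst v - 1, snd v) \<in> S"
proof -
  note J = index_act[OF v, folded j(1) c]
  note inner = innermost_top[OF v top, folded j(1) c]
  have jk: "j < k" "a j \<le> c" "c \<le> b j" using actD[OF J(1)] by auto
  have rim: "height j c = 0" "path_cell j c = rim lam c" using innermost_on_rim[OF J(1)] inner(2) by auto
  have K: "c \<in> contents lam" "Suc c \<in> contents lam"
    using path_cell_props(4)[OF jk(1), of c] path_cell_props(4)[OF jk(1), of "Suc c"] jk j(2) by auto
  have b: "1 \<le> fst v" using diagram_bounds[of v] v S_subset by auto
  have R: "rim lam c = (fst v + level v, snd v + level v)" using level_rim[of v] v S_subset c by auto
  have sub: "act c \<subseteq> act (Suc c)"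
  proof
    fix i assume i: "i \<in> act c"
    have "b i \<noteq> c"
    proof
      assume bi: "b i = c"
      have "i \<noteq> j" using bi j(2) by auto
      moreover have "height i c = 0" using height_end[of i] actD[OF i] bi by simp
      ultimately show False using height_distinct[of i j c] rim(1) actD[OF i] jk by simp
    qed
    then show "i \<in> act (Suc c)" using actD[OF i] by (simp add: act_def)
  qed
  show ?thesis
  proof (cases "rim_up lam c")
    case True
    have "level v < card (act (Suc c))" using card_mono[OF _ sub] inner(1) by simp
    then show ?thesis
      by (rule cell_at_level[OF K(2)]) (use rim_step_up[OF K True] R b in \<open>simp add: prod_eq_iff\<close>)
  next
    case False
    have hj: "height j (Suc c) = 1" using height_step(4)[OF jk(1,2) j(2) False j(3)] rim(1) by simp
    have "0 \<in> level ` {u \<in> S. content lam u = Suc c}"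
      unfolding level_image[OF K(2)] using card_mono[OF _ sub] inner(1) by simp
    then obtain m where m: "m \<in> act (Suc c)" "level (path_cell m (Suc c)) = 0" unfolding S_diagonal by auto
    then have hm: "height m (Suc c) = 0"
      using path_cell_props(2)[of m "Suc c"] actD[OF m(1)] by (simp add: level_def height_def)
    have "m \<notin> act c"
    proof
      assume mc: "m \<in> act c"
      have "m \<noteq> j" using hm hj by auto
      then have "height j (Suc c) < height m (Suc c)"
        using height_order[of m j "Suc c"] inner(2)[OF mc] actD[OF m(1)] jk j(2) by simp
      then show False using hm by simp
    qed
    then have "card (insert m (act c)) = Suc (Suc (level v))" using inner(1) by simp
    moreover have "card (insert m (act c)) \<le> card (act (Suc c))"
      by (rule card_mono) (use sub m in auto)
    ultimately have "Suc (level v) < card (act (Suc c))" by simp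
    then show ?thesis
      by (rule cell_at_level[OF K(2)]) (use rim_step_right[OF K(1) False] R b in \<open>simp add: prod_eq_iff\<close>)
  qed
qed

text \<open>The reflection of \<open>up_step_not_minimal\<close>: no strip starts at content \<open>Suc e\<close>, and over an up step of the rim some
other path ends at content \<open>e\<close>.\<close>

lemma down_step_not_minimal:
  assumes v: "v \<in> S" and top: "(fst v - 1, snd v - 1) \<notin> S"
    and e: "Suc e = content lam v" and j: "j = index v" "a j \<le> e" "down_step (path_cell j e) (path_cell j (Suc e))"
  shows "(fst v, snd v - 1) \<in> S"
proof -
  note J = index_act[OF v, folded j(1) e]
  note inner = innermost_top[OF v top, folded j(1) e]
  have jk: "j < k" "Suc e \<le> b j" using actD[OF J(1)] by auto
  have rim: "height j (Suc e) = 0" "path_cell j (Suc e) = rim lam (Suc e)" using innermost_on_rim[OF J(1)] inner(2) by auto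
  have K: "e \<in> contents lam" "Suc e \<in> contents lam"
    using path_cell_props(4)[OF jk(1), of e] path_cell_props(4)[OF jk(1), of "Suc e"] jk j(2) by auto
  have b: "1 \<le> snd v" using diagram_bounds[of v] v S_subset by auto
  have R: "rim lam (Suc e) = (fst v + level v, snd v + level v)" using level_rim[of v] v S_subset e by auto
  have sub: "act (Suc e) \<subseteq> act e"
  proof
    fix i assume i: "i \<in> act (Suc e)"
    have "a i \<noteq> Suc e"
    proof
      assume ai: "a i = Suc e"
      have "i \<noteq> j" using ai j(2) by auto
      moreover have "height i (Suc e) = 0" using height_start[of i] actD[OF i] ai by simp
      ultimately show False using height_distinct[of i j "Suc e"] rim(1) actD[OF i] jk j(2) by simp
    qed
    then show "i \<in> act e" using actD[OF i] by (simp add: act_def)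
  qed
  show ?thesis
  proof (cases "rim_up lam e")
    case False
    have "level v < card (act e)" using card_mono[OF _ sub] inner(1) by simp
    then show ?thesis
      by (rule cell_at_level[OF K(1)]) (use rim_step_right[OF K(1) False] R b in \<open>simp add: prod_eq_iff\<close>)
  next
    case True
    have hj: "height j e = 1" using height_step(2)[OF jk(1) j(2) _ True j(3)] jk(2) rim(1) by simp
    have "0 \<in> level ` {u \<in> S. content lam u = e}"
      unfolding level_image[OF K(1)] using card_mono[OF _ sub] inner(1) by simp
    then obtain m where m: "m \<in> act e" "level (path_cell m e) = 0" unfolding S_diagonal by auto
    then have hm: "height m e = 0"
      using path_cell_props(2)[of m e] actD[OF m(1)] by (simp add: level_def height_def)
    have "m \<notin> act (Suc e)"
    proof
      assume mc: "m \<in> act (Suc e)"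
      have "m \<noteq> j" using hm hj by auto
      then have "height j e < height m e"
        using height_order[of m j e] inner(2)[OF mc] actD[OF m(1)] jk j(2) by simp
      then show False using hm by simp
    qed
    then have "card (insert m (act (Suc e))) = Suc (Suc (level v))" using inner(1) by simp
    moreover have "card (insert m (act (Suc e))) \<le> card (act e)"
      by (rule card_mono) (use sub m in auto)
    ultimately have "Suc (level v) < card (act e)" by simp
    then show ?thesis
      by (rule cell_at_level[OF K(1)]) (use rim_step_up[OF K True] R b in \<open>simp add: prod_eq_iff\<close>)
  qed
qed

text \<open>Otherwise some path is below the path \<open>j\<close> of the innermost strip at \<open>v\<close>. Path \<open>j\<close> contains the rim cell on the diagonal
of \<open>v\<close>; as \<open>v\<close> is minimal, it neither leaves this cell by an up step nor enters it by a down step. By the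
hypothesis on its first and last steps the cell is then a peak, and a peak on the rim is not high.\<close>

lemma rank_minimal_cell:
  assumes v: "v \<in> S" and up: "(fst v - 1, snd v) \<notin> S" and left: "(fst v, snd v - 1) \<notin> S"
  shows "rank (index v) = 0"
proof (rule rank_minimal)
  define c where "c = content lam v"
  define j where "j = index v"
  note J = index_act[OF v, folded j_def c_def]
  have jk: "j < k" "a j \<le> c" "c \<le> b j" using actD[OF J(1)] by auto
  show "index v < k" using jk(1) by (simp add: j_def)
  have top: "(fst v - 1, snd v - 1) \<notin> S"
  proof
    assume t: "(fst v - 1, snd v - 1) \<in> S"
    have "(fst v - 1, snd v) \<in> S"
      by (rule S_convex[unfolded order_convex_def, rule_format, OF t v]) simp
    then show False using up by simp
  qed
  have rim: "path_cell j c = rim lam c"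
    using innermost_on_rim(2)[OF J(1)] innermost_top(2)[OF v top, folded j_def c_def] by blast
  fix m assume m: "m < k"
  show "\<not> strictly_below (Ls ! m) (Ls ! index v)"
  proof
    assume sb: "strictly_below (Ls ! m) (Ls ! index v)"
    then have hyp: "first_step_up (Ls ! j)" "last_step_down (Ls ! j)" "peaks (Ls ! j) \<subseteq> high_peaks lam (Ls ! j)"
      using above[of m j] m jk(1) by (auto simp: k_def j_def)
    have len: "b j + 1 = a j + length (Ls ! j)" by (rule length_path[OF jk(1)])
    have no_up: "\<not> up_step (path_cell j c) (path_cell j (Suc c))" if "c < b j"
      using up_step_not_minimal[OF v top c_def j_def that] up by blast
    have no_down: "\<not> down_step (path_cell j e) (path_cell j (Suc e))" if "c = Suc e" "a j \<le> e" for e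
      using down_step_not_minimal[OF v top _ j_def that(2)] that(1) left by (auto simp: c_def)
    have not_start: "a j \<noteq> c"
    proof
      assume "a j = c"
      moreover from this hyp(1) len have "c < b j" by (simp add: first_step_up_def)
      ultimately show False using no_up hyp(1) by (simp add: first_step_up_def path_cell_def)
    qed
    then obtain e where e: "c = Suc e" "a j \<le> e" using jk(2) by (cases c) auto
    have not_end: "c \<noteq> b j"
    proof
      assume cb: "c = b j"
      then have "length (Ls ! j) - 2 = e - a j" "length (Ls ! j) - 1 = Suc e - a j" using len e by auto
      then show False using no_down[OF e] hyp(2) by (simp add: last_step_down_def path_cell_def)
    qed
    then have cb: "c < b j" using jk(3) by simp
    have down: "down_step (path_cell j c) (path_cell j (Suc c))" using path_cell_step[OF jk(1,2) cb] no_up[OF cb] by blast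
    have ups: "up_step (path_cell j e) (path_cell j c)" using path_cell_step[OF jk(1) e(2)] no_down[OF e] e cb by auto
    have "path_cell j c \<in> peaks (Ls ! j)"
      unfolding peaks_def
    proof (intro CollectI exI[of _ "c - a j"] conjI)
      show "path_cell j c = Ls ! j ! (c - a j)" by (simp add: path_cell_def)
      show "0 < c - a j" "c - a j + 1 < length (Ls ! j)" using e cb len by auto
      have "c - a j - 1 = e - a j" "c - a j + 1 = Suc c - a j" using e by auto
      then show "up_step (Ls ! j ! (c - a j - 1)) (Ls ! j ! (c - a j))"
        "down_step (Ls ! j ! (c - a j)) (Ls ! j ! (c - a j + 1))"
        using down ups unfolding path_cell_def by simp_all
    qed
    then have "(fst (path_cell j c) + 1, snd (path_cell j c) + 1) \<in> Y" using hyp(3) by (auto simp: high_peaks_def)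
    then show False using rim rim_props(3)[OF act_contents[OF J(1)]] by simp
  qed
qed

lemma minimal_cell_below:
  assumes "u \<in> S"
  shows "\<exists>v\<in>S. fst v \<le> fst u \<and> snd v \<le> snd u \<and> (fst v - 1, snd v) \<notin> S \<and> (fst v, snd v - 1) \<notin> S"
  using assms
proof (induction "fst u + snd u" arbitrary: u rule: less_induct)
  case less
  have b: "1 \<le> fst u" "1 \<le> snd u" using diagram_bounds[of u] less.prems S_subset by auto
  consider "(fst u - 1, snd u) \<in> S" | "(fst u, snd u - 1) \<in> S"
    | "(fst u - 1, snd u) \<notin> S" "(fst u, snd u - 1) \<notin> S" by blast
  then show ?case
  proof cases
    case 1
    then obtain v where "v \<in> S" "fst v \<le> fst u - 1 \<and> snd v \<le> snd u \<and> (fst v - 1, snd v) \<notin> S \<and> (fst v, snd v - 1) \<notin> S"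
      using less.hyps[of "(fst u - 1, snd u)"] b by auto
    then show ?thesis by (intro bexI[of _ v]) auto
  next
    case 2
    then obtain v where "v \<in> S" "fst v \<le> fst u \<and> snd v \<le> snd u - 1 \<and> (fst v - 1, snd v) \<notin> S \<and> (fst v, snd v - 1) \<notin> S"
      using less.hyps[of "(fst u, snd u - 1)"] b by auto
    then show ?thesis by (intro bexI[of _ v]) auto
  next
    case 3
    then show ?thesis using less.prems by (intro bexI[of _ u]) auto
  qed
qed

text \<open>The bound holds at a minimal cell below \<open>u\<close>, and \<open>\<eta> + level - offset\<close> is monotone, since the offset is the same at
comparable cells.\<close>

lemma filling_ge_rank:
  assumes \<eta>: "\<eta> \<in> fillings H" and u: "u \<in> S"
  shows "rank (index u) \<le> \<eta> u"
proof -
  obtain v where v: "v \<in> S" "fst v \<le> fst u" "snd v \<le> snd u" "(fst v - 1, snd v) \<notin> S" "(fst v, snd v - 1) \<notin> S"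
    using minimal_cell_below[OF u] by blast
  have rpp: "(\<lambda>u. if u \<in> S then \<eta> u + level u else 0) \<in> RPP S"
    using \<eta> unfolding fillings_def by blast
  have "rank (index u) + level u = offset v"
    using offset_order[OF v(1) u v(2,3)] unfolding offset_def by (rule sym)
  also have "\<dots> = level v" unfolding offset_def rank_minimal_cell[OF v(1,4,5)] by simp
  also have "\<dots> \<le> \<eta> v + level v" by simp
  also have "\<dots> \<le> \<eta> u + level u"
    using RPP_order_mono[OF S_convex rpp v(1) u v(2,3)] v(1) u by simp
  finally show ?thesis by simp
qed

definition total_shift :: nat where
  "total_shift = (\<Sum>i<k. rank i * card (set (Ls ! i)))"

lemma sum_rank_index: "(\<Sum>u\<in>S. rank (index u)) = total_shift"
proof -
  have "(\<Sum>u\<in>S. rank (index u)) = (\<Sum>(i, c)\<in>Sigma {..<k} (\<lambda>i. {a i..b i}). rank i)"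
  proof (rule sum.reindex_bij_witness[of _ "\<lambda>(i, c). cell i c" "\<lambda>u. (index u, content lam u)"])
    fix u assume u: "u \<in> S"
    note J = index_act[OF u]
    show "(case (index u, content lam u) of (i, c) \<Rightarrow> cell i c) = u" using J by simp
    show "(index u, content lam u) \<in> Sigma {..<k} (\<lambda>i. {a i..b i})" using actD[OF J(1)] by simp
  next
    fix p assume p: "p \<in> Sigma {..<k} (\<lambda>i. {a i..b i})"
    obtain i c where ic: "p = (i, c)" by fastforce
    then have "i \<in> act c" using p by (simp add: act_def)
    then show "(index (case p of (i, c) \<Rightarrow> cell i c), content lam (case p of (i, c) \<Rightarrow> cell i c)) = p"
      "(case p of (i, c) \<Rightarrow> cell i c) \<in> S"
      using ic index_cell cell_props by simp_all
  qed simp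
  also have "\<dots> = (\<Sum>i<k. \<Sum>c\<in>{a i..b i}. rank i)" by (rule sum.Sigma[symmetric]) auto
  also have "\<dots> = total_shift"
    unfolding total_shift_def
  proof (rule sum.cong[OF refl])
    fix i assume "i \<in> {..<k}"
    then have i: "i < k" by simp
    have "card (set (Ls ! i)) = length (Ls ! i)"
      by (rule distinct_card[OF dyck_path_distinct[OF path(1)[OF i]]])
    also have "\<dots> = card {a i..b i}" using length_path[OF i] by simp
    finally show "(\<Sum>c\<in>{a i..b i}. rank i) = rank i * card (set (Ls ! i))" by simp
  qed
  finally show ?thesis .
qed

text \<open>The bijection adds to each entry the rank of its strip. In terms of \<open>\<eta> + level\<close> it adds the offset, which preserves
and reflects the order conditions.\<close>

lemma card_fillings:
  "card {\<eta> \<in> fillings n. (\<Sum>u\<in>S. \<eta> u) = n} = card {\<pi> \<in> RPP S. (\<Sum>u\<in>S. \<pi> u) + total_shift = n}"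
    (is "card ?F = card ?R")
proof (rule bij_betw_same_card[symmetric])
  let ?to = "\<lambda>\<pi> u. if u \<in> S then \<pi> u + rank (index u) else (0::nat)"
  let ?from = "\<lambda>\<eta> u. if u \<in> S then \<eta> u - rank (index u) else (0::nat)"
  have weight: "(\<Sum>u\<in>S. ?to \<pi> u) = (\<Sum>u\<in>S. \<pi> u) + total_shift" for \<pi>
    by (simp add: sum.distrib sum_rank_index)
  have out: "\<pi> u = 0" if "\<pi> \<in> RPP S" "u \<notin> S" for \<pi> u
    using that unfolding RPP_def by blast
  have fillD: "\<eta> u = 0" if "\<eta> \<in> fillings n" "u \<notin> S" for \<eta> u
    using that unfolding fillings_def by blast
  have from_eq: "?to (?from \<eta>) = \<eta>" if "\<eta> \<in> fillings n" for \<eta>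
  proof
    fix u show "?to (?from \<eta>) u = \<eta> u"
      using filling_ge_rank[OF that, of u] fillD[OF that, of u] by (cases "u \<in> S") simp_all
  qed
  have lift: "\<pi> \<in> RPP S \<longleftrightarrow> (\<lambda>u. if u \<in> S then \<pi> u + offset u else 0) \<in> RPP S" (is "_ \<longleftrightarrow> ?q \<in> _")
    if zero: "\<And>u. u \<notin> S \<Longrightarrow> \<pi> u = 0" for \<pi>
  proof -
    have eq: "?q u \<le> ?q v \<longleftrightarrow> \<pi> u \<le> \<pi> v" if "u \<in> S" "v \<in> S" "fst u \<le> fst v" "snd u \<le> snd v" for u v
      using that offset_order[OF that] by simp
    show ?thesis
    proof
      assume p: "\<pi> \<in> RPP S"
      show "?q \<in> RPP S"
      proof (rule RPP_adjacentI[OF S_convex])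
        fix r s
        show "(r, s) \<in> S \<Longrightarrow> (r, Suc s) \<in> S \<Longrightarrow> ?q (r, s) \<le> ?q (r, Suc s)"
          using eq[of "(r, s)" "(r, Suc s)"] RPP_order_mono[OF S_convex p, of "(r, s)" "(r, Suc s)"] by simp
        show "(r, s) \<in> S \<Longrightarrow> (Suc r, s) \<in> S \<Longrightarrow> ?q (r, s) \<le> ?q (Suc r, s)"
          using eq[of "(r, s)" "(Suc r, s)"] RPP_order_mono[OF S_convex p, of "(r, s)" "(Suc r, s)"] by simp
      qed simp
    next
      assume p: "?q \<in> RPP S"
      show "\<pi> \<in> RPP S"
      proof (rule RPP_adjacentI[OF S_convex zero])
        fix r s
        show "(r, s) \<in> S \<Longrightarrow> (r, Suc s) \<in> S \<Longrightarrow> \<pi> (r, s) \<le> \<pi> (r, Suc s)"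
          using eq[of "(r, s)" "(r, Suc s)"] RPP_order_mono[OF S_convex p, of "(r, s)" "(r, Suc s)"] by simp
        show "(r, s) \<in> S \<Longrightarrow> (Suc r, s) \<in> S \<Longrightarrow> \<pi> (r, s) \<le> \<pi> (Suc r, s)"
          using eq[of "(r, s)" "(Suc r, s)"] RPP_order_mono[OF S_convex p, of "(r, s)" "(Suc r, s)"] by simp
      qed
    qed
  qed
  have to_level: "(\<lambda>u. if u \<in> S then ?to \<pi> u + level u else 0) = (\<lambda>u. if u \<in> S then \<pi> u + offset u else 0)" for \<pi>
    by (auto simp: fun_eq_iff offset_def)
  show "bij_betw ?to ?R ?F"
  proof (rule bij_betw_byWitness[where f' = ?from])
    show "\<forall>\<pi>\<in>?R. ?from (?to \<pi>) = \<pi>"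
    proof (intro ballI ext)
      fix \<pi> u assume "\<pi> \<in> ?R"
      then show "?from (?to \<pi>) u = \<pi> u" using out[of \<pi> u] by (cases "u \<in> S") simp_all
    qed
    show "\<forall>\<eta>\<in>?F. ?to (?from \<eta>) = \<eta>" using from_eq by blast
    show "?to ` ?R \<subseteq> ?F"
    proof
      fix \<eta> assume "\<eta> \<in> ?to ` ?R"
      then obtain \<pi> where p: "\<pi> \<in> RPP S" "(\<Sum>u\<in>S. \<pi> u) + total_shift = n" and e: "\<eta> = ?to \<pi>" by blast
      have sum: "(\<Sum>u\<in>S. \<eta> u) = n" using weight[of \<pi>] p(2) unfolding e by simp
      have "\<eta> u \<le> n" if "u \<in> S" for u
        using member_le_sum[OF that _ finite_S, of \<eta>] sum by simp
      moreover have "(\<lambda>u. if u \<in> S then \<eta> u + level u else 0) \<in> RPP S"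
        unfolding e to_level using lift[OF out[OF p(1)]] p(1) by simp
      moreover have "\<eta> u = 0" if "u \<notin> S" for u using that by (simp add: e)
      ultimately have "\<eta> \<in> fillings n" unfolding fillings_def by blast
      then show "\<eta> \<in> ?F" using sum by simp
    qed
    show "?from ` ?F \<subseteq> ?R"
    proof
      fix \<pi> assume "\<pi> \<in> ?from ` ?F"
      then obtain \<eta> where h: "\<eta> \<in> fillings n" "(\<Sum>u\<in>S. \<eta> u) = n" and e: "\<pi> = ?from \<eta>" by blast
      have restored: "?to \<pi> = \<eta>" unfolding e by (rule from_eq[OF h(1)])
      have "(\<lambda>u. if u \<in> S then \<eta> u + level u else 0) \<in> RPP S" using h(1) unfolding fillings_def by blast
      also have "(\<lambda>u. if u \<in> S then \<eta> u + level u else 0) = (\<lambda>u. if u \<in> S then \<pi> u + offset u else 0)"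
      proof
        fix u show "(if u \<in> S then \<eta> u + level u else 0) = (if u \<in> S then \<pi> u + offset u else 0)"
          using fun_cong[OF restored, of u] by (cases "u \<in> S") (simp_all add: offset_def)
      qed
      finally have "(\<lambda>u. if u \<in> S then \<pi> u + offset u else 0) \<in> RPP S" .
      then have "\<pi> \<in> RPP S" using lift[of \<pi>] by (simp add: e)
      moreover have "(\<Sum>u\<in>S. \<pi> u) + total_shift = n" using weight[of \<pi>] h(2) unfolding restored by simp
      ultimately show "\<pi> \<in> ?R" by simp
    qed
  qed
qed

theorem det_eq_shifted_RPP_gf:
  "rdet k (\<lambda>i j. E_gf lam (hd (Ls ! i)) (last (Ls ! j))) = fps_X ^ total_shift * RPP_gf S"
proof (rule fps_ext)
  fix n :: nat
  have "card {\<pi> \<in> RPP S. (\<Sum>u\<in>S. \<pi> u) + total_shift = n} =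
     (if n < total_shift then 0 else card {\<pi> \<in> RPP S. (\<Sum>u\<in>S. \<pi> u) = n - total_shift})"
  proof (cases "n < total_shift")
    case True
    then have empty: "{\<pi> \<in> RPP S. (\<Sum>u\<in>S. \<pi> u) + total_shift = n} = {}" by auto
    show ?thesis unfolding empty using True by simp
  next
    case False
    then have eq: "{\<pi> \<in> RPP S. (\<Sum>u\<in>S. \<pi> u) + total_shift = n} = {\<pi> \<in> RPP S. (\<Sum>u\<in>S. \<pi> u) = n - total_shift}"
      by auto
    show ?thesis unfolding eq using False by simp
  qed
  then show "fps_nth (rdet k (\<lambda>i j. E_gf lam (hd (Ls ! i)) (last (Ls ! j)))) n =
      fps_nth (fps_X ^ total_shift * RPP_gf S) n"
    unfolding det_E_gf_nth card_fillings by (simp add: RPP_gf_def fps_X_power_mult_nth)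
qed

end

section \<open>The determinantal formula\<close>

theorem theorem6p1:
  fixes lam mu :: "nat list" and Ls :: "cell list list"
  assumes "int_partition lam" and "int_partition mu" and "diagram mu \<subseteq> diagram lam"
    and "kreiman_outer_decomposition lam mu Ls"
    and "ranked (set Ls) strictly_below"
    and "\<And>i j. i < length Ls \<Longrightarrow> j < length Ls \<Longrightarrow> strictly_below (Ls ! i) (Ls ! j) \<Longrightarrow>
           first_step_up (Ls ! j) \<and> last_step_down (Ls ! j) \<and> peaks (Ls ! j) \<subseteq> high_peaks lam (Ls ! j)"
  shows "fps_to_fls (RPP_gf (diagram lam - diagram mu)) =
           fls_X_intpow (- int (\<Sum>i<length Ls.
              poset_rank (set Ls) strictly_below (Ls ! i) * card (set (Ls ! i)))) *
           fps_to_fls (det (mat (length Ls) (length Ls)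
              (\<lambda>(i, j). E_gf lam (hd (Ls ! i)) (last (Ls ! j))))) \<and>
         (\<forall>i<length Ls. \<forall>j<length Ls.
            E_gf lam (hd (Ls ! i)) (last (Ls ! j)) =
              (\<Sum>D\<in>Dyck lam (hd (Ls ! i)) (last (Ls ! j)).
                 (\<Prod>u\<in>set D. 1 / (1 - fps_X ^ hook_length lam u)) *
                 (\<Prod>u\<in>valleys D. fps_X ^ hook_length lam u)))"
proof
  interpret ranked_kreiman lam mu Ls
    by unfold_locales (fact assms)+
  have det: "fps_to_fls (det (mat (length Ls) (length Ls) (\<lambda>(i, j). E_gf lam (hd (Ls ! i)) (last (Ls ! j))))) =
      fls_X ^ total_shift * fps_to_fls (RPP_gf (diagram lam - diagram mu))"
    using det_eq_shifted_RPP_gf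
    by (simp add: rdet_def k_def S_def fls_times_fps_to_fls fps_to_fls_power)
  have cancel: "fls_X_intpow (- int m) * (fls_X ^ m * f) = f" for m and f :: "rat fls"
    unfolding fls_X_power_times_conv_shift(1) fls_X_intpow_times_conv_shift(1) by simp
  have shift: "(\<Sum>i<length Ls. poset_rank (set Ls) strictly_below (Ls ! i) * card (set (Ls ! i))) = total_shift"
    by (simp add: total_shift_def rank_def k_def)
  show "fps_to_fls (RPP_gf (diagram lam - diagram mu)) =
      fls_X_intpow (- int (\<Sum>i<length Ls. poset_rank (set Ls) strictly_below (Ls ! i) * card (set (Ls ! i)))) *
      fps_to_fls (det (mat (length Ls) (length Ls) (\<lambda>(i, j). E_gf lam (hd (Ls ! i)) (last (Ls ! j)))))"
    unfolding shift det by (rule cancel[symmetric])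
  show "\<forall>i<length Ls. \<forall>j<length Ls.
            E_gf lam (hd (Ls ! i)) (last (Ls ! j)) =
              (\<Sum>D\<in>Dyck lam (hd (Ls ! i)) (last (Ls ! j)).
                 (\<Prod>u\<in>set D. 1 / (1 - fps_X ^ hook_length lam u)) *
                 (\<Prod>u\<in>valleys D. fps_X ^ hook_length lam u))"
  proof (intro allI impI)
    fix i j assume "i < length Ls" "j < length Ls"
    then have "i < k" "j < k" by (simp_all add: k_def)
    from E_gf_eq_Dyck_gf[OF path(3)[OF this(1)] path(4)[OF this(2)]]
    show "E_gf lam (hd (Ls ! i)) (last (Ls ! j)) =
              (\<Sum>D\<in>Dyck lam (hd (Ls ! i)) (last (Ls ! j)).
                 (\<Prod>u\<in>set D. 1 / (1 - fps_X ^ hook_length lam u)) *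
                 (\<Prod>u\<in>valleys D. fps_X ^ hook_length lam u))"
      by (simp add: Dyck_gf_def path_weight_def)
  qed
qed

end
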